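(* Let $M,N$ be pointed metric spaces and let $T:\mathcal{F}(M)\to\mathcal{F}(N)$ be a bounded linear operator such that there exists $k\in\mathbb{N}$ with $T(\mathcal{FS}_2(M))\subset\mathcal{FS}_k(N)$. Then the following properties are equivalent: (i) $T$ is compact; (ii) $T$ is weakly compact; (iii) $T$ is super strictly singular; (iv) $T$ is super strictly cosingular; (v) $T$ is strictly singular; (vi) $T$ is strictly cosingular; (vii) $T$ does not fix any copy of $\ell^1$; (viii) $T$ does not fix any complemented copy of $\ell^1$.
   Context: All vector spaces are over $\mathbb{C}$. A pointed metric space is a metric space $(M,d)$ with a distinguished point $0_M\in M$. $\mathrm{Lip}_0(M)$ is the Banach space of Lipschitz functions $g:M\to\mathbb{C}$ with $g(0_M)=0$, normed by $\|g\|_L=\sup_{x\neq y}\frac{|g(x)-g(y)|}{d(x,y)}$. For $x\in M$, $\delta(x)\in \mathrm{Lip}_0(M)^*$ is evaluation at $x$, $\langle g,\delta(x)\rangle=g(x)$ (so $\delta(0_M)=0$). The Lipschitz-free space $\mathcal{F}(M)$ is the norm-closed linear span of $\{\delta(x): x\in M\}$ in $\mathrm{Lip}_0(M)^*$. For $k\in\mathbb{N}$, $\mathcal{FS}_k(M)$ is the set of elements of $\mathcal{F}(M)$ whose support contains at most $k$ elements, i.e. the elements of the form $\sum_{i=1}^k a_i\delta(x_i)$ with $a_i\in\mathbb{C}$, $x_i\in M$. Let $X,Y$ be Banach spaces and $T:X\to Y$ a bounded linear operator; $S_E$ denotes the unit sphere and $B_X$ the closed unit ball; subspaces by which one takes quotients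 are closed; a supremum over an empty set is $0$. - $T$ is strictly singular if there is no infinite-dimensional (closed) subspace $E\subset X$ such that $T|_E$ is an isomorphism onto its range. - $T$ is strictly cosingular if for every closed subspace $Z\subset Y$ with $\dim(Y/Z)=\infty$, the map $Q\circ T:X\to Y/Z$ is not surjective, where $Q:Y\to Y/Z$ is the canonical quotient map. - $T$ is super strictly singular if for every $\varepsilon>0$ there is $N_\varepsilon\in\mathbb{N}$, $N_\varepsilon\ge 1$, such that for every subspace $E\subset X$ with $\dim(E)\ge N_\varepsilon$ there is $x\in S_E$ with $\|T(x)\|\le\varepsilon$; that is, $b_n(T):=\sup_{E\subset X,\ \dim E=n}\ \inf\{\|T(x)\|:x\in S_E\}\to 0$ as $n\to\infty$. - $T$ is super strictly cosingular if $a_n(T):=\sup\{\alpha_E(T): E\subset Y \text{ closed subspace},\ \dim(Y/E)=n\}\to 0$ as $n\to\infty$, where $\alpha_E(T):=\sup\{\alpha\ge 0:\alpha B_{Y/E}\subset Q\circ T(B_X)\}$ and $Q:Y\to Y/E$ is the canonical quotient map. - $T$ fixes a copy of $\ell^1$ if there are closed subspaces $E\subset X$ and $F\subset Y$, both isomorphic to $\ell^1$, such that $T|_E:E\to F$ is an isomorphism. $T$ fixes a complemented copy of $\ell^1$ if, in addition, $E$ and $F$ can be chosen so that $E$ is complemented in $X$ and $F$ is complemented in $Y$. *)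

theory Defs
  imports "HOL-Analysis.Analysis"
begin

section \<open>Complex normed vector spaces\<close>

class complex_vector = real_vector +
  fixes scaleC :: "complex \<Rightarrow> 'a \<Rightarrow> 'a"  (infixr "*\<^sub>C" 75)
  assumes scaleC_add_right: "c *\<^sub>C (x + y) = c *\<^sub>C x + c *\<^sub>C y"
    and scaleC_add_left: "(c + d) *\<^sub>C x = c *\<^sub>C x + d *\<^sub>C x"
    and scaleC_scaleC: "c *\<^sub>C d *\<^sub>C x = (c * d) *\<^sub>C x"
    and scaleC_one: "1 *\<^sub>C x = x"
    and scaleR_scaleC: "r *\<^sub>R x = complex_of_real r *\<^sub>C x"

class complex_normed_vector = complex_vector + real_normed_vector +
  assumes norm_scaleC: "norm (c *\<^sub>C x) = norm c * norm x"

global_interpretation complex_vector: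
  vector_space "scaleC :: complex \<Rightarrow> 'a \<Rightarrow> 'a::complex_vector"
  by unfold_locales (simp_all add: scaleC_add_right scaleC_add_left scaleC_scaleC scaleC_one)

instantiation complex :: complex_normed_vector
begin

definition scaleC_complex :: "complex \<Rightarrow> complex \<Rightarrow> complex"
  where "scaleC_complex c x = c * x"

instance
  by standard (simp_all add: scaleC_complex_def algebra_simps norm_mult scaleR_conv_of_real)

end

definition bounded_clinear ::
    "('a::complex_normed_vector \<Rightarrow> 'b::complex_normed_vector) \<Rightarrow> bool"
  where "bounded_clinear f \<longleftrightarrow> bounded_linear f \<and> (\<forall>c x. f (c *\<^sub>C x) = c *\<^sub>C f x)"

lemma bounded_linear_scaleC:
  "bounded_linear (\<lambda>x::'a::complex_normed_vector. c *\<^sub>C x)"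
  by (rule bounded_linear_intro[where K = "norm c"])
    (simp_all add: scaleC_add_right scaleR_scaleC scaleC_scaleC norm_scaleC mult.commute)

lemma closure_csubspace:
  fixes S :: "'a::complex_normed_vector set"
  assumes "complex_vector.subspace S"
  shows "complex_vector.subspace (closure S)"
proof (rule complex_vector.subspaceI)
  show "0 \<in> closure S"
    using complex_vector.subspace_0[OF assms] closure_subset by blast
next
  fix x y assume "x \<in> closure S" "y \<in> closure S"
  then obtain f g where fg: "\<And>n. f n \<in> S" "f \<longlonglongrightarrow> x" "\<And>n. g n \<in> S" "g \<longlonglongrightarrow> y"
    unfolding closure_sequential by blast
  then have "\<forall>n. f n + g n \<in> S" "(\<lambda>n. f n + g n) \<longlonglongrightarrow> x + y"
    by (auto intro: complex_vector.subspace_add[OF assms] tendsto_add)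
  then show "x + y \<in> closure S"
    unfolding closure_sequential by (intro exI[of _ "\<lambda>n. f n + g n"] conjI)
next
  fix c x assume "x \<in> closure S"
  then obtain f where f: "\<And>n. f n \<in> S" "f \<longlonglongrightarrow> x"
    unfolding closure_sequential by blast
  then have "\<forall>n. c *\<^sub>C f n \<in> S" "(\<lambda>n. c *\<^sub>C f n) \<longlonglongrightarrow> c *\<^sub>C x"
    using complex_vector.subspace_scale[OF assms]
      bounded_linear.tendsto[OF bounded_linear_scaleC, of f] by blast+
  then show "c *\<^sub>C x \<in> closure S"
    unfolding closure_sequential by (intro exI[of _ "\<lambda>n. c *\<^sub>C f n"] conjI)
qed


section \<open>The dual space\<close>

typedef (overloaded) ('a::complex_normed_vector) cdual =
    "{f :: 'a \<Rightarrow> complex. bounded_clinear f}"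
  morphisms cdual_apply CDual
  by (rule exI[of _ "\<lambda>_. 0"]) (simp add: bounded_clinear_def scaleC_complex_def)

setup_lifting type_definition_cdual

instantiation cdual :: (complex_normed_vector) complex_normed_vector
begin

lift_definition zero_cdual :: "'a cdual" is "\<lambda>_. 0"
  by (simp add: bounded_clinear_def scaleC_complex_def)

lift_definition plus_cdual :: "'a cdual \<Rightarrow> 'a cdual \<Rightarrow> 'a cdual" is "\<lambda>f g x. f x + g x"
  by (simp add: bounded_clinear_def scaleC_complex_def bounded_linear_add distrib_left)

lift_definition uminus_cdual :: "'a cdual \<Rightarrow> 'a cdual" is "\<lambda>f x. - f x"
  by (simp add: bounded_clinear_def scaleC_complex_def bounded_linear_minus)

lift_definition minus_cdual :: "'a cdual \<Rightarrow> 'a cdual \<Rightarrow> 'a cdual" is "\<lambda>f g x. f x - g x"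
  by (simp add: bounded_clinear_def scaleC_complex_def bounded_linear_sub right_diff_distrib)

lift_definition scaleC_cdual :: "complex \<Rightarrow> 'a cdual \<Rightarrow> 'a cdual" is "\<lambda>c f x. c * f x"
  by (auto simp: bounded_clinear_def scaleC_complex_def mult_ac intro: bounded_linear_const_mult)

lift_definition scaleR_cdual :: "real \<Rightarrow> 'a cdual \<Rightarrow> 'a cdual" is "\<lambda>r f x. r *\<^sub>R f x"
  by (auto simp: bounded_clinear_def scaleC_complex_def scaleR_conv_of_real
      intro: bounded_linear_const_mult)

lift_definition norm_cdual :: "'a cdual \<Rightarrow> real" is onorm .

definition dist_cdual :: "'a cdual \<Rightarrow> 'a cdual \<Rightarrow> real"
  where "dist_cdual a b = norm (a - b)"

definition sgn_cdual :: "'a cdual \<Rightarrow> 'a cdual"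
  where "sgn_cdual x = inverse (norm x) *\<^sub>R x"

definition
  "(uniformity :: ('a cdual \<times> 'a cdual) filter) =
    (INF e\<in>{0<..}. principal {(x, y). dist x y < e})"

definition open_cdual :: "'a cdual set \<Rightarrow> bool"
  where "open_cdual S = (\<forall>x\<in>S. \<forall>\<^sub>F (x', y) in uniformity. x' = x \<longrightarrow> y \<in> S)"

instance
proof
  fix f :: "'a cdual" and c :: complex
  have le: "norm (d *\<^sub>C g) \<le> norm d * norm g" for d and g :: "'a cdual"
    by transfer (auto simp: norm_mult bounded_clinear_def mult.assoc
        intro!: onorm_bound mult_nonneg_nonneg mult_left_mono onorm_pos_le onorm)
  have "norm c * norm f \<le> norm (c *\<^sub>C f)"
  proof (cases "c = 0")
    case True
    have "0 \<le> norm (c *\<^sub>C f)"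
      by transfer
        (auto simp: bounded_clinear_def intro: onorm_pos_le bounded_linear_const_mult)
    with True show ?thesis by simp
  next
    case False
    have "inverse c *\<^sub>C c *\<^sub>C f = f"
      using False by transfer (simp add: fun_eq_iff)
    with le[of "inverse c" "c *\<^sub>C f"] have "norm f \<le> norm (c *\<^sub>C f) / norm c"
      by (simp add: norm_inverse divide_inverse mult.commute)
    with False show ?thesis
      by (simp add: le_divide_eq mult.commute)
  qed
  with le show "norm (c *\<^sub>C f) = norm c * norm f"
    by (metis antisym)
next
  fix f g :: "'a cdual" and r :: real
  show "(norm f = 0) = (f = 0)" "norm (f + g) \<le> norm f + norm g" "norm (r *\<^sub>R f) = \<bar>r\<bar> * norm f"
    by (transfer, simp add: bounded_clinear_def onorm_eq_0 onorm_triangle onorm_scaleR fun_eq_iff)+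
qed (unfold dist_cdual_def open_cdual_def sgn_cdual_def uniformity_cdual_def,
    (rule refl | (transfer, simp add: fun_eq_iff algebra_simps scaleR_conv_of_real))+)

end


section \<open>The space \<open>\<ell>\<^sup>1\<close>\<close>

typedef ell1 = "{f :: nat \<Rightarrow> complex. summable (\<lambda>n. norm (f n))}"
  morphisms ell1_nth Abs_ell1
  by (rule exI[of _ "\<lambda>_. 0"]) simp

setup_lifting type_definition_ell1

instantiation ell1 :: complex_normed_vector
begin

lift_definition zero_ell1 :: ell1 is "\<lambda>_. 0"
  by simp

lift_definition plus_ell1 :: "ell1 \<Rightarrow> ell1 \<Rightarrow> ell1" is "\<lambda>f g n. f n + g n"
  subgoal for f g
    by (rule summable_comparison_test'[where N = 0 and g = "\<lambda>n. norm (f n) + norm (g n)"])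
      (auto simp: norm_triangle_ineq intro: summable_add)
  done

lift_definition uminus_ell1 :: "ell1 \<Rightarrow> ell1" is "\<lambda>f n. - f n"
  by simp

lift_definition minus_ell1 :: "ell1 \<Rightarrow> ell1 \<Rightarrow> ell1" is "\<lambda>f g n. f n - g n"
  subgoal for f g
    by (rule summable_comparison_test'[where N = 0 and g = "\<lambda>n. norm (f n) + norm (g n)"])
      (auto simp: norm_triangle_ineq4 intro: summable_add)
  done

lift_definition scaleC_ell1 :: "complex \<Rightarrow> ell1 \<Rightarrow> ell1" is "\<lambda>c f n. c * f n"
  by (simp add: norm_mult summable_mult)

lift_definition scaleR_ell1 :: "real \<Rightarrow> ell1 \<Rightarrow> ell1" is "\<lambda>r f n. r *\<^sub>R f n"
  by (simp add: summable_mult)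

lift_definition norm_ell1 :: "ell1 \<Rightarrow> real" is "\<lambda>f. \<Sum>n. norm (f n)" .

definition dist_ell1 :: "ell1 \<Rightarrow> ell1 \<Rightarrow> real"
  where "dist_ell1 a b = norm (a - b)"

definition sgn_ell1 :: "ell1 \<Rightarrow> ell1"
  where "sgn_ell1 x = inverse (norm x) *\<^sub>R x"

definition
  "(uniformity :: (ell1 \<times> ell1) filter) = (INF e\<in>{0<..}. principal {(x, y). dist x y < e})"

definition open_ell1 :: "ell1 set \<Rightarrow> bool"
  where "open_ell1 S = (\<forall>x\<in>S. \<forall>\<^sub>F (x', y) in uniformity. x' = x \<longrightarrow> y \<in> S)"

instance
proof
  fix f g :: ell1 and c :: complex and r :: real
  show "(norm f = 0) = (f = 0)"
    by transfer (auto simp: suminf_eq_zero_iff fun_eq_iff)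
  show "norm (f + g) \<le> norm f + norm g"
  proof transfer
    fix f g :: "nat \<Rightarrow> complex"
    assume f: "summable (\<lambda>n. norm (f n))" and g: "summable (\<lambda>n. norm (g n))"
    have "summable (\<lambda>n. norm (f n + g n))"
      by (rule summable_comparison_test'[OF summable_add[OF f g], where N = 0])
        (auto simp: norm_triangle_ineq)
    then show "(\<Sum>n. norm (f n + g n)) \<le> (\<Sum>n. norm (f n)) + (\<Sum>n. norm (g n))"
      unfolding suminf_add[OF f g]
      by (intro suminf_le summable_add f g norm_triangle_ineq)
  qed
  show "norm (r *\<^sub>R f) = \<bar>r\<bar> * norm f"
    by transfer (simp add: suminf_mult)
  show "norm (c *\<^sub>C f) = norm c * norm f"
    by transfer (simp add: norm_mult suminf_mult)
qed (unfold dist_ell1_def open_ell1_def sgn_ell1_def uniformity_ell1_def,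
    (rule refl | (transfer, simp add: fun_eq_iff algebra_simps scaleR_conv_of_real))+)

end


section \<open>Lipschitz functions and Lipschitz-free spaces\<close>

class pointed_metric_space = metric_space +
  fixes basepoint :: 'a

typedef (overloaded) ('a::pointed_metric_space) lip0 =
    "{g :: 'a \<Rightarrow> complex. (\<exists>C. C-lipschitz_on UNIV g) \<and> g basepoint = 0}"
  morphisms lip0_apply Lip0
  by (rule exI[of _ "\<lambda>_. 0"]) (auto intro: lipschitz_intros)

setup_lifting type_definition_lip0

text \<open>Inserting \<open>0\<close> makes the supremum equal to \<open>0\<close> if the space is a singleton, and
  changes nothing otherwise.\<close>

definition lip_const :: "('a::metric_space \<Rightarrow> complex) \<Rightarrow> real"
  where "lip_const g = Sup (insert 0 {norm (g x - g y) / dist x y | x y. x \<noteq> y})"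

lemma lip_const_least:
  assumes "0 \<le> C" "\<And>x y. norm (g x - g y) \<le> C * dist x y"
  shows "lip_const g \<le> C"
  unfolding lip_const_def using assms by (intro cSup_least) (auto simp: divide_le_eq)

lemma lip_const_bound:
  assumes "C-lipschitz_on UNIV g"
  shows "0 \<le> lip_const g" "norm (g x - g y) \<le> lip_const g * dist x y"
proof -
  let ?S = "insert 0 {norm (g x - g y) / dist x y | x y. x \<noteq> y}"
  have "bdd_above ?S"
    using assms by (intro bdd_aboveI[of _ C])
      (auto simp: divide_le_eq lipschitz_on_def dist_norm)
  then have le: "s \<le> lip_const g" if "s \<in> ?S" for s
    unfolding lip_const_def using that by (rule cSup_upper[rotated])
  show "0 \<le> lip_const g"
    by (rule le) simp
  show "norm (g x - g y) \<le> lip_const g * dist x y"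
  proof (cases "x = y")
    case False
    then have "norm (g x - g y) / dist x y \<le> lip_const g"
      by (intro le) blast
    with False show ?thesis by (simp add: divide_le_eq)
  qed simp
qed

lemma lip_const_scale_le:
  assumes "C-lipschitz_on UNIV g"
  shows "lip_const (\<lambda>x. c * g x) \<le> norm c * lip_const g"
  using lip_const_bound[OF assms]
  by (intro lip_const_least)
    (auto simp: norm_mult mult.assoc mult_left_mono simp flip: right_diff_distrib)

lemma lipschitz_on_const_mult:
  fixes g :: "'a::metric_space \<Rightarrow> complex"
  assumes "C-lipschitz_on UNIV g"
  shows "(norm c * C)-lipschitz_on UNIV (\<lambda>x. c * g x)"
  using assms by (auto simp: lipschitz_on_def dist_norm norm_mult mult.assoc mult_left_mono
      simp flip: right_diff_distrib)

lemma lip_const_scale: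
  assumes "C-lipschitz_on UNIV g"
  shows "lip_const (\<lambda>x. c * g x) = norm c * lip_const g"
proof (rule antisym)
  note cg = lipschitz_on_const_mult[OF assms, of c]
  show "norm c * lip_const g \<le> lip_const (\<lambda>x. c * g x)"
  proof (cases "c = 0")
    case True
    then show ?thesis using lip_const_bound(1)[OF cg] by simp
  next
    case False
    with lip_const_scale_le[OF cg, of "inverse c"]
    have "lip_const g \<le> lip_const (\<lambda>x. c * g x) / norm c"
      by (simp add: norm_inverse divide_inverse mult.commute flip: mult.assoc)
    with False show ?thesis
      by (simp add: le_divide_eq mult.commute)
  qed
qed (rule lip_const_scale_le[OF assms])

instantiation lip0 :: (pointed_metric_space) complex_normed_vector
begin

lift_definition zero_lip0 :: "'a lip0" is "\<lambda>_. 0"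
  by (auto intro: lipschitz_intros)

lift_definition plus_lip0 :: "'a lip0 \<Rightarrow> 'a lip0 \<Rightarrow> 'a lip0" is "\<lambda>f g x. f x + g x"
  by (auto intro: lipschitz_on_add)

lift_definition uminus_lip0 :: "'a lip0 \<Rightarrow> 'a lip0" is "\<lambda>f x. - f x"
  by auto

lift_definition minus_lip0 :: "'a lip0 \<Rightarrow> 'a lip0 \<Rightarrow> 'a lip0" is "\<lambda>f g x. f x - g x"
  by (auto intro: lipschitz_on_diff)

lift_definition scaleC_lip0 :: "complex \<Rightarrow> 'a lip0 \<Rightarrow> 'a lip0" is "\<lambda>c f x. c * f x"
  by (auto intro: lipschitz_on_const_mult)

lift_definition scaleR_lip0 :: "real \<Rightarrow> 'a lip0 \<Rightarrow> 'a lip0" is "\<lambda>r f x. r *\<^sub>R f x"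
  by (auto simp: scaleR_conv_of_real intro: lipschitz_on_const_mult)

lift_definition norm_lip0 :: "'a lip0 \<Rightarrow> real" is lip_const .

definition dist_lip0 :: "'a lip0 \<Rightarrow> 'a lip0 \<Rightarrow> real"
  where "dist_lip0 a b = norm (a - b)"

definition sgn_lip0 :: "'a lip0 \<Rightarrow> 'a lip0"
  where "sgn_lip0 x = inverse (norm x) *\<^sub>R x"

definition
  "(uniformity :: ('a lip0 \<times> 'a lip0) filter) =
    (INF e\<in>{0<..}. principal {(x, y). dist x y < e})"

definition open_lip0 :: "'a lip0 set \<Rightarrow> bool"
  where "open_lip0 S = (\<forall>x\<in>S. \<forall>\<^sub>F (x', y) in uniformity. x' = x \<longrightarrow> y \<in> S)"

instance
proof
  fix f g :: "'a lip0" and c :: complex and r :: real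
  show "(norm f = 0) = (f = 0)"
  proof transfer
    fix f :: "'a \<Rightarrow> complex"
    assume f: "(\<exists>C. C-lipschitz_on UNIV f) \<and> f basepoint = 0"
    show "(lip_const f = 0) = (f = (\<lambda>_. 0))"
    proof
      assume "lip_const f = 0"
      then have "norm (f x - f basepoint) \<le> 0" for x
        using f lip_const_bound(2)[of _ f x basepoint] by auto
      then show "f = (\<lambda>_. 0)" using f by auto
    next
      assume "f = (\<lambda>_. 0)"
      then show "lip_const f = 0"
        using f lip_const_bound(1)[of _ f] lip_const_least[of 0 f] by auto
    qed
  qed
  show "norm (f + g) \<le> norm f + norm g"
  proof transfer
    fix f g :: "'a \<Rightarrow> complex"
    assume "(\<exists>C. C-lipschitz_on UNIV f) \<and> f basepoint = 0"
      and "(\<exists>C. C-lipschitz_on UNIV g) \<and> g basepoint = 0"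
    then obtain C D where f: "C-lipschitz_on UNIV f" and g: "D-lipschitz_on UNIV g"
      by blast
    show "lip_const (\<lambda>x. f x + g x) \<le> lip_const f + lip_const g"
    proof (rule lip_const_least)
      show "0 \<le> lip_const f + lip_const g"
        using lip_const_bound(1)[OF f] lip_const_bound(1)[OF g] by simp
      show "norm (f x + g x - (f y + g y)) \<le> (lip_const f + lip_const g) * dist x y" for x y
        using lip_const_bound(2)[OF f, of x y] lip_const_bound(2)[OF g, of x y]
          norm_triangle_ineq[of "f x - f y" "g x - g y"]
        by (simp add: algebra_simps)
    qed
  qed
  show "norm (r *\<^sub>R f) = \<bar>r\<bar> * norm f"
    by transfer (auto simp: scaleR_conv_of_real lip_const_scale)
  show "norm (c *\<^sub>C f) = norm c * norm f"
    by transfer (auto simp: lip_const_scale)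
qed (unfold dist_lip0_def open_lip0_def sgn_lip0_def uniformity_lip0_def,
    (rule refl | (transfer, simp add: fun_eq_iff algebra_simps scaleR_conv_of_real))+)

end

lemma bounded_clinear_eval:
  "bounded_clinear (\<lambda>g :: 'a::pointed_metric_space lip0. lip0_apply g x)"
proof -
  have "norm (lip0_apply g x) \<le> norm g * dist x basepoint" for g
  proof (transfer fixing: x)
    fix g :: "'a \<Rightarrow> complex" assume "(\<exists>C. C-lipschitz_on UNIV g) \<and> g basepoint = 0"
    then show "norm (g x) \<le> lip_const g * dist x basepoint"
      using lip_const_bound(2)[of _ g x basepoint] by auto
  qed
  then have "bounded_linear (\<lambda>g. lip0_apply g x)"
    by (intro bounded_linear_intro[where K = "dist x basepoint"])
      (simp_all add: plus_lip0.rep_eq scaleR_lip0.rep_eq)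
  then show ?thesis
    by (simp add: bounded_clinear_def scaleC_lip0.rep_eq scaleC_complex_def)
qed

lift_definition eval_functional :: "'a::pointed_metric_space \<Rightarrow> 'a lip0 cdual"
  is "\<lambda>x g. lip0_apply g x"
  by (rule bounded_clinear_eval)

typedef (overloaded) ('a::pointed_metric_space) lip_free =
    "closure (complex_vector.span (range (eval_functional :: 'a \<Rightarrow> 'a lip0 cdual)))"
  morphisms lip_free_functional Abs_lip_free
  using closure_subset complex_vector.span_zero by blast

setup_lifting type_definition_lip_free

lemma csubspace_free_carrier:
  "complex_vector.subspace (closure (complex_vector.span (range eval_functional)))"
  by (rule closure_csubspace complex_vector.subspace_span)+

instantiation lip_free :: (pointed_metric_space) complex_normed_vector
begin

lift_definition zero_lip_free :: "'a lip_free" is 0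
  by (rule complex_vector.subspace_0[OF csubspace_free_carrier])

lift_definition plus_lip_free :: "'a lip_free \<Rightarrow> 'a lip_free \<Rightarrow> 'a lip_free" is "(+)"
  by (rule complex_vector.subspace_add[OF csubspace_free_carrier])

lift_definition uminus_lip_free :: "'a lip_free \<Rightarrow> 'a lip_free" is uminus
  by (rule complex_vector.subspace_neg[OF csubspace_free_carrier])

lift_definition minus_lip_free :: "'a lip_free \<Rightarrow> 'a lip_free \<Rightarrow> 'a lip_free" is "(-)"
  by (rule complex_vector.subspace_diff[OF csubspace_free_carrier])

lift_definition scaleC_lip_free :: "complex \<Rightarrow> 'a lip_free \<Rightarrow> 'a lip_free" is "(*\<^sub>C)"
  by (rule complex_vector.subspace_scale[OF csubspace_free_carrier])

lift_definition scaleR_lip_free :: "real \<Rightarrow> 'a lip_free \<Rightarrow> 'a lip_free" is "(*\<^sub>R)"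
  unfolding scaleR_scaleC by (rule complex_vector.subspace_scale[OF csubspace_free_carrier])

lift_definition norm_lip_free :: "'a lip_free \<Rightarrow> real" is norm .

definition dist_lip_free :: "'a lip_free \<Rightarrow> 'a lip_free \<Rightarrow> real"
  where "dist_lip_free a b = norm (a - b)"

definition sgn_lip_free :: "'a lip_free \<Rightarrow> 'a lip_free"
  where "sgn_lip_free x = inverse (norm x) *\<^sub>R x"

definition
  "(uniformity :: ('a lip_free \<times> 'a lip_free) filter) =
    (INF e\<in>{0<..}. principal {(x, y). dist x y < e})"

definition open_lip_free :: "'a lip_free set \<Rightarrow> bool"
  where "open_lip_free S = (\<forall>x\<in>S. \<forall>\<^sub>F (x', y) in uniformity. x' = x \<longrightarrow> y \<in> S)"

instance
  apply standard
  unfolding dist_lip_free_def open_lip_free_def sgn_lip_free_def uniformity_lip_free_def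
  apply (rule refl | (transfer, simp add: algebra_simps scaleC_add_right scaleC_add_left
      scaleC_scaleC scaleC_one scaleR_scaleC norm_scaleC norm_triangle_ineq))+
  done

end

lift_definition delta :: "'a::pointed_metric_space \<Rightarrow> 'a lip_free" is eval_functional
  by (meson closure_subset complex_vector.span_base rangeI subsetD)

definition FS :: "nat \<Rightarrow> 'a::pointed_metric_space lip_free set"
  where "FS k = {\<Sum>i<k. a i *\<^sub>C delta (x i) | (a :: nat \<Rightarrow> complex) (x :: nat \<Rightarrow> 'a). True}"


section \<open>Dimension and quotients\<close>

definition finite_dim :: "'a::complex_vector set \<Rightarrow> bool"
  where "finite_dim E \<longleftrightarrow> (\<exists>B. finite B \<and> E \<subseteq> complex_vector.span B)"

text \<open>The library's \<open>dim\<close> takes the value \<open>0\<close> on infinite-dimensional subspaces, which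
  therefore have to be treated separately.\<close>

definition dim_at_least :: "nat \<Rightarrow> 'a::complex_vector set \<Rightarrow> bool"
  where "dim_at_least n E \<longleftrightarrow> \<not> finite_dim E \<or> n \<le> complex_vector.dim E"

text \<open>The quotient by a subspace \<open>E\<close> is the set \<open>range (quot E)\<close> of cosets of \<open>E\<close>, with the
  operations for which \<open>quot E\<close> is linear.\<close>

definition quot :: "'a::complex_normed_vector set \<Rightarrow> 'a \<Rightarrow> 'a set"
  where "quot E y = (\<lambda>e. y + e) ` E"

definition quot_norm :: "'a::complex_normed_vector set \<Rightarrow> real"
  where "quot_norm K = Inf (norm ` K)"

text \<open>The set \<open>\<alpha> B\<close>, where \<open>B\<close> is the closed unit ball of the quotient by \<open>E\<close>.\<close>

definition scaled_quot_ball :: "real \<Rightarrow> 'a::complex_normed_vector set \<Rightarrow> 'a set set"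
  where "scaled_quot_ball \<alpha> E = {quot E (\<alpha> *\<^sub>R y) | y. quot_norm (quot E y) \<le> 1}"

text \<open>The cosets of the elements of the finite set \<open>B\<close> form a basis of the quotient by \<open>E\<close>
  (and are pairwise distinct).\<close>

definition quot_basis :: "'a::complex_normed_vector set \<Rightarrow> 'a set \<Rightarrow> bool"
  where "quot_basis E B \<longleftrightarrow> finite B \<and>
    (\<forall>c. quot E (\<Sum>b\<in>B. c b *\<^sub>C b) = quot E 0 \<longrightarrow> (\<forall>b\<in>B. c b = 0)) \<and>
    (\<forall>y. \<exists>c. quot E y = quot E (\<Sum>b\<in>B. c b *\<^sub>C b))"

definition quot_dim_eq :: "'a::complex_normed_vector set \<Rightarrow> nat \<Rightarrow> bool"
  where "quot_dim_eq E n \<longleftrightarrow> (\<exists>B. quot_basis E B \<and> card B = n)"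

definition quot_dim_infinite :: "'a::complex_normed_vector set \<Rightarrow> bool"
  where "quot_dim_infinite E \<longleftrightarrow> (\<forall>n. \<not> quot_dim_eq E n)"


section \<open>Isomorphisms and complemented subspaces\<close>

definition isomorphism_onto ::
    "'a::complex_normed_vector set \<Rightarrow> 'b::complex_normed_vector set \<Rightarrow> ('a \<Rightarrow> 'b) \<Rightarrow> bool"
  where "isomorphism_onto E F f \<longleftrightarrow>
    (\<forall>x\<in>E. \<forall>y\<in>E. f (x + y) = f x + f y) \<and>
    (\<forall>c. \<forall>x\<in>E. f (c *\<^sub>C x) = c *\<^sub>C f x) \<and>
    (\<exists>g. homeomorphism E F f g)"

definition isomorphic_to_ell1 :: "'a::complex_normed_vector set \<Rightarrow> bool"
  where "isomorphic_to_ell1 E \<longleftrightarrow> (\<exists>f :: ell1 \<Rightarrow> 'a. isomorphism_onto UNIV E f)"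

definition complemented :: "'a::complex_normed_vector set \<Rightarrow> bool"
  where "complemented E \<longleftrightarrow> (\<exists>P. bounded_clinear P \<and> range P = E \<and> (\<forall>x. P (P x) = P x))"

definition closed_csubspace :: "'a::complex_normed_vector set \<Rightarrow> bool"
  where "closed_csubspace E \<longleftrightarrow> complex_vector.subspace E \<and> closed E"


section \<open>Classes of operators\<close>

definition weak_topology :: "'a::complex_normed_vector topology"
  where "weak_topology = topology_generated_by {cdual_apply f -` U | f U. open U}"

definition compact_operator ::
    "('a::complex_normed_vector \<Rightarrow> 'b::complex_normed_vector) \<Rightarrow> bool"
  where "compact_operator T \<longleftrightarrow> compact (closure (T ` cball 0 1))"

definition weakly_compact_operator ::
    "('a::complex_normed_vector \<Rightarrow> 'b::complex_normed_vector) \<Rightarrow> bool"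
  where "weakly_compact_operator T \<longleftrightarrow>
    compactin weak_topology (weak_topology closure_of (T ` cball 0 1))"

definition strictly_singular ::
    "('a::complex_normed_vector \<Rightarrow> 'b::complex_normed_vector) \<Rightarrow> bool"
  where "strictly_singular T \<longleftrightarrow>
    \<not> (\<exists>E. closed_csubspace E \<and> \<not> finite_dim E \<and> isomorphism_onto E (T ` E) T)"

definition strictly_cosingular ::
    "('a::complex_normed_vector \<Rightarrow> 'b::complex_normed_vector) \<Rightarrow> bool"
  where "strictly_cosingular T \<longleftrightarrow>
    (\<forall>Z. closed_csubspace Z \<and> quot_dim_infinite Z \<longrightarrow> range (quot Z \<circ> T) \<noteq> range (quot Z))"

definition super_strictly_singular ::
    "('a::complex_normed_vector \<Rightarrow> 'b::complex_normed_vector) \<Rightarrow> bool"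
  where "super_strictly_singular T \<longleftrightarrow>
    (\<forall>\<epsilon>>0. \<exists>N\<ge>1. \<forall>E. complex_vector.subspace E \<and> dim_at_least N E \<longrightarrow>
      (\<exists>x\<in>E. norm x = 1 \<and> norm (T x) \<le> \<epsilon>))"

text \<open>Suprema are taken in \<open>[0, \<infinity>]\<close>, where the supremum of the empty set is \<open>0\<close>.\<close>

definition surjectivity_modulus ::
    "('a::complex_normed_vector \<Rightarrow> 'b::complex_normed_vector) \<Rightarrow> 'b set \<Rightarrow> ennreal"
  where "surjectivity_modulus T E =
    Sup {ennreal \<alpha> | \<alpha>. 0 \<le> \<alpha> \<and> scaled_quot_ball \<alpha> E \<subseteq> (quot E \<circ> T) ` cball 0 1}"

definition cosingular_number ::
    "('a::complex_normed_vector \<Rightarrow> 'b::complex_normed_vector) \<Rightarrow> nat \<Rightarrow> ennreal"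
  where "cosingular_number T n =
    Sup {surjectivity_modulus T E | E. closed_csubspace E \<and> quot_dim_eq E n}"

definition super_strictly_cosingular ::
    "('a::complex_normed_vector \<Rightarrow> 'b::complex_normed_vector) \<Rightarrow> bool"
  where "super_strictly_cosingular T \<longleftrightarrow> cosingular_number T \<longlonglongrightarrow> 0"

definition fixes_copy_of_ell1 ::
    "('a::complex_normed_vector \<Rightarrow> 'b::complex_normed_vector) \<Rightarrow> bool"
  where "fixes_copy_of_ell1 T \<longleftrightarrow>
    (\<exists>E F. closed_csubspace E \<and> closed_csubspace F \<and>
      isomorphic_to_ell1 E \<and> isomorphic_to_ell1 F \<and> isomorphism_onto E F T)"

definition fixes_complemented_copy_of_ell1 ::
    "('a::complex_normed_vector \<Rightarrow> 'b::complex_normed_vector) \<Rightarrow> bool"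
  where "fixes_complemented_copy_of_ell1 T \<longleftrightarrow>
    (\<exists>E F. closed_csubspace E \<and> closed_csubspace F \<and>
      isomorphic_to_ell1 E \<and> isomorphic_to_ell1 F \<and> isomorphism_onto E F T \<and>
      complemented E \<and> complemented F)"

end

theory Submission
  imports Defs
begin

text \<open>
  Each property holds for compact operators and fails if \<open>T\<close> fixes a complemented copy of \<open>\<ell>\<^sup>1\<close>, that
  is, if \<open>R \<circ> T \<circ> S = id\<close> for bounded operators \<open>S\<close> from \<open>\<ell>\<^sup>1\<close> and \<open>R\<close> to \<open>\<ell>\<^sup>1\<close>. So it suffices to factor
  the identity of \<open>\<ell>\<^sup>1\<close> through a noncompact \<open>T\<close>.

  If \<open>T\<close> is not compact, some sequence of molecules \<open>m\<^sub>n = (\<delta>(x) - \<delta>(y)) / d(x, y)\<close> has images \<open>\<gamma>\<^sub>n\<close> without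
  convergent subsequence, and by hypothesis \<open>\<gamma>\<^sub>n\<close> is supported on a set \<open>A\<^sub>n\<close> of at most \<open>k\<close> points. After
  passing to a subsequence there are a finite set \<open>P\<close> of points of the completion, containing the base
  point, and \<open>c > 0\<close> such that every \<open>u \<in> A\<^sub>n\<close> has distance at least \<open>c d(u, P)\<close> from every other \<open>A\<^sub>m\<close>.
  Were \<open>\<gamma>\<^sub>n\<close> asymptotically small on the functions of Lipschitz constant \<open>1\<close> vanishing on \<open>P\<close>, it would
  approach the finite-dimensional span of \<open>P\<close> and subconverge. Hence, along a subsequence, there are
  such functions \<open>h\<^sub>n\<close> with \<open>\<bar>\<langle>h\<^sub>n, \<gamma>\<^sub>n\<rangle>\<bar> > \<eta>\<close>. As \<open>\<bar>h\<^sub>n\<bar> \<le> d(\<cdot>, P)\<close>, truncating \<open>h\<^sub>n\<close> by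
  \<open>max 0 (d(\<cdot>, P) - 4 / c d(\<cdot>, A\<^sub>n))\<close> does not change it on \<open>A\<^sub>n\<close>, and yields uniformly Lipschitz functions
  with disjoint supports, which are the coordinates of \<open>R\<close>; \<open>S\<close> maps the unit vectors to the \<open>m\<^sub>n\<close>.
\<close>

section \<open>Bounded complex-linear maps, subspaces and quotients\<close>

lemma bounded_clinearI:
  assumes "\<And>x y. f (x + y) = f x + f y" "\<And>c x. f (c *\<^sub>C x) = c *\<^sub>C f x"
    "\<And>x. norm (f x) \<le> K * norm x"
  shows "bounded_clinear f"
  unfolding bounded_clinear_def using assms
  by (auto intro!: bounded_linear_intro[where K = K] simp: scaleR_scaleC mult.commute)

lemma bounded_clinear_bounded_linear: "bounded_clinear f \<Longrightarrow> bounded_linear f"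
  and bounded_clinear_scaleC: "bounded_clinear f \<Longrightarrow> f (c *\<^sub>C x) = c *\<^sub>C f x"
  by (auto simp: bounded_clinear_def)

lemma bounded_clinear_add: "bounded_clinear f \<Longrightarrow> f (x + y) = f x + f y"
  and bounded_clinear_diff: "bounded_clinear f \<Longrightarrow> f (x - y) = f x - f y"
  and bounded_clinear_0: "bounded_clinear f \<Longrightarrow> f 0 = 0"
  and bounded_clinear_sum: "bounded_clinear f \<Longrightarrow> f (sum h A) = (\<Sum>a\<in>A. f (h a))"
  by (auto simp: bounded_clinear_def linear_simps linear_sum dest: bounded_linear.linear)

lemma bounded_clinear_continuous_on: "bounded_clinear f \<Longrightarrow> continuous_on A f"
  by (simp add: bounded_clinear_bounded_linear linear_continuous_on)

lemma bounded_clinear_bound: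
  assumes "bounded_clinear f"
  obtains K where "K > 0" "\<And>x. norm (f x) \<le> K * norm x"
  using bounded_linear.pos_bounded[OF bounded_clinear_bounded_linear[OF assms]]
  by (auto simp: mult.commute)

lemma bounded_clinear_compose:
  "bounded_clinear f \<Longrightarrow> bounded_clinear g \<Longrightarrow> bounded_clinear (\<lambda>x. f (g x))"
  by (auto simp: bounded_clinear_def bounded_linear_compose)

lemma bounded_clinear_sub:
  "bounded_clinear f \<Longrightarrow> bounded_clinear g \<Longrightarrow> bounded_clinear (\<lambda>x. f x - g x)"
  by (auto simp: bounded_clinear_def bounded_linear_sub complex_vector.scale_right_diff_distrib)

text \<open>Isomorphisms are given as homeomorphisms, so norm bounds have to be extracted from
  continuity at 0: a nonzero \<open>x\<close> is scaled to norm \<open>d / 2\<close>, where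
  \<open>f\<close> stays below 1.\<close>

lemma continuous_linear_imp_bounded_clinear:
  assumes add: "\<And>x y. f (x + y) = f x + f y" and scale: "\<And>c x. f (c *\<^sub>C x) = c *\<^sub>C f x"
    and "continuous_on UNIV f"
  shows "bounded_clinear f"
proof -
  have f0: "f 0 = 0" using add[of 0 0] by simp
  have "isCont f 0" using assms(3) by (simp add: continuous_on_eq_continuous_at)
  then have "\<exists>d>0. \<forall>x. x \<noteq> 0 \<and> norm (x - 0) < d \<longrightarrow> norm (f x - f 0) < 1"
    unfolding isCont_def by (rule LIM_D) simp
  then obtain d where d: "d > 0" "\<And>x. x \<noteq> 0 \<Longrightarrow> norm x < d \<Longrightarrow> norm (f x) < 1"
    using f0 by auto
  show ?thesis
  proof (rule bounded_clinearI[OF add scale])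
    fix x
    show "norm (f x) \<le> (2 / d) * norm x"
    proof (cases "x = 0")
      case False
      define r where "r = d / (2 * norm x)"
      have r: "r > 0" "norm (r *\<^sub>R x) < d"
        using False d(1) by (auto simp: r_def)
      then have "norm (f (r *\<^sub>R x)) < 1" using False by (intro d) auto
      then have "r * norm (f x) < 1"
        using r(1) by (simp add: scaleR_scaleC scale norm_scaleC)
      then show ?thesis
        using False d(1) by (simp add: r_def field_simps)
    qed (simp add: f0)
  qed
qed

lemma bounded_linear_scaleC_left:
  fixes v :: "'a::complex_normed_vector"
  shows "bounded_linear (\<lambda>a. a *\<^sub>C v)"
  by (rule bounded_linear_intro[where K = "norm v"])
    (auto simp: scaleC_add_left scaleR_scaleC scaleC_scaleC norm_scaleC scaleC_complex_def)

lemma kernel_csubspace: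
  assumes "bounded_clinear f" shows "closed_csubspace {x. f x = 0}"
  unfolding closed_csubspace_def
proof
  show "complex_vector.subspace {x. f x = 0}"
    by (rule complex_vector.subspaceI)
      (auto simp: bounded_clinear_0 bounded_clinear_add bounded_clinear_scaleC assms)
  show "closed {x. f x = 0}"
    by (intro closed_Collect_eq bounded_clinear_continuous_on assms continuous_on_const)
qed

section \<open>Homogeneous linear systems and dimension\<close>

text \<open>Gaussian elimination by induction on the equations. If equation \<open>i0\<close> has a
  pivot at \<open>k\<close>, multiples of it clear the unknown \<open>k\<close> from the others,
  which changes the matrix; hence \<open>A\<close> is generalized in the induction.\<close>

lemma linear_system_nontrivial_solution:
  fixes A :: "'i \<Rightarrow> 'j \<Rightarrow> complex"
  assumes "finite I" "finite J" "card I < card J"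
  shows "\<exists>c. (\<exists>j\<in>J. c j \<noteq> 0) \<and> (\<forall>i\<in>I. (\<Sum>j\<in>J. c j * A i j) = 0)"
  using assms
proof (induction I arbitrary: A J rule: finite_induct)
  case empty
  then have "J \<noteq> {}" by auto
  then show ?case by (intro exI[of _ "\<lambda>_. 1"]) auto
next
  case (insert i0 I)
  show ?case
  proof (cases "\<forall>j\<in>J. A i0 j = 0")
    case True
    have "card I < card J" using insert by auto
    from insert.IH[OF insert.prems(1) this, of A] True show ?thesis
      by (auto simp: sum.neutral)
  next
    case False
    then obtain k where k: "k \<in> J" "A i0 k \<noteq> 0" by auto
    have "card I < card (J - {k})" using insert k by auto
    from insert.IH[OF _ this, of "\<lambda>i j. A i j - A i k * A i0 j / A i0 k"] insert.prems(1)
    obtain c where c: "\<exists>j\<in>J-{k}. c j \<noteq> 0"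
      "\<And>i. i \<in> I \<Longrightarrow> (\<Sum>j\<in>J-{k}. c j * (A i j - A i k * A i0 j / A i0 k)) = 0" by auto
    define s where "s = (\<Sum>j\<in>J-{k}. c j * A i0 j)"
    \<comment> \<open>Back substitution: the unknown \<open>k\<close> is determined by equation
      \<open>i0\<close>.\<close>
    define c' where "c' = c(k := - s / A i0 k)"
    have split: "(\<Sum>j\<in>J. c' j * A i j) = (\<Sum>j\<in>J-{k}. c j * A i j) - s / A i0 k * A i k" for i
    proof -
      have "(\<Sum>j\<in>J-{k}. c' j * A i j) = (\<Sum>j\<in>J-{k}. c j * A i j)"
        by (intro sum.cong) (auto simp: c'_def)
      then show ?thesis using k(1) insert.prems(1) by (simp add: sum.remove[of J k] c'_def)
    qed
    have "(\<Sum>j\<in>J. c' j * A i j) = 0" if "i \<in> insert i0 I" for i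
    proof (cases "i = i0")
      case True
      then show ?thesis using k by (simp add: split s_def)
    next
      case False
      with that have "i \<in> I" by simp
      have "(\<Sum>j\<in>J-{k}. c j * (A i j - A i k * A i0 j / A i0 k))
          = (\<Sum>j\<in>J-{k}. c j * A i j) - (\<Sum>j\<in>J-{k}. (A i k / A i0 k) * (c j * A i0 j))"
        by (simp add: algebra_simps sum_subtractf)
      also have "\<dots> = (\<Sum>j\<in>J-{k}. c j * A i j) - s / A i0 k * A i k"
        by (simp add: s_def sum_distrib_left sum_divide_distrib mult_ac)
      finally show ?thesis using c(2)[OF \<open>i \<in> I\<close>] by (simp add: split)
    qed
    moreover have "\<exists>j\<in>J. c' j \<noteq> 0" using c(1) by (auto simp: c'_def)
    ultimately show ?thesis by blast
  qed
qed

lemma span_finite_obtain: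
  assumes "finite B" "x \<in> complex_vector.span B"
  obtains c where "x = (\<Sum>b\<in>B. c b *\<^sub>C b)"
  using assms by (auto simp: complex_vector.span_finite)

lemma obtain_independent_of_card:
  assumes "complex_vector.subspace E" "dim_at_least n E"
  obtains B where "finite B" "B \<subseteq> E" "card B = n" "complex_vector.independent B"
proof -
  obtain B where B: "B \<subseteq> E" "complex_vector.independent B" "E \<subseteq> complex_vector.span B"
    "card B = complex_vector.dim E"
    using complex_vector.basis_exists by blast
  have "\<exists>C\<subseteq>B. finite C \<and> card C = n"
  proof (cases "finite B")
    case True
    then have "n \<le> card B" using assms(2) B by (auto simp: dim_at_least_def finite_dim_def)
    then show ?thesis by (meson True obtain_subset_with_card_n)
  next
    case False
    then show ?thesis by (meson infinite_arbitrarily_large)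
  qed
  then show thesis using B that complex_vector.independent_mono by (metis subset_trans)
qed

text \<open>There is one more independent vector than there are functionals, so the coefficients of
  a suitable combination solve a homogeneous system with more unknowns than equations.\<close>

lemma exists_common_kernel_vector:
  fixes E :: "'a::complex_vector set" and f :: "'i \<Rightarrow> 'a \<Rightarrow> complex"
  assumes E: "complex_vector.subspace E" "dim_at_least (Suc (card I)) E" and "finite I"
    and add: "\<And>i x y. i \<in> I \<Longrightarrow> f i (x + y) = f i x + f i y"
    and scale: "\<And>i c x. i \<in> I \<Longrightarrow> f i (c *\<^sub>C x) = c * f i x"
  obtains x where "x \<in> E" "x \<noteq> 0" "\<And>i. i \<in> I \<Longrightarrow> f i x = 0"
proof -
  obtain B where B: "finite B" "B \<subseteq> E" "card B = Suc (card I)" "complex_vector.independent B"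
    using obtain_independent_of_card[OF E] by blast
  obtain c where c: "\<exists>b\<in>B. c b \<noteq> 0" "\<forall>i\<in>I. (\<Sum>b\<in>B. c b * f i b) = 0"
    using linear_system_nontrivial_solution[OF \<open>finite I\<close> B(1), of f] B(3) by auto
  let ?x = "\<Sum>b\<in>B. c b *\<^sub>C b"
  have "f i (sum g B) = (\<Sum>b\<in>B. f i (g b))" if "i \<in> I" for i g
    using B(1) scale[OF that, of 0 0] by (induction B rule: finite_induct) (auto simp: add that)
  with c(2) have "f i ?x = 0" if "i \<in> I" for i using that by (simp add: scale)
  moreover have "?x \<noteq> 0"
    using c(1) B(1,4) complex_vector.independentD[of B B c] by auto
  moreover have "?x \<in> E"
    using B(2) by (intro complex_vector.subspace_sum complex_vector.subspace_scale E) auto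
  ultimately show thesis using that by blast
qed

section \<open>Sums of closed and finite-dimensional subspaces\<close>

text \<open>If \<open>d\<close> is the distance of \<open>v\<close> from \<open>Z\<close>, then \<open>\<bar>c\<bar> d \<le> \<parallel>z + c v\<parallel>\<close> for \<open>z \<in> Z\<close>, so the
  coefficients \<open>c\<close> along a convergent sequence converge as well.\<close>

lemma closed_csubspace_plus_line:
  fixes Z :: "'a::complex_normed_vector set"
  assumes Z: "closed_csubspace Z"
  shows "closed_csubspace {z + c *\<^sub>C v | z c. z \<in> Z}" (is "closed_csubspace ?W")
proof (cases "v \<in> Z")
  case True
  have sub: "complex_vector.subspace Z" using Z by (simp add: closed_csubspace_def)
  have "?W = Z"
  proof
    show "?W \<subseteq> Z"
      using True by (auto intro: complex_vector.subspace_add[OF sub] complex_vector.subspace_scale[OF sub])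
    show "Z \<subseteq> ?W"
    proof
      fix z assume "z \<in> Z"
      then have "z = z + 0 *\<^sub>C v \<and> z \<in> Z" by simp
      then show "z \<in> ?W" by blast
    qed
  qed
  then show ?thesis using Z by simp
next
  case False
  have sub: "complex_vector.subspace Z" and cl: "closed Z"
    using Z by (auto simp: closed_csubspace_def)
  have "Z \<noteq> {}" using complex_vector.subspace_0[OF sub] by auto
  define d where "d = infdist v Z"
  have "d > 0"
    using False cl \<open>Z \<noteq> {}\<close> infdist_nonneg[of v Z] in_closed_iff_infdist_zero[of Z v]
    by (force simp: d_def)
  have bound: "norm c * d \<le> norm (z + c *\<^sub>C v)" if "z \<in> Z" for z c
  proof (cases "c = 0")
    case False
    have "- (inverse c *\<^sub>C z) \<in> Z"
      using that by (intro complex_vector.subspace_neg[OF sub] complex_vector.subspace_scale[OF sub])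
    then have "d \<le> norm (inverse c *\<^sub>C z + v)"
      using infdist_le[of "- (inverse c *\<^sub>C z)" Z v] by (simp add: d_def dist_norm add.commute)
    then have "norm c * d \<le> norm (c *\<^sub>C (inverse c *\<^sub>C z + v))"
      by (simp add: norm_scaleC mult_left_mono)
    then show ?thesis using False by (simp add: scaleC_add_right scaleC_scaleC scaleC_one)
  qed simp
  have "complex_vector.subspace ?W"
  proof (rule complex_vector.subspaceI)
    show "0 \<in> ?W"
      using complex_vector.subspace_0[OF sub] by (auto intro!: exI[of _ 0])
  next
    fix x y assume "x \<in> ?W" "y \<in> ?W"
    then obtain z c z' c' where "z \<in> Z" "z' \<in> Z" "x = z + c *\<^sub>C v" "y = z' + c' *\<^sub>C v" by blast
    then show "x + y \<in> ?W"
      by (auto intro!: exI[of _ "z + z'"] exI[of _ "c + c'"] complex_vector.subspace_add[OF sub]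
          simp: scaleC_add_left)
  next
    fix a x assume "x \<in> ?W"
    then obtain z c where "z \<in> Z" "x = z + c *\<^sub>C v" by blast
    then show "a *\<^sub>C x \<in> ?W"
      by (auto intro!: exI[of _ "a *\<^sub>C z"] exI[of _ "a * c"] complex_vector.subspace_scale[OF sub]
          simp: scaleC_add_right scaleC_scaleC)
  qed
  moreover have "closed ?W"
    unfolding closed_sequential_limits
  proof (intro allI impI, elim conjE)
    fix y l assume y: "\<forall>n. y n \<in> ?W" "y \<longlonglongrightarrow> l"
    then obtain z c where zc: "\<And>n. z n \<in> Z" "\<And>n. y n = z n + c n *\<^sub>C v" by simp metis
    have "Cauchy c"
    proof (rule metric_CauchyI)
      fix e :: real assume "e > 0"
      with \<open>d > 0\<close> have "e * d > 0" by simp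
      then obtain M where M: "\<And>m n. m \<ge> M \<Longrightarrow> n \<ge> M \<Longrightarrow> dist (y m) (y n) < e * d"
        using LIMSEQ_imp_Cauchy[OF y(2)] metric_CauchyD by blast
      have "dist (c m) (c n) < e" if "m \<ge> M" "n \<ge> M" for m n
      proof -
        have "norm (c m - c n) * d \<le> norm ((z m - z n) + (c m - c n) *\<^sub>C v)"
          by (intro bound complex_vector.subspace_diff[OF sub] zc)
        also have "\<dots> = dist (y m) (y n)"
          by (simp add: zc dist_norm complex_vector.scale_left_diff_distrib algebra_simps)
        also have "\<dots> < e * d" using M that by blast
        finally show ?thesis using \<open>d > 0\<close> by (simp add: dist_norm)
      qed
      then show "\<exists>M. \<forall>m\<ge>M. \<forall>n\<ge>M. dist (c m) (c n) < e" by blast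
    qed
    then obtain c0 where c0: "c \<longlonglongrightarrow> c0" using Cauchy_convergent convergentD by blast
    have "(\<lambda>n. c n *\<^sub>C v) \<longlonglongrightarrow> c0 *\<^sub>C v"
      using c0 by (rule bounded_linear.tendsto[OF bounded_linear_scaleC_left])
    then have "(\<lambda>n. y n - c n *\<^sub>C v) \<longlonglongrightarrow> l - c0 *\<^sub>C v" by (intro tendsto_diff y)
    then have "l - c0 *\<^sub>C v \<in> Z" by (rule closed_sequentially[OF cl, rotated]) (simp add: zc)
    then show "l \<in> ?W" by (auto intro!: exI[of _ "l - c0 *\<^sub>C v"] exI[of _ c0])
  qed
  ultimately show ?thesis by (simp add: closed_csubspace_def)
qed

lemma closed_csubspace_plus_span:
  assumes "closed_csubspace Z" "finite F"
  shows "closed_csubspace {y. \<exists>f\<in>complex_vector.span F. y - f \<in> Z}"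
  using assms(2)
proof (induction F rule: finite_induct)
  case empty
  then show ?case using assms(1) by simp
next
  case (insert v F)
  let ?W = "{y. \<exists>f\<in>complex_vector.span F. y - f \<in> Z}"
  have "{y. \<exists>f\<in>complex_vector.span (insert v F). y - f \<in> Z} = {w + c *\<^sub>C v | w c. w \<in> ?W}"
  proof (intro set_eqI iffI)
    fix y assume "y \<in> {y. \<exists>f\<in>complex_vector.span (insert v F). y - f \<in> Z}"
    then obtain f c where "f - c *\<^sub>C v \<in> complex_vector.span F" "y - f \<in> Z"
      by (auto simp: complex_vector.span_insert)
    then show "y \<in> {w + c *\<^sub>C v | w c. w \<in> ?W}"
      by (auto intro!: exI[of _ "y - c *\<^sub>C v"] exI[of _ c] bexI[of _ "f - c *\<^sub>C v"])
  next
    fix y assume "y \<in> {w + c *\<^sub>C v | w c. w \<in> ?W}"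
    then obtain w c f where "y = w + c *\<^sub>C v" "f \<in> complex_vector.span F" "w - f \<in> Z" by auto
    then show "y \<in> {y. \<exists>f\<in>complex_vector.span (insert v F). y - f \<in> Z}"
      by (auto simp: complex_vector.span_insert algebra_simps intro!: exI[of _ "f + c *\<^sub>C v"] exI[of _ c])
  qed
  then show ?case using closed_csubspace_plus_line[OF insert.IH, of v] by simp
qed

text \<open>An argument in the style of Riesz's lemma. If the closed subspace
  \<open>Z + span F\<close> missed \<open>y\<close>, a difference \<open>y - w\<close> of norm less
  than twice the distance of \<open>y\<close>, scaled to norm \<open>s\<close>, could be
  approximated from the subspace up to \<open>s / 2\<close>. Scaling back gives a point of the
  subspace closer to \<open>y\<close> than that distance.\<close>

lemma span_plus_csubspace_eq_UNIV:
  fixes Z :: "'a::complex_normed_vector set"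
  assumes Z: "closed_csubspace Z" and "finite F" and "s > 0"
    and approx: "\<And>v. norm v \<le> s \<Longrightarrow> \<exists>f\<in>complex_vector.span F. \<exists>z\<in>Z. norm (v - f - z) \<le> s / 2"
  shows "\<exists>f\<in>complex_vector.span F. y - f \<in> Z"
proof (rule ccontr)
  let ?W = "{y. \<exists>f\<in>complex_vector.span F. y - f \<in> Z}"
  assume "\<not> ?thesis"
  then have "y \<notin> ?W" by simp
  have W: "complex_vector.subspace ?W" "closed ?W"
    using closed_csubspace_plus_span[OF Z \<open>finite F\<close>] by (auto simp: closed_csubspace_def)
  then have "?W \<noteq> {}" using complex_vector.subspace_0 by blast
  define d where "d = infdist y ?W"
  have "d > 0"
    using \<open>y \<notin> ?W\<close> W(2) \<open>?W \<noteq> {}\<close> infdist_nonneg[of y ?W] in_closed_iff_infdist_zero[of ?W y]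
    by (force simp: d_def)
  have "\<exists>w\<in>?W. dist y w < 2 * d"
    using \<open>d > 0\<close> \<open>?W \<noteq> {}\<close> cInf_lessD[of "(dist y) ` ?W" "2 * d"]
    by (auto simp: d_def infdist_notempty)
  then obtain w where w: "w \<in> ?W" "norm (y - w) < 2 * d" by (auto simp: dist_norm)
  define v where "v = y - w"
  have "v \<noteq> 0" using w \<open>y \<notin> ?W\<close> by (auto simp: v_def)
  define r where "r = s / norm v"
  have "r > 0" using \<open>s > 0\<close> \<open>v \<noteq> 0\<close> by (simp add: r_def)
  have "norm (r *\<^sub>R v) \<le> s" using \<open>v \<noteq> 0\<close> \<open>s > 0\<close> by (simp add: r_def)
  then obtain f z where fz: "f \<in> complex_vector.span F" "z \<in> Z" "norm (r *\<^sub>R v - f - z) \<le> s / 2"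
    using approx by blast
  then have "f + z \<in> ?W" by (auto intro!: bexI[of _ f])
  note complex_vector.subspace_add[OF W(1) w(1) complex_vector.subspace_scale[OF W(1) this]]
  then have "w + (1/r) *\<^sub>R (f + z) \<in> ?W"
    unfolding scaleR_scaleC .
  then have "d \<le> norm (v - (1/r) *\<^sub>R (f + z))"
    using infdist_le[of "w + (1/r) *\<^sub>R (f + z)" ?W y] by (simp add: d_def v_def dist_norm diff_diff_eq)
  also have "v - (1/r) *\<^sub>R (f + z) = (1/r) *\<^sub>R (r *\<^sub>R v - f - z)"
    using \<open>r > 0\<close> by (simp add: scaleR_diff_right scaleR_add_right)
  also have "norm \<dots> \<le> (1/r) * (s/2)" using fz(3) \<open>r > 0\<close> mult_left_mono[OF fz(3), of "1/r"] by simp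
  also have "\<dots> = norm v / 2" using \<open>s > 0\<close> by (simp add: r_def)
  also have "\<dots> < d" using w by (simp add: v_def)
  finally show False by simp
qed

section \<open>Bases of quotients\<close>

lemma quot_eq_iff:
  assumes "complex_vector.subspace E"
  shows "quot E x = quot E y \<longleftrightarrow> x - y \<in> E"
proof
  assume "quot E x = quot E y"
  moreover have "x \<in> quot E x"
    using complex_vector.subspace_0[OF assms] by (force simp: quot_def)
  ultimately obtain e where "e \<in> E" "x = y + e" by (auto simp: quot_def)
  then show "x - y \<in> E" by simp
next
  have *: "quot E x \<subseteq> quot E y" if "x - y \<in> E" for x y
  proof
    fix z assume "z \<in> quot E x"
    then obtain e where "e \<in> E" "z = x + e" by (auto simp: quot_def)
    then have "(x - y) + e \<in> E" "z = y + ((x - y) + e)"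
      using that complex_vector.subspace_add[OF assms] by auto
    then show "z \<in> quot E y" unfolding quot_def by (rule image_eqI[rotated])
  qed
  assume "x - y \<in> E"
  moreover from this have "y - x \<in> E"
    using complex_vector.subspace_neg[OF assms, of "x - y"] by simp
  ultimately show "quot E x = quot E y" using * by blast
qed

text \<open>Modulo \<open>E\<close> every basis element is a combination of \<open>F\<close>. With
  more basis elements than elements of \<open>F\<close>, some nontrivial combination has all its
  \<open>F\<close>-coefficients equal to zero and so lies in \<open>E\<close>.\<close>

lemma quot_basis_card_le:
  assumes E: "complex_vector.subspace E" and "finite F" and "quot_basis E B"
    and sp: "\<And>y. \<exists>f\<in>complex_vector.span F. y - f \<in> E"
  shows "card B \<le> card F"
proof (rule ccontr)
  assume "\<not> card B \<le> card F"
  have B: "finite B" "\<And>c b. (\<Sum>b\<in>B. c b *\<^sub>C b) \<in> E \<Longrightarrow> b \<in> B \<Longrightarrow> c b = 0"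
    using assms(3) by (auto simp: quot_basis_def quot_eq_iff[OF E])
  have "\<exists>a. y - (\<Sum>f\<in>F. a f *\<^sub>C f) \<in> E" for y
    using sp[of y] span_finite_obtain[OF \<open>finite F\<close>] by metis
  then obtain a where a: "\<And>y. y - (\<Sum>f\<in>F. a y f *\<^sub>C f) \<in> E" by metis
  obtain c where c: "\<exists>b\<in>B. c b \<noteq> 0" "\<forall>f\<in>F. (\<Sum>b\<in>B. c b * a b f) = 0"
    using linear_system_nontrivial_solution[OF \<open>finite F\<close> B(1), of "\<lambda>f b. a b f"] \<open>\<not> _\<close> by auto
  have "(\<Sum>b\<in>B. c b *\<^sub>C (b - (\<Sum>f\<in>F. a b f *\<^sub>C f))) \<in> E"
    by (intro complex_vector.subspace_sum complex_vector.subspace_scale E a)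
  also have "(\<Sum>b\<in>B. c b *\<^sub>C (b - (\<Sum>f\<in>F. a b f *\<^sub>C f)))
      = (\<Sum>b\<in>B. c b *\<^sub>C b) - (\<Sum>b\<in>B. \<Sum>f\<in>F. (c b * a b f) *\<^sub>C f)"
    by (simp add: complex_vector.scale_right_diff_distrib sum_subtractf
        complex_vector.scale_sum_right scaleC_scaleC)
  also have "(\<Sum>b\<in>B. \<Sum>f\<in>F. (c b * a b f) *\<^sub>C f) = (\<Sum>f\<in>F. (\<Sum>b\<in>B. c b * a b f) *\<^sub>C f)"
    by (subst sum.swap) (simp add: complex_vector.scale_sum_left)
  also have "\<dots> = 0" using c(2) by simp
  finally show False using B(2) c(1) by auto
qed

text \<open>Infinite dimension of a quotient is encoded as the absence of a finite basis, so a basis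
  has to be produced: a set of least cardinality spanning modulo \<open>E\<close> is one.\<close>

lemma quot_dim_finite:
  assumes E: "complex_vector.subspace E" and "finite F"
    and sp: "\<And>y. \<exists>f\<in>complex_vector.span F. y - f \<in> E"
  shows "\<not> quot_dim_infinite E"
proof -
  define Q where "Q n \<longleftrightarrow> (\<exists>F. finite F \<and> card F = n \<and> (\<forall>y. \<exists>f\<in>complex_vector.span F. y - f \<in> E))" for n
  have "Q (card F)" using assms by (auto simp: Q_def)
  define n where "n = (LEAST n. Q n)"
  have "Q n" unfolding n_def by (rule LeastI) fact
  then obtain B where B: "finite B" "card B = n" "\<And>y. \<exists>f\<in>complex_vector.span B. y - f \<in> E"
    by (auto simp: Q_def)
  have min: "\<not> Q m" if "m < n" for m using that not_less_Least unfolding n_def by blast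
  have "\<exists>c. y - (\<Sum>b\<in>B. c b *\<^sub>C b) \<in> E" for y
    using B(3)[of y] span_finite_obtain[OF \<open>finite B\<close>] by metis
  moreover have "c b = 0" if c: "(\<Sum>b\<in>B. c b *\<^sub>C b) \<in> E" "b \<in> B" for c b
  proof (rule ccontr)
    assume "c b \<noteq> 0"
    let ?u = "\<Sum>b\<in>B-{b}. c b *\<^sub>C b"
    let ?S = "complex_vector.span (B - {b})"
    have eq: "(\<Sum>b\<in>B. c b *\<^sub>C b) = c b *\<^sub>C b + ?u" by (simp add: sum.remove[OF \<open>finite B\<close> \<open>b \<in> B\<close>])
    have u: "?u \<in> ?S"
      by (intro complex_vector.span_sum complex_vector.span_scale complex_vector.span_base)
    have "\<exists>f\<in>?S. y - f \<in> E" for y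
    proof -
      obtain f where f: "f \<in> complex_vector.span B" "y - f \<in> E" using B(3) by blast
      have "insert b (B - {b}) = B" using \<open>b \<in> B\<close> by blast
      then obtain a where a: "f - a *\<^sub>C b \<in> ?S"
        using f(1) complex_vector.span_insert[of b "B - {b}"] by auto
      have "(f - a *\<^sub>C b) - (a / c b) *\<^sub>C ?u \<in> ?S"
        by (intro complex_vector.span_diff complex_vector.span_scale u a)
      moreover have "y - f + (a / c b) *\<^sub>C (\<Sum>b\<in>B. c b *\<^sub>C b) \<in> E"
        by (intro complex_vector.subspace_add complex_vector.subspace_scale E f c)
      then have "y - ((f - a *\<^sub>C b) - (a / c b) *\<^sub>C ?u) \<in> E"
        using \<open>c b \<noteq> 0\<close> by (simp add: eq scaleC_add_right scaleC_scaleC algebra_simps)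
      ultimately show ?thesis by blast
    qed
    then have "Q (card (B - {b}))" unfolding Q_def using B(1) by blast
    moreover have "card (B - {b}) < n" using B \<open>b \<in> B\<close> by (metis card_Diff1_less)
    ultimately show False using min by blast
  qed
  ultimately have "quot_basis E B"
    using B(1) by (auto simp: quot_basis_def quot_eq_iff[OF E])
  then show ?thesis by (auto simp: quot_dim_infinite_def quot_dim_eq_def)
qed

section \<open>Operators to and from \<open>\<ell>\<^sup>1\<close>\<close>

lift_definition ell1_unit :: "nat \<Rightarrow> ell1" is "\<lambda>n m. if m = n then 1 else 0"
  by (rule summable_finite[of "{_}"]) auto

lemma ell1_summable: "summable (\<lambda>n. norm (ell1_nth a n))"
  using ell1_nth by simp

lemma norm_ell1_nth_le: "norm (ell1_nth a n) \<le> norm a"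
  unfolding norm_ell1.rep_eq
  using sum_le_suminf[OF ell1_summable, of "{n}" a] by simp

lemma norm_ell1_unit [simp]: "norm (ell1_unit n) = 1"
proof -
  have "(\<lambda>m. norm (ell1_nth (ell1_unit n) m)) sums (\<Sum>m\<in>{n}. norm (ell1_nth (ell1_unit n) m))"
    by (rule sums_finite) (auto simp: ell1_unit.rep_eq)
  then show ?thesis by (simp add: norm_ell1.rep_eq sums_iff ell1_unit.rep_eq)
qed

lemma bounded_clinear_ell1_nth: "bounded_clinear (\<lambda>a. ell1_nth a n)"
  by (rule bounded_clinearI[where K = 1])
    (auto simp: plus_ell1.rep_eq scaleC_ell1.rep_eq scaleC_complex_def norm_ell1_nth_le)

text \<open>This functional takes the value 1 on every unit vector. It serves to show that the unit
  vectors do not cluster weakly at 0, although all their coordinates tend to 0.\<close>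

lemma bounded_clinear_ell1_suminf: "bounded_clinear (\<lambda>a. suminf (ell1_nth a))"
proof (rule bounded_clinearI[where K = 1])
  fix a b c
  note s = summable_norm_cancel[OF ell1_summable]
  show "suminf (ell1_nth (a + b)) = suminf (ell1_nth a) + suminf (ell1_nth b)"
    using suminf_add[OF s s] by (simp add: plus_ell1.rep_eq)
  show "suminf (ell1_nth (c *\<^sub>C a)) = c *\<^sub>C suminf (ell1_nth a)"
    using suminf_mult[OF s] by (simp add: scaleC_ell1.rep_eq scaleC_complex_def)
  show "norm (suminf (ell1_nth a)) \<le> 1 * norm a"
    using summable_norm[OF ell1_summable] by (simp add: norm_ell1.rep_eq)
qed

text \<open>The series converges absolutely since \<open>x\<close> is bounded. It is kept in the
  conclusion so that bounded functionals can be applied to it term by term.\<close>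

lemma ell1_synthesis:
  fixes x :: "nat \<Rightarrow> 'a::{complex_normed_vector, banach}"
  assumes bd: "\<And>n. norm (x n) \<le> C"
  shows "\<exists>S. bounded_clinear S \<and> (\<forall>a. (\<lambda>n. ell1_nth a n *\<^sub>C x n) sums S a)"
proof -
  have le: "norm (ell1_nth a n *\<^sub>C x n) \<le> C * norm (ell1_nth a n)" for a n
    using bd[of n] mult_right_mono[OF bd[of n], of "norm (ell1_nth a n)"]
    by (simp add: norm_scaleC mult.commute)
  have sm: "summable (\<lambda>n. norm (ell1_nth a n *\<^sub>C x n))" for a
    using le by (intro summable_comparison_test'[OF summable_mult[OF ell1_summable[of a], of C]]) auto
  note s = summable_norm_cancel[OF sm]
  define S where "S a = (\<Sum>n. ell1_nth a n *\<^sub>C x n)" for a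
  have "bounded_clinear S"
  proof (rule bounded_clinearI[where K = C])
    fix a b c
    show "S (a + b) = S a + S b"
      using suminf_add[OF s s] by (simp add: S_def plus_ell1.rep_eq scaleC_add_left)
    show "S (c *\<^sub>C a) = c *\<^sub>C S a"
      using bounded_linear.suminf[OF bounded_linear_scaleC s, of c a]
      by (simp add: S_def scaleC_ell1.rep_eq scaleC_scaleC)
    have "norm (S a) \<le> (\<Sum>n. norm (ell1_nth a n *\<^sub>C x n))"
      unfolding S_def by (rule summable_norm[OF sm])
    also have "\<dots> \<le> (\<Sum>n. C * norm (ell1_nth a n))"
      by (intro suminf_le le sm summable_mult ell1_summable)
    also have "\<dots> = C * norm a"
      by (simp add: norm_ell1.rep_eq suminf_mult[OF ell1_summable])
    finally show "norm (S a) \<le> C * norm a" .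
  qed
  moreover have "(\<lambda>n. ell1_nth a n *\<^sub>C x n) sums S a" for a
    unfolding S_def using s by (rule summable_sums)
  ultimately show ?thesis by blast
qed

section \<open>Complemented copies as factorizations of the identity\<close>

lemma isomorphism_onto_inverse:
  assumes iso: "isomorphism_onto E F f" and E: "complex_vector.subspace E"
  obtains g where "homeomorphism E F f g"
    "\<And>x y. x \<in> F \<Longrightarrow> y \<in> F \<Longrightarrow> g (x + y) = g x + g y"
    "\<And>c x. x \<in> F \<Longrightarrow> g (c *\<^sub>C x) = c *\<^sub>C g x"
proof -
  obtain g where g: "homeomorphism E F f g"
    and add: "\<And>x y. x \<in> E \<Longrightarrow> y \<in> E \<Longrightarrow> f (x + y) = f x + f y"
    and scale: "\<And>c x. x \<in> E \<Longrightarrow> f (c *\<^sub>C x) = c *\<^sub>C f x"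
    using iso by (auto simp: isomorphism_onto_def)
  have gE: "g x \<in> E" "f (g x) = x" if "x \<in> F" for x
    using g that by (auto simp: homeomorphism_def)
  have gf: "g (f x) = x" if "x \<in> E" for x
    using g that by (auto simp: homeomorphism_def)
  show thesis
  proof (rule that[OF g])
    fix x y assume "x \<in> F" "y \<in> F"
    then show "g (x + y) = g x + g y"
      using gf[of "g x + g y"] by (simp add: add gE complex_vector.subspace_add[OF E])
  next
    fix c x assume "x \<in> F"
    then show "g (c *\<^sub>C x) = c *\<^sub>C g x"
      using gf[of "c *\<^sub>C g x"] by (simp add: scale gE complex_vector.subspace_scale[OF E])
  qed
qed

text \<open>The map \<open>\<lambda>x. A (B x)\<close> is a projection onto \<open>range A\<close>,
  and \<open>range A\<close> is the kernel of the complementary projection, hence closed.\<close>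

lemma retract_of_ell1:
  fixes A :: "ell1 \<Rightarrow> 'a::complex_normed_vector"
  assumes A: "bounded_clinear A" and B: "bounded_clinear B" and BA: "\<And>a. B (A a) = a"
  shows "closed_csubspace (range A)" "isomorphic_to_ell1 (range A)" "complemented (range A)"
proof -
  have "range A = {x. x - A (B x) = 0}"
    using BA by (auto simp: image_def)
  moreover have "bounded_clinear (\<lambda>x. A (B x))"
    by (rule bounded_clinear_compose[OF A B])
  then have "bounded_clinear (\<lambda>x. x - A (B x))"
    by (intro bounded_clinear_sub) (simp add: bounded_clinear_def)
  ultimately show "closed_csubspace (range A)"
    using kernel_csubspace[of "\<lambda>x. x - A (B x)"] by metis
  have "homeomorphism UNIV (range A) A B"
    by (simp add: homeomorphism_def bounded_clinear_continuous_on A B BA image_image)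
  then show "isomorphic_to_ell1 (range A)"
    unfolding isomorphic_to_ell1_def isomorphism_onto_def
    by (auto intro!: exI[of _ A] simp: bounded_clinear_add[OF A] bounded_clinear_scaleC[OF A])
  show "complemented (range A)"
    unfolding complemented_def using BA
    by (intro exI[of _ "\<lambda>x. A (B x)"] conjI bounded_clinear_compose[OF A B]) (auto simp: image_def, metis)
qed

text \<open>From left to right, \<open>S\<close> is the isomorphism \<open>u\<close> onto
  \<open>E\<close>, and \<open>R\<close> projects onto \<open>F\<close>, then inverts
  \<open>T\<close> and \<open>u\<close>. Conversely, \<open>range S\<close> has the left inverse
  \<open>\<lambda>x. R (T x)\<close> and \<open>range (\<lambda>a. T (S a))\<close> has the left
  inverse \<open>R\<close>, so both are complemented copies.\<close>

lemma fixes_complemented_copy_of_ell1_iff: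
  assumes T: "bounded_clinear T"
  shows "fixes_complemented_copy_of_ell1 T \<longleftrightarrow>
    (\<exists>R S. bounded_clinear R \<and> bounded_clinear S \<and> (\<forall>a::ell1. R (T (S a)) = a))"
proof
  assume "fixes_complemented_copy_of_ell1 T"
  then obtain E F u P where E: "closed_csubspace E"
    and u: "isomorphism_onto (UNIV :: ell1 set) E u" and iso: "isomorphism_onto E F T"
    and P: "bounded_clinear P" "range P = F" "\<And>x. P (P x) = P x"
    by (auto simp: fixes_complemented_copy_of_ell1_def isomorphic_to_ell1_def complemented_def)
  obtain u' where u': "homeomorphism UNIV E u u'"
    "\<And>x y. x \<in> E \<Longrightarrow> y \<in> E \<Longrightarrow> u' (x + y) = u' x + u' y"
    "\<And>c x. x \<in> E \<Longrightarrow> u' (c *\<^sub>C x) = c *\<^sub>C u' x"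
    using isomorphism_onto_inverse[OF u complex_vector.subspace_UNIV] by metis
  obtain T' where T': "homeomorphism E F T T'"
    "\<And>x y. x \<in> F \<Longrightarrow> y \<in> F \<Longrightarrow> T' (x + y) = T' x + T' y"
    "\<And>c x. x \<in> F \<Longrightarrow> T' (c *\<^sub>C x) = c *\<^sub>C T' x"
    using isomorphism_onto_inverse[OF iso] E by (metis closed_csubspace_def)
  have PF: "P y \<in> F" for y using P by auto
  have T'E: "T' y \<in> E" if "y \<in> F" for y using T' that by (auto simp: homeomorphism_def)
  have "bounded_clinear u"
    using u u' by (intro continuous_linear_imp_bounded_clinear)
      (auto simp: isomorphism_onto_def homeomorphism_def)
  moreover have "bounded_clinear (\<lambda>y. u' (T' (P y)))"
  proof (rule continuous_linear_imp_bounded_clinear)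
    show "continuous_on UNIV (\<lambda>y. u' (T' (P y)))"
    proof (rule continuous_on_compose2[of E u'])
      show "continuous_on UNIV (\<lambda>y. T' (P y))"
        by (rule continuous_on_compose2[of F T'])
          (use T' P bounded_clinear_continuous_on in \<open>auto simp: homeomorphism_def\<close>)
    qed (use u' T'E PF in \<open>auto simp: homeomorphism_def\<close>)
  qed (simp_all add: bounded_clinear_add[OF P(1)] bounded_clinear_scaleC[OF P(1)] T' PF T'E u')
  moreover have "u' (T' (P (T (u a)))) = a" for a
  proof -
    have "u a \<in> E" using u' by (auto simp: homeomorphism_def)
    then have "T (u a) \<in> F" "T' (T (u a)) = u a" using T' by (auto simp: homeomorphism_def)
    moreover from this(1) have "P (T (u a)) = T (u a)" using P by auto
    ultimately show ?thesis using u' by (simp add: homeomorphism_def)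
  qed
  ultimately show "\<exists>R S. bounded_clinear R \<and> bounded_clinear S \<and> (\<forall>a::ell1. R (T (S a)) = a)"
    by blast
next
  assume "\<exists>R S. bounded_clinear R \<and> bounded_clinear S \<and> (\<forall>a::ell1. R (T (S a)) = a)"
  then obtain R S where R: "bounded_clinear R" and S: "bounded_clinear S"
    and RTS: "\<And>a::ell1. R (T (S a)) = a" by blast
  have RT: "bounded_clinear (\<lambda>x. R (T x))" and TS: "bounded_clinear (\<lambda>a. T (S a))"
    by (rule bounded_clinear_compose[OF R T], rule bounded_clinear_compose[OF T S])
  have SR: "bounded_clinear (\<lambda>y. S (R y))" by (rule bounded_clinear_compose[OF S R])
  have "homeomorphism (range S) (range (\<lambda>a. T (S a))) T (\<lambda>y. S (R y))"
    by (simp add: homeomorphism_def bounded_clinear_continuous_on T SR RTS image_image)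
  then have "isomorphism_onto (range S) (range (\<lambda>a. T (S a))) T"
    unfolding isomorphism_onto_def
    by (auto simp: bounded_clinear_add[OF T] bounded_clinear_scaleC[OF T])
  then show "fixes_complemented_copy_of_ell1 T"
    unfolding fixes_complemented_copy_of_ell1_def
    using retract_of_ell1[of S "\<lambda>x. R (T x)", OF S RT RTS]
      retract_of_ell1[of "\<lambda>a. T (S a)" R, OF TS R RTS] by blast
qed

lemma fixes_complemented_imp_fixes:
  "fixes_complemented_copy_of_ell1 T \<Longrightarrow> fixes_copy_of_ell1 T"
  by (auto simp: fixes_complemented_copy_of_ell1_def fixes_copy_of_ell1_def)

section \<open>Properties excluded by a fixed copy of the sequence space\<close>

lemma ell1_nth_sum: "ell1_nth (sum f A) m = (\<Sum>a\<in>A. ell1_nth (f a) m)"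
  by (rule bounded_clinear_sum[OF bounded_clinear_ell1_nth])

lemma isomorphic_to_ell1_not_finite_dim:
  assumes "isomorphic_to_ell1 E"
  shows "\<not> finite_dim E"
proof
  assume "finite_dim E"
  then obtain B where B: "finite B" "E \<subseteq> complex_vector.span B" by (auto simp: finite_dim_def)
  obtain u :: "ell1 \<Rightarrow> 'a" and u' where u: "\<And>x y. u (x + y) = u x + u y"
    "\<And>c x. u (c *\<^sub>C x) = c *\<^sub>C u x" and inv: "\<And>x. u' (u x) = x" and ran: "range u = E"
    using assms by (auto simp: isomorphic_to_ell1_def isomorphism_onto_def homeomorphism_def)
  have "\<exists>c. u (ell1_unit j) = (\<Sum>b\<in>B. c b *\<^sub>C b)" for j
    using B ran span_finite_obtain[OF B(1)] by (metis rangeI subsetD)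
  then obtain A where A: "\<And>j. u (ell1_unit j) = (\<Sum>b\<in>B. A j b *\<^sub>C b)" by metis
  \<comment> \<open>This index set has \<open>card B + 1\<close> elements, one more than the number
    of equations.\<close>
  let ?J = "{..card B}"
  obtain c where c: "\<exists>j\<in>?J. c j \<noteq> 0" "\<forall>b\<in>B. (\<Sum>j\<in>?J. c j * A j b) = 0"
    using linear_system_nontrivial_solution[OF B(1), of ?J "\<lambda>b j. A j b"] by auto
  have u0: "u 0 = 0" using u(1)[of 0 0] by simp
  have u_sum: "u (sum f K) = (\<Sum>k\<in>K. u (f k))" if "finite K" for f :: "nat \<Rightarrow> ell1" and K
    using that by (induction K rule: finite_induct) (auto simp: u u0)
  let ?a = "\<Sum>j\<in>?J. c j *\<^sub>C ell1_unit j"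
  have "u ?a = (\<Sum>j\<in>?J. \<Sum>b\<in>B. (c j * A j b) *\<^sub>C b)"
    by (simp add: u_sum u A complex_vector.scale_sum_right scaleC_scaleC)
  also have "\<dots> = (\<Sum>b\<in>B. (\<Sum>j\<in>?J. c j * A j b) *\<^sub>C b)"
    by (subst sum.swap) (simp add: complex_vector.scale_sum_left)
  also have "\<dots> = u 0" using c by (simp add: u0)
  finally have "?a = 0" using inv by metis
  moreover have "ell1_nth ?a j = c j" if "j \<in> ?J" for j
  proof -
    have "ell1_nth ?a j = (\<Sum>i\<in>?J. c i * (if j = i then 1 else 0))"
      by (simp only: ell1_nth_sum scaleC_ell1.rep_eq ell1_unit.rep_eq)
    then show ?thesis using that by (simp add: if_distrib cong: if_cong)
  qed
  ultimately show False using c(1) by (auto simp: zero_ell1.rep_eq)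
qed

lemma strictly_singular_imp_not_fixes_copy_of_ell1:
  assumes "strictly_singular T" shows "\<not> fixes_copy_of_ell1 T"
proof
  assume "fixes_copy_of_ell1 T"
  then obtain E F where EF: "closed_csubspace E" "isomorphic_to_ell1 E" "isomorphism_onto E F T"
    by (auto simp: fixes_copy_of_ell1_def)
  then have "T ` E = F" by (auto simp: isomorphism_onto_def homeomorphism_def)
  then show False
    using assms EF isomorphic_to_ell1_not_finite_dim unfolding strictly_singular_def by blast
qed

text \<open>A continuous inverse on an infinite-dimensional \<open>E\<close> would bound
  \<open>norm (T x)\<close> below on the unit sphere of \<open>E\<close>.\<close>

lemma super_strictly_singular_imp_strictly_singular:
  assumes "super_strictly_singular T" shows "strictly_singular T"
  unfolding strictly_singular_def
proof
  assume "\<exists>E. closed_csubspace E \<and> \<not> finite_dim E \<and> isomorphism_onto E (T ` E) T"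
  then obtain E where E: "complex_vector.subspace E" "\<not> finite_dim E" "isomorphism_onto E (T ` E) T"
    by (auto simp: closed_csubspace_def)
  obtain g where g: "homeomorphism E (T ` E) T g" "\<And>c x. x \<in> T ` E \<Longrightarrow> g (c *\<^sub>C x) = c *\<^sub>C g x"
    using isomorphism_onto_inverse[OF E(3,1)] by metis
  \<comment> \<open>Linearity of \<open>T\<close> is available on \<open>E\<close> only, so this
    comes from homogeneity there.\<close>
  have 0: "T 0 = 0"
    using E(3) complex_vector.subspace_0[OF E(1)]
    unfolding isomorphism_onto_def by (metis complex_vector.scale_zero_left)
  have g0: "g 0 = 0" and "0 \<in> T ` E"
    using g(1) 0 complex_vector.subspace_0[OF E(1)] by (auto simp: homeomorphism_def)
  have "continuous_on (T ` E) g" using g(1) by (simp add: homeomorphism_def)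
  from this[unfolded continuous_on_iff, rule_format, OF \<open>0 \<in> T ` E\<close>, of 1]
  obtain d where d: "d > 0" "\<And>y. y \<in> T ` E \<Longrightarrow> norm y < d \<Longrightarrow> norm (g y) < 1"
    using g0 by auto
  \<comment> \<open>An infinite-dimensional \<open>E\<close> satisfies
    \<open>dim_at_least N E\<close> for every \<open>N\<close>.\<close>
  have "\<exists>x\<in>E. norm x = 1 \<and> norm (T x) \<le> d / 2"
    using assms E d(1) unfolding super_strictly_singular_def dim_at_least_def
    by (metis half_gt_zero)
  then obtain x where x: "x \<in> E" "norm x = 1" "norm (T x) \<le> d / 2" by blast
  then have "norm (g (T x)) < 1" using d by auto
  moreover have "g (T x) = x" using g(1) x by (simp add: homeomorphism_def)
  ultimately show False using x by simp
qed

lemma norm_cdual_apply_le: "norm (cdual_apply f y) \<le> norm f * norm y"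
  by transfer (simp add: bounded_clinear_def onorm)

lemma openin_weak_topology_vimage:
  fixes f :: "'a::complex_normed_vector \<Rightarrow> complex"
  assumes "bounded_clinear f" "open U"
  shows "openin weak_topology {y. f y \<in> U}"
proof -
  have "cdual_apply (CDual f) = f" using assms(1) by (simp add: CDual_inverse)
  then have "{y. f y \<in> U} = cdual_apply (CDual f) -` U" by auto
  then show ?thesis
    unfolding weak_topology_def using assms(2) by (auto intro: topology_generated_by_Basis)
qed

lemma topspace_weak_topology [simp]: "topspace weak_topology = UNIV"
  unfolding weak_topology_def topology_generated_by_topspace by blast

lemma openin_weak_topology_imp_open:
  assumes "openin weak_topology U" shows "open U"
proof -
  have "generate_topology_on {cdual_apply f -` U | f U. open U} U"
    using assms unfolding weak_topology_def by (simp add: openin_topology_generated_by_iff)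
  then show ?thesis
  proof induction
    case (Basis s)
    then obtain f :: "'a cdual" and V where "s = cdual_apply f -` V" "open V" by blast
    moreover have "bounded_clinear (cdual_apply f)" using cdual_apply by simp
    ultimately show ?case by (simp add: bounded_clinear_continuous_on open_vimage)
  qed auto
qed

text \<open>A weakly open cover without a finite subcover: \<open>V n\<close> asks for a nonzero
  coordinate \<open>n\<close> of \<open>R y\<close>, and \<open>V0\<close> asks that the coordinates
  of \<open>R y\<close> do not sum to \<open>r\<close>. If all coordinates vanish, the sum is 0,
  which differs from \<open>r\<close>, so the sets cover everything; but the point
  \<open>z m\<close> lies in \<open>V m\<close> alone.\<close>

lemma factor_ell1_not_weakly_compact:
  assumes R: "bounded_clinear R" and S: "bounded_clinear S" and RTS: "\<And>a::ell1. R (T (S a)) = a"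
  shows "\<not> weakly_compact_operator T"
proof
  let ?W = "weak_topology closure_of (T ` cball 0 1)"
  assume "weakly_compact_operator T"
  then have cp: "compactin weak_topology ?W" by (simp add: weakly_compact_operator_def)
  obtain K where K: "K > 0" "\<And>a. norm (S a) \<le> K * norm a"
    using bounded_clinear_bound[OF S] by blast
  \<comment> \<open>The factor brings the images of the unit vectors under \<open>S\<close> into the
    unit ball.\<close>
  define r :: complex where "r = of_real (1 / K)"
  have "r \<noteq> 0" using K by (simp add: r_def)
  define z where "z m = T (S (r *\<^sub>C ell1_unit m))" for m
  have "z m \<in> T ` cball 0 1" for m
    using K(1) K(2)[of "r *\<^sub>C ell1_unit m"] by (auto simp: z_def norm_scaleC r_def norm_divide)
  then have zW: "z m \<in> ?W" for m
    using closure_of_subset[of "T ` cball 0 1" weak_topology] by auto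
  have Rz: "ell1_nth (R (z m)) n = r * (if n = m then 1 else 0)" for m n
    by (simp add: z_def RTS scaleC_ell1.rep_eq ell1_unit.rep_eq)
  have "(\<lambda>n. ell1_nth (R (z m)) n) sums (\<Sum>n\<in>{m}. ell1_nth (R (z m)) n)" for m
    by (rule sums_finite) (auto simp: Rz)
  then have sz: "suminf (ell1_nth (R (z m))) = r" for m by (simp add: sums_iff Rz[of m m])
  define V where "V n = {y. ell1_nth (R y) n \<in> - {0}}" for n
  define V0 where "V0 = {y. suminf (ell1_nth (R y)) \<in> - {r}}"
  have "openin weak_topology U" if "U \<in> insert V0 (range V)" for U
    using that bounded_clinear_compose[OF bounded_clinear_ell1_nth R]
      bounded_clinear_compose[OF bounded_clinear_ell1_suminf R]
    by (auto simp: V_def V0_def simp del: Compl_iff intro!: openin_weak_topology_vimage)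
  moreover have "?W \<subseteq> \<Union> (insert V0 (range V))"
  proof
    fix y assume "y \<in> ?W"
    show "y \<in> \<Union> (insert V0 (range V))"
    proof (cases "\<forall>n. ell1_nth (R y) n = 0")
      case True
      then have "ell1_nth (R y) = (\<lambda>_. 0)" by auto
      then show ?thesis using \<open>r \<noteq> 0\<close> by (simp add: V0_def)
    qed (auto simp: V_def)
  qed
  ultimately obtain \<F> where \<F>: "finite \<F>" "\<F> \<subseteq> insert V0 (range V)" "?W \<subseteq> \<Union>\<F>"
    using cp unfolding compactin_def by (metis (no_types, lifting))
  then have "finite (\<F> - {V0})" "\<F> - {V0} \<subseteq> range V" by auto
  then obtain N where N: "finite N" "\<F> - {V0} = V ` N"
    by (meson finite_subset_image subset_UNIV)
  then obtain m where m: "m \<notin> N" using ex_new_if_finite[OF infinite_UNIV_nat] by blast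
  obtain U where U: "U \<in> \<F>" "z m \<in> U" using zW \<F>(3) by blast
  then have "U \<noteq> V0" using sz by (auto simp: V0_def)
  then have "U \<in> \<F> - {V0}" using U(1) by simp
  then have "U \<in> V ` N" unfolding N(2) .
  then obtain n where "n \<in> N" "U = V n" by blast
  then show False using U(2) Rz m by (auto simp: V_def split: if_splits)
qed

text \<open>Take for \<open>Z\<close> the kernel of \<open>R\<close>. Since \<open>R\<close> maps
  onto \<open>ell1\<close>, the quotient has infinite dimension, and every \<open>y\<close> is
  congruent to \<open>T (S (R y))\<close> modulo \<open>Z\<close>.\<close>

lemma factor_ell1_not_strictly_cosingular:
  assumes R: "bounded_clinear R" and S: "bounded_clinear S" and RTS: "\<And>a::ell1. R (T (S a)) = a"
  shows "\<not> strictly_cosingular T"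
proof
  assume sc: "strictly_cosingular T"
  let ?Z = "{y. R y = 0}"
  have Z: "closed_csubspace ?Z" by (rule kernel_csubspace[OF R])
  then have sub: "complex_vector.subspace ?Z" by (simp add: closed_csubspace_def)
  have "quot_dim_infinite ?Z"
    unfolding quot_dim_infinite_def
  proof (intro allI notI)
    fix n assume "quot_dim_eq ?Z n"
    then obtain B where B: "finite B" "\<And>y. \<exists>c. y - (\<Sum>b\<in>B. c b *\<^sub>C b) \<in> ?Z"
      by (auto simp: quot_dim_eq_def quot_basis_def quot_eq_iff[OF sub])
    have "(UNIV :: ell1 set) \<subseteq> complex_vector.span (R ` B)"
    proof
      fix a :: ell1
      obtain c where "T (S a) - (\<Sum>b\<in>B. c b *\<^sub>C b) \<in> ?Z" using B(2) by blast
      then have "a = (\<Sum>b\<in>B. c b *\<^sub>C R b)"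
        by (simp add: bounded_clinear_diff[OF R] bounded_clinear_sum[OF R]
            bounded_clinear_scaleC[OF R] RTS)
      also have "\<dots> \<in> complex_vector.span (R ` B)"
        by (intro complex_vector.span_sum complex_vector.span_scale complex_vector.span_base) auto
      finally show "a \<in> complex_vector.span (R ` B)" .
    qed
    then have "finite_dim (UNIV :: ell1 set)" using B(1) unfolding finite_dim_def by blast
    moreover have "isomorphic_to_ell1 (range (\<lambda>a::ell1. a))"
      by (rule retract_of_ell1(2)[of _ "\<lambda>a. a"]) (auto simp: bounded_clinear_def)
    ultimately show False using isomorphic_to_ell1_not_finite_dim by auto
  qed
  moreover have "range (quot ?Z \<circ> T) = range (quot ?Z)"
  proof -
    have "quot ?Z y = quot ?Z (T (S (R y)))" for y
      by (simp add: quot_eq_iff[OF sub] bounded_clinear_diff[OF R] RTS)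
    then show ?thesis by (auto simp: image_def)
  qed
  ultimately show False using sc Z unfolding strictly_cosingular_def by blast
qed

lemma quot_norm_obtain:
  assumes "quot_norm (quot E y) < s" "complex_vector.subspace E"
  obtains e where "e \<in> E" "norm (y + e) < s"
proof -
  have "\<exists>t\<in>norm ` quot E y. t < s"
    using assms complex_vector.subspace_0[OF assms(2)]
    by (intro cInf_lessD) (auto simp: quot_norm_def quot_def)
  then show thesis using that by (auto simp: quot_def)
qed

text \<open>For each \<open>n\<close>, the vectors \<open>y\<close> for which the first
  \<open>n\<close> coordinates of \<open>R y\<close> vanish form a subspace of codimension
  \<open>n\<close>. Modulo it \<open>T (S (R y))\<close> equals \<open>y\<close>, so its modulus is
  at least \<open>1 / (2 * K)\<close>, whatever \<open>n\<close> is.\<close>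

lemma factor_ell1_not_super_strictly_cosingular:
  assumes R: "bounded_clinear R" and S: "bounded_clinear S" and RTS: "\<And>a::ell1. R (T (S a)) = a"
  shows "\<not> super_strictly_cosingular T"
proof -
  have SR: "bounded_clinear (\<lambda>y. S (R y))" by (rule bounded_clinear_compose[OF S R])
  obtain K where K: "K > 0" "\<And>y. norm (S (R y)) \<le> K * norm y"
    using bounded_clinear_bound[OF SR] by blast
  \<comment> \<open>The factor 2 leaves room for a representative of norm less than 2 in a coset of
    quotient norm at most 1, so that the infimum need not be attained.\<close>
  define \<alpha> where "\<alpha> = 1 / (2 * K)"
  have "\<alpha> > 0" using K by (simp add: \<alpha>_def)
  have "ennreal \<alpha> \<le> cosingular_number T n" for n
  proof -
    define E where "E = {y. \<forall>j<n. ell1_nth (R y) j = 0}"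
    have E: "complex_vector.subspace E" "closed E"
    proof -
      have f: "bounded_clinear (\<lambda>y. ell1_nth (R y) j)" for j
        by (rule bounded_clinear_compose[OF bounded_clinear_ell1_nth R])
      show "complex_vector.subspace E"
        unfolding E_def using f by (intro complex_vector.subspaceI)
          (simp_all add: bounded_clinear_0[OF f] bounded_clinear_add[OF f] bounded_clinear_scaleC[OF f])
      have "E = (\<Inter>j<n. {y. ell1_nth (R y) j = 0})" by (auto simp: E_def)
      then show "closed E"
        using kernel_csubspace[OF f] by (auto simp: closed_csubspace_def)
    qed
    define b where "b j = T (S (ell1_unit j))" for j
    have Rb: "R (b j) = ell1_unit j" for j by (simp add: b_def RTS)
    have "inj b" by (rule injI) (metis Rb ell1_unit.rep_eq zero_neq_one)
    have coord: "ell1_nth (R (\<Sum>j<n. c j *\<^sub>C b j)) i = c i" if "i < n" for c i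
    proof -
      have "ell1_nth (R (\<Sum>j<n. c j *\<^sub>C b j)) i = (\<Sum>j<n. c j * (if i = j then 1 else 0))"
        by (simp add: bounded_clinear_sum[OF R] bounded_clinear_scaleC[OF R] Rb ell1_nth_sum
            scaleC_ell1.rep_eq ell1_unit.rep_eq)
      then show ?thesis using that by (simp add: if_distrib cong: if_cong)
    qed
    have reidx: "(\<Sum>y\<in>b ` {..<n}. c y *\<^sub>C y) = (\<Sum>j<n. c (b j) *\<^sub>C b j)" for c
      using \<open>inj b\<close> by (simp add: sum.reindex inj_on_subset[OF \<open>inj b\<close>])
    have "quot_basis E (b ` {..<n})"
      unfolding quot_basis_def quot_eq_iff[OF E(1)] reidx
    proof (intro conjI allI impI ballI)
      fix c y assume "(\<Sum>j<n. c (b j) *\<^sub>C b j) - 0 \<in> E" "y \<in> b ` {..<n}"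
      then show "c y = 0" using coord[of _ "\<lambda>j. c (b j)"] by (auto simp: E_def)
    next
      fix y
      \<comment> \<open>\<open>quot_basis\<close> indexes coefficients by the basis vectors, so the
        coordinate number is recovered through the inverse of \<open>b\<close>.\<close>
      let ?c = "\<lambda>x. ell1_nth (R y) (inv b x)"
      have "(\<Sum>j<n. ?c (b j) *\<^sub>C b j) = (\<Sum>j<n. ell1_nth (R y) j *\<^sub>C b j)"
        using \<open>inj b\<close> by simp
      then have "y - (\<Sum>j<n. ?c (b j) *\<^sub>C b j) \<in> E"
        by (simp add: E_def bounded_clinear_diff[OF R] minus_ell1.rep_eq coord)
      then show "\<exists>c. y - (\<Sum>j<n. c (b j) *\<^sub>C b j) \<in> E" by (rule exI[of _ ?c])
    qed simp
    moreover have "card (b ` {..<n}) = n" using \<open>inj b\<close> by (simp add: card_image inj_on_subset)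
    ultimately have "quot_dim_eq E n" by (auto simp: quot_dim_eq_def)
    then have "surjectivity_modulus T E \<le> cosingular_number T n"
      unfolding cosingular_number_def using E by (intro Sup_upper) (auto simp: closed_csubspace_def)
    moreover have "scaled_quot_ball \<alpha> E \<subseteq> (quot E \<circ> T) ` cball 0 1"
    proof
      fix q assume "q \<in> scaled_quot_ball \<alpha> E"
      then obtain y where y: "q = quot E (\<alpha> *\<^sub>R y)" "quot_norm (quot E y) < 2"
        by (auto simp: scaled_quot_ball_def)
      obtain e where e: "e \<in> E" "norm (y + e) < 2" using quot_norm_obtain[OF y(2) E(1)] by blast
      define x where "x = S (R (\<alpha> *\<^sub>R (y + e)))"
      have "norm x \<le> K * (\<alpha> * norm (y + e))"
        using K(2)[of "\<alpha> *\<^sub>R (y + e)"] \<open>\<alpha> > 0\<close> by (simp add: x_def)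
      also have "\<dots> \<le> K * (\<alpha> * 2)" using e K \<open>\<alpha> > 0\<close> by (intro mult_left_mono) auto
      also have "\<dots> = 1" using K by (simp add: \<alpha>_def)
      finally have "norm x \<le> 1" .
      have "R (\<alpha> *\<^sub>R y - T x) = - (\<alpha> *\<^sub>R R e)"
        by (simp add: x_def bounded_clinear_diff[OF R] RTS scaleR_scaleC bounded_clinear_scaleC[OF R]
            bounded_clinear_add[OF R] scaleC_add_right)
      then have "\<alpha> *\<^sub>R y - T x \<in> E" using e(1)
        by (simp add: E_def uminus_ell1.rep_eq scaleR_ell1.rep_eq)
      then have "q = quot E (T x)" by (simp add: y quot_eq_iff[OF E(1)])
      then show "q \<in> (quot E \<circ> T) ` cball 0 1" using \<open>norm x \<le> 1\<close> by auto
    qed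
    then have "ennreal \<alpha> \<le> surjectivity_modulus T E"
      unfolding surjectivity_modulus_def using \<open>\<alpha> > 0\<close> by (intro Sup_upper) auto
    ultimately show ?thesis by (rule order_trans[rotated])
  qed
  moreover have "0 < ennreal \<alpha>" using \<open>\<alpha> > 0\<close> by simp
  ultimately show ?thesis
    unfolding super_strictly_cosingular_def
    by (metis LIMSEQ_le_const not_less)
qed

section \<open>Compact operators\<close>

text \<open>The norm closure of the image is also weakly compact, the weak topology being coarser.
  Separating functionals make that topology Hausdorff, so this set is weakly closed and contains the
  weak closure.\<close>

lemma compact_imp_weakly_compact:
  fixes T :: "'a::complex_normed_vector \<Rightarrow> 'b::complex_normed_vector"
  assumes T: "compact_operator T" and sep: "\<And>y::'b. y \<noteq> 0 \<Longrightarrow> \<exists>f. cdual_apply f y \<noteq> 0"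
  shows "weakly_compact_operator T"
proof -
  let ?W = "weak_topology :: 'b topology" and ?K = "closure (T ` cball 0 1)"
  have "Hausdorff_space ?W"
    unfolding Hausdorff_space_def
  proof (intro allI impI, elim conjE)
    fix x y :: 'b assume "x \<noteq> y"
    then obtain f where f: "cdual_apply f (x - y) \<noteq> 0" using sep[of "x - y"] by auto
    have bf: "bounded_clinear (cdual_apply f)" using cdual_apply by simp
    with f have "cdual_apply f x \<noteq> cdual_apply f y" by (simp add: bounded_clinear_diff)
    then obtain U V where "open U" "open V" "cdual_apply f x \<in> U" "cdual_apply f y \<in> V" "U \<inter> V = {}"
      by (meson hausdorff)
    then show "\<exists>U V. openin ?W U \<and> openin ?W V \<and> x \<in> U \<and> y \<in> V \<and> disjnt U V"
      by (intro exI[of _ "{z. cdual_apply f z \<in> U}"] exI[of _ "{z. cdual_apply f z \<in> V}"])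
        (auto simp: disjnt_def openin_weak_topology_vimage[OF bf])
  qed
  moreover have K: "compactin ?W ?K"
    unfolding compactin_def
  proof (intro conjI allI impI)
    fix \<U> assume "Ball \<U> (openin ?W) \<and> ?K \<subseteq> \<Union>\<U>"
    moreover from this have "\<And>U. U \<in> \<U> \<Longrightarrow> open U" by (auto intro: openin_weak_topology_imp_open)
    ultimately show "\<exists>\<F>. finite \<F> \<and> \<F> \<subseteq> \<U> \<and> ?K \<subseteq> \<Union>\<F>"
      using T compactE[of ?K \<U>] unfolding compact_operator_def by metis
  qed simp
  ultimately have "closedin ?W ?K" by (rule compactin_imp_closedin)
  then have "?W closure_of (T ` cball 0 1) \<subseteq> ?K" by (intro closure_of_minimal closure_subset)
  then show ?thesis
    unfolding weakly_compact_operator_def using K closed_compactin closedin_closure_of by blast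
qed

lemma compact_operator_finite_net:
  assumes "compact_operator T" "\<epsilon> > 0"
  obtains F where "finite F" "\<And>x. norm x \<le> 1 \<Longrightarrow> \<exists>p\<in>F. norm (T x - p) < \<epsilon>"
proof -
  let ?K = "closure (T ` cball 0 1)"
  obtain F where F: "finite F" "?K \<subseteq> (\<Union>x\<in>F. ball x \<epsilon>)"
    using assms unfolding compact_operator_def compact_eq_totally_bounded by blast
  have "\<exists>p\<in>F. norm (T x - p) < \<epsilon>" if "norm x \<le> 1" for x
  proof -
    have "T x \<in> ?K" using that closure_subset by force
    then show ?thesis using F(2) by (force simp: dist_norm norm_minus_commute)
  qed
  with F(1) that show thesis by blast
qed

text \<open>A vector of \<open>T ` E\<close> annihilated by norming functionals of a finite net of \<open>T ` cball 0 1\<close>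
  has small norm compared with its preimage.\<close>

lemma compact_imp_super_strictly_singular:
  fixes T :: "'a::complex_normed_vector \<Rightarrow> 'b::complex_normed_vector"
  assumes bT: "bounded_clinear T" and T: "compact_operator T"
    and norming: "\<And>y::'b. \<exists>f. norm f \<le> 1 \<and> norm y \<le> 2 * norm (cdual_apply f y)"
  shows "super_strictly_singular T"
  unfolding super_strictly_singular_def
proof (intro allI impI)
  fix \<epsilon> :: real assume "\<epsilon> > 0"
  then have "\<epsilon> / 4 > 0" by simp
  from compact_operator_finite_net[OF T this] obtain F where
    F: "finite F" "\<And>x. norm x \<le> 1 \<Longrightarrow> \<exists>p\<in>F. norm (T x - p) < \<epsilon> / 4" by blast
  obtain f :: "'b \<Rightarrow> 'b cdual" where f: "\<And>y. norm (f y) \<le> 1" "\<And>y. norm y \<le> 2 * norm (cdual_apply (f y) y)"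
    using norming by metis
  have bf: "bounded_clinear (cdual_apply (f p))" for p using cdual_apply by simp
  have "\<exists>x\<in>E. norm x = 1 \<and> norm (T x) \<le> \<epsilon>"
    if E: "complex_vector.subspace E" "dim_at_least (Suc (card F)) E" for E
  proof -
    obtain x where x: "x \<in> E" "x \<noteq> 0" "\<And>p. p \<in> F \<Longrightarrow> cdual_apply (f p) (T x) = 0"
      using exists_common_kernel_vector[OF E F(1), of "\<lambda>p x. cdual_apply (f p) (T x)"]
      by (auto simp: bounded_clinear_add[OF bT] bounded_clinear_scaleC[OF bT]
          bounded_clinear_add[OF bf] bounded_clinear_scaleC[OF bf] scaleC_complex_def)
    define u where "u = complex_of_real (1 / norm x) *\<^sub>C x"
    have u: "u \<in> E" "norm u = 1" "\<And>p. p \<in> F \<Longrightarrow> cdual_apply (f p) (T u) = 0"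
      using x by (auto simp: u_def norm_scaleC norm_divide complex_vector.subspace_scale[OF E(1)]
          bounded_clinear_scaleC[OF bT] bounded_clinear_scaleC[OF bf])
    then obtain p where p: "p \<in> F" "norm (T u - p) < \<epsilon> / 4" using F(2)[of u] by auto
    \<comment> \<open>As \<open>f p\<close> annihilates \<open>T u\<close>, the norm of
      \<open>p\<close> is at most twice its distance from \<open>T u\<close>.\<close>
    have "norm p \<le> 2 * norm (cdual_apply (f p) p)" by (rule f)
    also have "norm (cdual_apply (f p) p) = norm (cdual_apply (f p) (T u - p))"
      using u(3)[OF p(1)] by (simp add: bounded_clinear_diff[OF bf])
    also have "\<dots> \<le> 1 * norm (T u - p)"
      using norm_cdual_apply_le f(1) by (rule order_trans[OF _ mult_right_mono]) auto
    finally have "norm p \<le> \<epsilon> / 2" using p by simp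
    then have "norm (T u) \<le> \<epsilon>"
      using norm_triangle_ineq[of "T u - p" p] p(2) \<open>\<epsilon> > 0\<close> by simp
    then show ?thesis using u by blast
  qed
  then show "\<exists>N\<ge>1. \<forall>E. complex_vector.subspace E \<and> dim_at_least N E \<longrightarrow>
      (\<exists>x\<in>E. norm x = 1 \<and> norm (T x) \<le> \<epsilon>)"
    by (intro exI[of _ "Suc (card F)"]) auto
qed

lemma norm_divide_scaleR_le:
  fixes v :: "'a::real_normed_vector"
  assumes "norm (r *\<^sub>R v - w) \<le> s" "r > 0"
  shows "norm (v - (1 / r) *\<^sub>R w) \<le> s / r"
proof -
  have "v - (1 / r) *\<^sub>R w = (1 / r) *\<^sub>R (r *\<^sub>R v - w)"
    using assms(2) by (simp add: scaleR_diff_right)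
  then have "norm (v - (1 / r) *\<^sub>R w) = norm (r *\<^sub>R v - w) / r" using assms(2) by simp
  then show ?thesis using assms by (simp add: divide_right_mono)
qed

text \<open>Let \<open>F\<close> be an \<epsilon>/2-net of the image of the unit ball. A modulus
  above \<epsilon> would bring every vector of the unit ball within 1/2 of
  \<open>E + span F\<close>, so that this sum is the whole space and the codimension of
  \<open>E\<close> is at most \<open>card F\<close>.\<close>

lemma compact_imp_super_strictly_cosingular:
  assumes T: "compact_operator T"
  shows "super_strictly_cosingular T"
proof -
  have ev: "\<forall>\<^sub>F n in sequentially. cosingular_number T n \<le> ennreal \<epsilon>" if "\<epsilon> > 0" for \<epsilon>
  proof -
    have "\<epsilon> / 2 > 0" using that by simp
    from compact_operator_finite_net[OF T this] obtain F where
      F: "finite F" "\<And>x. norm x \<le> 1 \<Longrightarrow> \<exists>p\<in>F. norm (T x - p) < \<epsilon> / 2" by blast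
    have "surjectivity_modulus T E \<le> ennreal \<epsilon>"
      if E: "closed_csubspace E" and n: "quot_dim_eq E n" "card F < n" for E n
    proof -
      have sub: "complex_vector.subspace E" using E by (simp add: closed_csubspace_def)
      have "\<alpha> \<le> \<epsilon>" if \<alpha>: "scaled_quot_ball \<alpha> E \<subseteq> (quot E \<circ> T) ` cball 0 1" for \<alpha>
      proof (rule ccontr)
        assume "\<not> \<alpha> \<le> \<epsilon>"
        then have "\<alpha> > \<epsilon>" "\<alpha> > 0" using \<open>\<epsilon> > 0\<close> by auto
        have approx: "\<exists>f\<in>complex_vector.span F. \<exists>z\<in>E. norm (v - f - z) \<le> 1 / 2" if "norm v \<le> 1" for v
        proof -
          have "v \<in> quot E v" using complex_vector.subspace_0[OF sub] by (force simp: quot_def)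
          then have "quot_norm (quot E v) \<le> norm v"
            unfolding quot_norm_def by (intro cInf_lower) (auto intro: bdd_belowI[of _ 0])
          then have "quot E (\<alpha> *\<^sub>R v) \<in> scaled_quot_ball \<alpha> E"
            using that by (auto simp: scaled_quot_ball_def)
          then obtain x where x: "norm x \<le> 1" "quot E (\<alpha> *\<^sub>R v) = quot E (T x)" using \<alpha> by force
          then have e: "\<alpha> *\<^sub>R v - T x \<in> E" by (simp add: quot_eq_iff[OF sub])
          obtain p where p: "p \<in> F" "norm (T x - p) < \<epsilon> / 2" using F(2) x(1) by blast
          \<comment> \<open>Modulo \<open>E\<close>, the vector \<open>\<alpha> *\<^sub>R v\<close>
            is \<open>T x\<close>, which is near \<open>p\<close>. Division by \<alpha>, which
            exceeds \<epsilon>, leaves an error of at most 1/2.\<close>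
          have "norm (\<alpha> *\<^sub>R v - (p + (\<alpha> *\<^sub>R v - T x))) \<le> \<epsilon> / 2"
            using p(2) by (simp add: algebra_simps)
          from norm_divide_scaleR_le[OF this \<open>\<alpha> > 0\<close>]
          have "norm (v - (1 / \<alpha>) *\<^sub>R p - (1 / \<alpha>) *\<^sub>R (\<alpha> *\<^sub>R v - T x)) \<le> \<epsilon> / 2 / \<alpha>"
            by (simp add: scaleR_add_right algebra_simps)
          also have "\<dots> \<le> 1 / 2" using \<open>\<alpha> > \<epsilon>\<close> \<open>\<alpha> > 0\<close> by (simp add: field_simps)
          finally show ?thesis
            using p(1) complex_vector.span_scale[OF complex_vector.span_base[OF p(1)]]
              complex_vector.subspace_scale[OF sub e] unfolding scaleR_scaleC by blast
        qed
        obtain B where B: "quot_basis E B" "card B = n" using n by (auto simp: quot_dim_eq_def)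
        have "card B \<le> card F"
          by (rule quot_basis_card_le[OF sub F(1) B(1)])
            (use span_plus_csubspace_eq_UNIV[OF E F(1), of 1] approx in auto)
        with B n show False by simp
      qed
      then show ?thesis
        unfolding surjectivity_modulus_def by (intro Sup_least) (auto intro: ennreal_leI)
    qed
    then show ?thesis
      unfolding cosingular_number_def eventually_sequentially
      by (intro exI[of _ "Suc (card F)"] allI impI Sup_least) auto
  qed
  show ?thesis
    unfolding super_strictly_cosingular_def
  proof (rule order_tendstoI)
    fix a :: ennreal assume "0 < a"
    \<comment> \<open>The bound \<open>a\<close> may be infinite; a value strictly below it is
      finite and hence a real number.\<close>
    then obtain e where e: "0 < e" "e < a" using dense by blast
    then have "e \<noteq> top" using less_top by (metis less_trans less_irrefl top_greatest not_le)
    then obtain \<epsilon> where "\<epsilon> \<ge> 0" "e = ennreal \<epsilon>" by (cases e) auto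
    with e show "\<forall>\<^sub>F n in sequentially. cosingular_number T n < a"
      using ev[of \<epsilon>] by (auto elim!: eventually_mono intro: le_less_trans)
  qed simp
qed

text \<open>If the composition were onto, the space would be the union of the closed sets
  \<open>K n + Z\<close> with \<open>K n\<close> compact, and by Baire one of them would contain a
  ball. Differences of its elements, together with a finite net of \<open>K n - K n\<close>, then
  show that the quotient by \<open>Z\<close> has finite dimension.\<close>

lemma compact_imp_strictly_cosingular:
  fixes T :: "'a::complex_normed_vector \<Rightarrow> 'b::{complex_normed_vector, banach}"
  assumes bT: "bounded_clinear T" and T: "compact_operator T"
  shows "strictly_cosingular T"
  unfolding strictly_cosingular_def
proof (intro allI impI, elim conjE, rule notI)
  fix Z :: "'b set"
  assume Z: "closed_csubspace Z" and inf: "quot_dim_infinite Z"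
    and surj: "range (quot Z \<circ> T) = range (quot Z)"
  have sub: "complex_vector.subspace Z" "closed Z" using Z by (auto simp: closed_csubspace_def)
  let ?K = "closure (T ` cball 0 1)"
  define K where "K n = (\<lambda>x. real n *\<^sub>R x) ` ?K" for n
  have cK: "compact (K n)" for n
    using T unfolding K_def compact_operator_def by (rule compact_scaling)
  define A where "A n = (\<Union>x\<in>K n. \<Union>z\<in>Z. {x + z})" for n
  have cl: "closed (A n)" for n
    unfolding A_def by (rule compact_closed_sums[OF cK sub(2)])
  have "(\<Union>n. A n) = UNIV"
  proof (intro set_eqI iffI UNIV_I)
    fix y
    have "quot Z y \<in> range (quot Z \<circ> T)" using surj by auto
    then obtain x where x: "y - T x \<in> Z" by (auto simp: quot_eq_iff[OF sub(1)])
    obtain n where n: "norm x < real n" by (meson reals_Archimedean2)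
    then have "n > 0" using norm_ge_zero[of x] by (cases n) auto
    let ?x = "(1 / real n) *\<^sub>R x"
    have "norm ?x \<le> 1" using n \<open>n > 0\<close> by simp
    then have "T ?x \<in> ?K" by (intro subsetD[OF closure_subset]) auto
    moreover have "T x = real n *\<^sub>R T ?x"
      using \<open>n > 0\<close> by (simp add: scaleR_scaleC bounded_clinear_scaleC[OF bT] scaleC_scaleC scaleC_one)
    ultimately have "T x \<in> K n" by (auto simp: K_def)
    then have "y \<in> A n" using x unfolding A_def by (intro UN_I[of "T x"] UN_I[of "y - T x"]) auto
    then show "y \<in> (\<Union>n. A n)" by blast
  qed
  moreover have "\<not> (\<forall>n. interior (A n) = {})" if "(\<Union>n. A n) = UNIV"
  proof
    assume int: "\<forall>n. interior (A n) = {}"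
    have "Met_TC.mtopology interior_of \<Union>(range A) = {}"
      by (rule Met_TC.metric_Baire_category_alt)
        (use int cl in \<open>auto simp: complete_UNIV\<close>)
    then show False using that by simp
  qed
  ultimately obtain n y where "y \<in> interior (A n)" by blast
  then obtain s where s: "s > 0" "ball y s \<subseteq> A n" using mem_interior by blast
  have "compact {x - y | x y. x \<in> K n \<and> y \<in> K n}" (is "compact ?D")
    by (rule compact_differences[OF cK cK])
  moreover have "s / 4 > 0" using s by simp
  ultimately obtain F where F: "finite F" "?D \<subseteq> (\<Union>x\<in>F. ball x (s / 4))"
    unfolding compact_eq_totally_bounded by blast
  have "\<exists>f\<in>complex_vector.span F. \<exists>z\<in>Z. norm (v - f - z) \<le> s / 2 / 2" if "norm v \<le> s / 2" for v
  proof -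
    have "y \<in> A n" "y + v \<in> A n" using s that by (auto simp: dist_norm subset_iff)
    then obtain k z k' z' where kz: "k \<in> K n" "z \<in> Z" "y = k + z" "k' \<in> K n" "z' \<in> Z" "y + v = k' + z'"
      unfolding A_def by blast
    have "k' - k \<in> ?D" using kz by blast
    then obtain f where f: "f \<in> F" "norm (k' - k - f) < s / 4"
      using F(2) by (force simp: dist_norm norm_minus_commute)
    \<comment> \<open>The centre \<open>y\<close> of the ball cancels, so \<open>v\<close> is a
      difference of two elements of \<open>K n\<close> up to an element of \<open>Z\<close>.\<close>
    have "v - f - (z' - z) = k' - k - f" using kz(3,6) by (simp add: algebra_simps)
    then have "norm (v - f - (z' - z)) \<le> s / 2 / 2" using f(2) by (simp only:)
    moreover have "z' - z \<in> Z" using kz complex_vector.subspace_diff[OF sub(1)] by blast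
    moreover have "f \<in> complex_vector.span F" using f(1) by (rule complex_vector.span_base)
    ultimately show ?thesis by blast
  qed
  then have "\<exists>f\<in>complex_vector.span F. y - f \<in> Z" for y
    using span_plus_csubspace_eq_UNIV[OF Z F(1), of "s / 2"] s(1) by auto
  then show False using quot_dim_finite[OF sub(1) F(1)] inf by blast
qed

section \<open>Lipschitz-free spaces\<close>

definition cdual_blinfun :: "'a::complex_normed_vector cdual \<Rightarrow> 'a \<Rightarrow>\<^sub>L complex"
  where "cdual_blinfun f = Blinfun (cdual_apply f)"

lemma blinfun_apply_cdual_blinfun: "blinfun_apply (cdual_blinfun f) = cdual_apply f"
  unfolding cdual_blinfun_def using cdual_apply[of f]
  by (intro bounded_linear_Blinfun_apply) (auto simp: bounded_clinear_def)

lemma dist_cdual_blinfun: "dist (cdual_blinfun f) (cdual_blinfun g) = dist f g"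
proof -
  have "blinfun_apply (cdual_blinfun f - cdual_blinfun g) = cdual_apply (f - g)"
    by (auto simp: fun_eq_iff minus_blinfun.rep_eq blinfun_apply_cdual_blinfun minus_cdual.rep_eq)
  then show ?thesis by (simp add: dist_norm norm_blinfun.rep_eq norm_cdual.rep_eq)
qed

text \<open>Completeness is inherited from the bounded real-linear maps, into which the dual embeds
  isometrically. Complex homogeneity passes to the limit pointwise.\<close>

instance cdual :: (complex_normed_vector) banach
proof
  fix f :: "nat \<Rightarrow> 'a cdual" assume "Cauchy f"
  then have "Cauchy (\<lambda>n. cdual_blinfun (f n))" by (simp add: Cauchy_def dist_cdual_blinfun)
  then obtain g where g: "(\<lambda>n. cdual_blinfun (f n)) \<longlonglongrightarrow> g" using Cauchy_convergent convergentD by blast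
  have lim: "(\<lambda>n. cdual_apply (f n) x) \<longlonglongrightarrow> blinfun_apply g x" for x
    using blinfun.tendsto[OF g tendsto_const[of x]] by (simp add: blinfun_apply_cdual_blinfun)
  have "blinfun_apply g (c *\<^sub>C x) = c * blinfun_apply g x" for c x
  proof (rule LIMSEQ_unique[OF lim])
    have "cdual_apply (f n) (c *\<^sub>C x) = c * cdual_apply (f n) x" for n
      using cdual_apply[of "f n"] by (simp add: bounded_clinear_def scaleC_complex_def)
    then show "(\<lambda>n. cdual_apply (f n) (c *\<^sub>C x)) \<longlonglongrightarrow> c * blinfun_apply g x"
      using tendsto_mult_left[OF lim] by simp
  qed
  then have "bounded_clinear (blinfun_apply g)"
    by (simp add: bounded_clinear_def scaleC_complex_def blinfun.bounded_linear_right)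
  then have "blinfun_apply (cdual_blinfun (CDual (blinfun_apply g))) = blinfun_apply g"
    by (simp add: blinfun_apply_cdual_blinfun CDual_inverse)
  then have "cdual_blinfun (CDual (blinfun_apply g)) = g" by (simp add: blinfun_apply_inject)
  then have "f \<longlonglongrightarrow> CDual (blinfun_apply g)"
    using g by (simp add: tendsto_iff flip: dist_cdual_blinfun)
  then show "convergent f" by (auto simp: convergent_def)
qed

lemma dist_lip_free_functional: "dist (lip_free_functional \<mu>) (lip_free_functional \<nu>) = dist \<mu> \<nu>"
  by (simp add: dist_norm norm_lip_free.rep_eq minus_lip_free.rep_eq)

instance lip_free :: (pointed_metric_space) banach
proof
  fix f :: "nat \<Rightarrow> 'a lip_free" assume "Cauchy f"
  then have "Cauchy (\<lambda>n. lip_free_functional (f n))" by (simp add: Cauchy_def dist_lip_free_functional)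
  then obtain g where g: "(\<lambda>n. lip_free_functional (f n)) \<longlonglongrightarrow> g" using Cauchy_convergent convergentD by blast
  then have "g \<in> closure (complex_vector.span (range eval_functional))"
    by (rule closed_sequentially[OF closed_closure lip_free_functional])
  then have "lip_free_functional (Abs_lip_free g) = g" by (rule Abs_lip_free_inverse)
  then have "f \<longlonglongrightarrow> Abs_lip_free g"
    using g by (simp add: tendsto_iff flip: dist_lip_free_functional)
  then show "convergent f" by (auto simp: convergent_def)
qed

section \<open>The duality pairing and linear extension\<close>

text \<open>The bracket between Lipschitz functions and the free space. For fixed \<open>g\<close>
  it is the bounded linear extension of \<open>g\<close> along \<open>delta\<close>.\<close>

definition pair :: "'a::pointed_metric_space lip0 \<Rightarrow> 'a lip_free \<Rightarrow> complex"
  where "pair g \<mu> = cdual_apply (lip_free_functional \<mu>) g"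

lemma pair_delta [simp]: "pair g (delta x) = lip0_apply g x"
  by (simp add: pair_def delta.rep_eq eval_functional.rep_eq)

lemma norm_pair_le: "norm (pair g \<mu>) \<le> norm g * norm \<mu>"
  using norm_cdual_apply_le[of "lip_free_functional \<mu>" g]
  by (simp add: pair_def norm_lip_free.rep_eq mult.commute)

lemma bounded_clinear_pair: "bounded_clinear (pair g)"
  by (rule bounded_clinearI[where K = "norm g"])
    (auto simp: pair_def plus_lip_free.rep_eq plus_cdual.rep_eq scaleC_lip_free.rep_eq
      scaleC_cdual.rep_eq scaleC_complex_def norm_pair_le[unfolded pair_def])

lemma bounded_clinear_pair_left: "bounded_clinear (\<lambda>g. pair g \<mu>)"
  unfolding pair_def using cdual_apply by simp

lemma norm_lip_free_le:
  assumes "0 \<le> C" and le: "\<And>g. norm g \<le> 1 \<Longrightarrow> norm (pair g \<mu>) \<le> C"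
  shows "norm \<mu> \<le> C"
  unfolding norm_lip_free.rep_eq norm_cdual.rep_eq
proof (rule onorm_bound[OF \<open>0 \<le> C\<close>])
  fix g :: "'a lip0"
  show "norm (cdual_apply (lip_free_functional \<mu>) g) \<le> C * norm g"
  proof (cases "g = 0")
    case True
    then show ?thesis using bounded_clinear_0[OF bounded_clinear_pair_left[of \<mu>]] by (simp add: pair_def)
  next
    case False
    let ?c = "complex_of_real (1 / norm g)"
    have "norm (pair (?c *\<^sub>C g) \<mu>) \<le> C"
      using False by (intro le) (simp add: norm_scaleC norm_divide)
    also have "pair (?c *\<^sub>C g) \<mu> = ?c * pair g \<mu>"
      by (simp add: bounded_clinear_scaleC[OF bounded_clinear_pair_left] scaleC_complex_def)
    finally show ?thesis
      using False by (simp add: norm_mult norm_divide field_simps flip: pair_def)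
  qed
qed

text \<open>The norm is a supremum of pairings with the unit ball of \<open>lip0\<close>. The factor
  2 allows a single \<open>g\<close> to come close enough.\<close>

lemma lip_free_norming_functional:
  fixes \<mu> :: "'a::pointed_metric_space lip_free"
  shows "\<exists>f. norm f \<le> 1 \<and> norm \<mu> \<le> 2 * norm (cdual_apply f \<mu>)"
proof (cases "\<mu> = 0")
  case True
  then show ?thesis by (intro exI[of _ 0]) auto
next
  case False
  have "\<exists>g. norm g \<le> 1 \<and> norm \<mu> / 2 < norm (pair g \<mu>)"
  proof (rule ccontr)
    assume "\<not> ?thesis"
    then have "norm \<mu> \<le> norm \<mu> / 2" by (intro norm_lip_free_le) (auto simp: not_less)
    then show False using False by simp
  qed
  then obtain g where g: "norm g \<le> 1" "norm \<mu> / 2 < norm (pair g \<mu>)" by blast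
  have f: "cdual_apply (CDual (pair g)) = pair g"
    using bounded_clinear_pair[of g] by (simp add: CDual_inverse)
  have "norm (CDual (pair g)) \<le> 1"
    unfolding norm_cdual.rep_eq f
  proof (rule onorm_bound)
    show "norm (pair g \<nu>) \<le> 1 * norm \<nu>" for \<nu>
      using norm_pair_le g(1) by (rule order_trans[OF _ mult_right_mono]) auto
  qed simp
  then show ?thesis using g f by (intro exI[of _ "CDual (pair g)"]) auto
qed

text \<open>The type is carved out as a closure inside the dual. Approximating combinations there
  lift through the isometric embedding \<open>lip_free_functional\<close>.\<close>

lemma closure_span_delta: "closure (complex_vector.span (range delta)) = UNIV"
proof (intro set_eqI iffI UNIV_I)
  fix \<mu> :: "'a lip_free"
  have sum: "lip_free_functional (\<Sum>t\<in>A. r t *\<^sub>C delta (h t)) = (\<Sum>t\<in>A. r t *\<^sub>C eval_functional (h t))"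
    for A :: "'b set" and r and h :: "'b \<Rightarrow> 'a"
    by (induction A rule: infinite_finite_induct)
      (auto simp: zero_lip_free.rep_eq plus_lip_free.rep_eq scaleC_lip_free.rep_eq delta.rep_eq)
  obtain f where f: "\<And>n. f n \<in> complex_vector.span (range eval_functional)"
    "f \<longlonglongrightarrow> lip_free_functional \<mu>"
    using lip_free_functional[of \<mu>] unfolding closure_sequential by blast
  have "\<exists>\<nu>\<in>complex_vector.span (range delta). lip_free_functional \<nu> = f n" for n
  proof -
    obtain t r where t: "finite t" "t \<subseteq> range eval_functional" "f n = (\<Sum>a\<in>t. r a *\<^sub>C a)"
      using f(1)[of n] unfolding complex_vector.span_explicit by blast
    then obtain h where "\<And>a. a \<in> t \<Longrightarrow> eval_functional (h a) = a" by (metis subsetD f_inv_into_f)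
    then have "lip_free_functional (\<Sum>a\<in>t. r a *\<^sub>C delta (h a)) = f n"
      unfolding sum t(3) by (intro sum.cong) auto
    then show ?thesis
      by (intro bexI[of _ "\<Sum>a\<in>t. r a *\<^sub>C delta (h a)"] complex_vector.span_sum
          complex_vector.span_scale complex_vector.span_base) auto
  qed
  then obtain \<nu> where \<nu>: "\<And>n. \<nu> n \<in> complex_vector.span (range delta)"
    "\<And>n. lip_free_functional (\<nu> n) = f n" by metis
  have "\<nu> \<longlonglongrightarrow> \<mu>"
    using f(2) by (simp add: tendsto_iff \<nu>(2)[symmetric] dist_lip_free_functional)
  then show "\<mu> \<in> closure (complex_vector.span (range delta))"
    using \<nu>(1) unfolding closure_sequential by blast
qed

lemma clinear_eq_on_delta:
  assumes f: "bounded_clinear f" and h: "bounded_clinear h"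
    and eq: "\<And>x. f (delta x) = h (delta x)"
  shows "f \<mu> = h \<mu>"
proof -
  have sub: "closed_csubspace {\<mu>. f \<mu> - h \<mu> = 0}"
    by (intro kernel_csubspace bounded_clinear_sub f h)
  then have "complex_vector.span (range delta) \<subseteq> {\<mu>. f \<mu> - h \<mu> = 0}"
    using eq by (intro complex_vector.span_minimal) (auto simp: closed_csubspace_def)
  then have "closure (complex_vector.span (range delta)) \<subseteq> {\<mu>. f \<mu> - h \<mu> = 0}"
    using sub by (intro closure_minimal) (auto simp: closed_csubspace_def)
  then show ?thesis by (auto simp: closure_span_delta)
qed

lemma lip0_apply_basepoint [simp]: "lip0_apply g basepoint = 0"
  using lip0_apply[of g] by simp

lemma delta_basepoint [simp]: "delta basepoint = 0"
proof -
  have "norm (delta basepoint :: 'a lip_free) \<le> 0" by (intro norm_lip_free_le) auto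
  then show ?thesis by simp
qed

lemma norm_lip0_apply_diff_le: "norm (lip0_apply g x - lip0_apply g y) \<le> norm g * dist x y"
  using lip0_apply[of g] lip_const_bound(2) unfolding norm_lip0.rep_eq by blast

lemma dist_delta_le: "dist (delta x) (delta y) \<le> dist x y"
  unfolding dist_norm[of "delta x"]
proof (rule norm_lip_free_le)
  fix g :: "'a lip0" assume "norm g \<le> 1"
  then have "norm g * dist x y \<le> 1 * dist x y" by (intro mult_right_mono) auto
  then show "norm (pair g (delta x - delta y)) \<le> dist x y"
    using norm_lip0_apply_diff_le[of g x y] by (simp add: bounded_clinear_diff[OF bounded_clinear_pair])
qed simp

lemma lip0_of_lipschitz:
  fixes f :: "'a::pointed_metric_space \<Rightarrow> complex"
  assumes "0 \<le> L" "\<And>x y. norm (f x - f y) \<le> L * dist x y" "f basepoint = 0"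
  obtains g where "norm g \<le> L" "\<And>x. lip0_apply g x = f x"
proof -
  have "L-lipschitz_on UNIV f" using assms by (auto simp: lipschitz_on_def dist_norm)
  then have "lip0_apply (Lip0 f) = f" using assms(3) by (intro Lip0_inverse) auto
  then show thesis
    using that[of "Lip0 f"] lip_const_least[OF assms(1,2)] by (simp add: norm_lip0.rep_eq)
qed

text \<open>The closure of \<open>range delta\<close> serves as the completion of the metric space.\<close>

lemma lip0_of_lipschitz_on_lip_free:
  fixes f :: "'a::pointed_metric_space lip_free \<Rightarrow> complex"
  assumes L: "0 \<le> L" and f: "\<And>u v. norm (f u - f v) \<le> L * dist u v" "f 0 = 0"
  obtains g where "norm g \<le> L" "\<And>v. v \<in> closure (range delta) \<Longrightarrow> pair g v = f v"
proof -
  have "norm (f (delta x) - f (delta y)) \<le> L * dist x y" for x y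
    using f(1) mult_left_mono[OF dist_delta_le L] by (rule order_trans)
  then obtain g where g: "norm g \<le> L" "\<And>x. lip0_apply g x = f (delta x)"
    using lip0_of_lipschitz[of L "\<lambda>x. f (delta x)"] L f(2) by auto
  have "continuous_on UNIV f"
    using L f(1) by (intro lipschitz_on_continuous_on[of L]) (auto simp: lipschitz_on_def dist_norm)
  then have "closed {v. pair g v = f v}"
    by (rule closed_Collect_eq[OF bounded_clinear_continuous_on[OF bounded_clinear_pair]])
  then have "closure (range delta) \<subseteq> {v. pair g v = f v}"
    by (intro closure_minimal) (auto simp: g)
  with g(1) that show thesis by blast
qed

text \<open>The functional is the linear extension of the Lipschitz function
  \<open>\<lambda>x. \<phi> (delta x)\<close>, and the norm of such an extension is controlled by
  the Lipschitz constant.\<close>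

lemma functional_bound_of_lipschitz:
  fixes \<phi> :: "'a::pointed_metric_space lip_free \<Rightarrow> complex"
  assumes \<phi>: "bounded_clinear \<phi>" and "0 \<le> L"
    and lip: "\<And>x y. norm (\<phi> (delta x) - \<phi> (delta y)) \<le> L * dist x y"
  shows "norm (\<phi> \<mu>) \<le> L * norm \<mu>"
proof -
  obtain g where g: "norm g \<le> L" "\<And>x. lip0_apply g x = \<phi> (delta x)"
    using lip0_of_lipschitz[where f = "\<lambda>x. \<phi> (delta x)", OF \<open>0 \<le> L\<close> lip]
      bounded_clinear_0[OF \<phi>] by (metis delta_basepoint)
  have "\<phi> \<mu> = pair g \<mu>" by (rule clinear_eq_on_delta[OF \<phi> bounded_clinear_pair]) (simp add: g)
  then show ?thesis using norm_pair_le[of g \<mu>] mult_right_mono[OF g(1), of "norm \<mu>"] by simp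
qed

section \<open>Finite nets and sequential compactness\<close>

text \<open>Values are rounded to a finite net of the disc of radius \<open>D\<close>. Only finitely
  many patterns of rounded values occur on \<open>I\<close>, and one member of \<open>A\<close> is
  kept for each pattern.\<close>

lemma finite_net_of_bounded_functions:
  fixes f :: "'a \<Rightarrow> 'i \<Rightarrow> complex"
  assumes "finite I" and bd: "\<And>x i. x \<in> A \<Longrightarrow> i \<in> I \<Longrightarrow> norm (f x i) \<le> D" and "\<epsilon> > 0"
  obtains H where "finite H" "H \<subseteq> A" "\<And>x. x \<in> A \<Longrightarrow> \<exists>h\<in>H. \<forall>i\<in>I. norm (f x i - f h i) < \<epsilon>"
proof -
  have "\<epsilon> / 2 > 0" using \<open>\<epsilon> > 0\<close> by simp
  have "\<exists>k. finite k \<and> cball (0::complex) D \<subseteq> (\<Union>x\<in>k. ball x (\<epsilon> / 2))"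
    using compact_cball[of "0::complex" D] \<open>\<epsilon> / 2 > 0\<close>
    unfolding compact_eq_totally_bounded by (elim conjE allE impE) assumption+
  then obtain k where k: "finite k" "cball (0::complex) D \<subseteq> (\<Union>x\<in>k. ball x (\<epsilon> / 2))"
    by (elim exE conjE) (rule that)
  have "\<exists>p\<in>k. dist p z < \<epsilon> / 2" if "norm z \<le> D" for z
  proof -
    have "z \<in> cball 0 D" using that by simp
    then have "z \<in> (\<Union>x\<in>k. ball x (\<epsilon> / 2))" by (rule subsetD[OF k(2)])
    then show ?thesis by simp
  qed
  then obtain c where c: "\<And>z. norm z \<le> D \<Longrightarrow> c z \<in> k" "\<And>z. norm z \<le> D \<Longrightarrow> dist (c z) z < \<epsilon> / 2"
    by metis
  define code where "code x = restrict (\<lambda>i. c (f x i)) I" for x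
  have "code ` A \<subseteq> PiE I (\<lambda>_. k)" using bd c(1) by (auto simp: code_def)
  then have "finite (code ` A)" using finite_PiE[OF \<open>finite I\<close>, of "\<lambda>_. k"] k(1) finite_subset by blast
  then obtain H where H: "H \<subseteq> A" "finite H" "code ` A = code ` H"
    using finite_subset_image[of "code ` A" code A] by auto
  show thesis
  proof (rule that[OF H(2,1)])
    fix x assume "x \<in> A"
    then have "code x \<in> code ` H" using H(3) by blast
    then obtain h where h: "h \<in> H" "code x = code h" by blast
    have "norm (f x i - f h i) < \<epsilon>" if "i \<in> I" for i
    proof -
      have "c (f x i) = c (f h i)" using h(2) that by (auto simp: code_def fun_eq_iff restrict_def split: if_splits)
      moreover have "norm (f x i) \<le> D" "norm (f h i) \<le> D" using bd that \<open>x \<in> A\<close> h H(1) by auto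
      ultimately have "dist (c (f x i)) (f x i) < \<epsilon> / 2" "dist (c (f x i)) (f h i) < \<epsilon> / 2"
        using c(2) by metis+
      then show ?thesis using dist_triangle_half_r[of "c (f x i)" "f x i" \<epsilon> "f h i"] by (simp add: dist_norm)
    qed
    with h show "\<exists>h\<in>H. \<forall>i\<in>I. norm (f x i - f h i) < \<epsilon>" by blast
  qed
qed

lemma compact_closure_of_nets:
  fixes S :: "'a::complete_space set"
  assumes "\<And>\<epsilon>. \<epsilon> > 0 \<Longrightarrow> \<exists>F. finite F \<and> (\<forall>x\<in>S. \<exists>p\<in>F. dist p x \<le> \<epsilon>)"
  shows "compact (closure S)"
  unfolding compact_eq_totally_bounded
proof (intro conjI allI impI)
  show "complete (closure S)" by (simp add: complete_eq_closed)
  fix \<epsilon> :: real assume "\<epsilon> > 0"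
  then have "\<epsilon> / 2 > 0" by simp
  then obtain F where F: "finite F" "\<forall>x\<in>S. \<exists>p\<in>F. dist p x \<le> \<epsilon> / 2" using assms by blast
  have "closed (\<Union>p\<in>F. cball p (\<epsilon> / 2))" using F(1) by (intro closed_UN) auto
  then have "closure S \<subseteq> (\<Union>p\<in>F. cball p (\<epsilon> / 2))" using F(2) by (intro closure_minimal) auto
  moreover have "(\<Union>p\<in>F. cball p (\<epsilon> / 2)) \<subseteq> (\<Union>p\<in>F. ball p \<epsilon>)"
    using \<open>\<epsilon> > 0\<close> by (intro UN_mono) auto
  ultimately have "closure S \<subseteq> (\<Union>p\<in>F. ball p \<epsilon>)" by (rule order_trans)
  with F(1) show "\<exists>k. finite k \<and> closure S \<subseteq> (\<Union>x\<in>k. ball x \<epsilon>)" by blast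
qed

text \<open>A sequence in the closure is shadowed by one in \<open>S\<close> with errors tending to
  0, and both converge along the same subsequences. So it is enough to test sequences of
  \<open>S\<close> itself.\<close>

lemma sequence_without_convergent_subsequence:
  fixes S :: "'a::metric_space set"
  assumes "\<not> compact (closure S)"
  obtains x :: "nat \<Rightarrow> 'a" where "\<And>n. x n \<in> S" "\<And>r. strict_mono r \<Longrightarrow> \<not> convergent (\<lambda>n. x (r n))"
proof -
  have "compact (closure S)" if conv: "\<And>x :: nat \<Rightarrow> 'a. (\<forall>n. x n \<in> S) \<Longrightarrow> \<exists>r. strict_mono r \<and> convergent (\<lambda>n. x (r n))"
    unfolding compact_def
  proof (intro allI impI)
    fix f :: "nat \<Rightarrow> 'a" assume f: "\<forall>n. f n \<in> closure S"
    have "\<exists>y\<in>S. dist y (f n) < 1 / real (Suc n)" for n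
      using f closure_approachable[of "f n" S] by (simp del: of_nat_Suc)
    then obtain x where x: "\<And>n. x n \<in> S" "\<And>n. dist (x n) (f n) < 1 / real (Suc n)" by metis
    obtain r l where r: "strict_mono r" "(\<lambda>n. x (r n)) \<longlonglongrightarrow> l"
      using conv[of x] x(1) by (auto simp: convergent_def)
    have "(\<lambda>n. dist (x (r n)) (f (r n))) \<longlonglongrightarrow> 0"
    proof (rule tendsto_sandwich[OF always_eventually always_eventually tendsto_const])
      show "(\<lambda>n. 1 / real (Suc (r n))) \<longlonglongrightarrow> 0"
        using LIMSEQ_subseq_LIMSEQ[OF LIMSEQ_inverse_real_of_nat r(1)]
        by (simp add: comp_def inverse_eq_divide)
    qed (use x(2) less_imp_le in auto)
    from tendsto_add[OF this iffD1[OF tendsto_dist_iff r(2)]]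
    have "(\<lambda>n. dist (x (r n)) (f (r n)) + dist (x (r n)) l) \<longlonglongrightarrow> 0" by simp
    then have "(\<lambda>n. dist (f (r n)) l) \<longlonglongrightarrow> 0"
      by (rule tendsto_sandwich[OF always_eventually always_eventually tendsto_const, rotated 2])
        (auto simp: dist_triangle3)
    then have "(f \<circ> r) \<longlonglongrightarrow> l" by (subst tendsto_dist_iff) (simp add: comp_def)
    moreover from this have "l \<in> closure S"
      by (rule closed_sequentially[OF closed_closure, rotated]) (simp add: f)
    ultimately show "\<exists>l\<in>closure S. \<exists>r. strict_mono r \<and> (f \<circ> r) \<longlonglongrightarrow> l" using r(1) by blast
  qed
  with assms that show thesis by blast
qed

section \<open>Molecules and compactness\<close>

text \<open>The pairing of \<open>g\<close> with a molecule is a difference quotient of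
  \<open>g\<close>, so the molecules determine Lipschitz constants.\<close>

definition molecules :: "'a::pointed_metric_space lip_free set"
  where "molecules = {complex_of_real (1 / dist x y) *\<^sub>C (delta x - delta y) | x y. x \<noteq> y}"

lemma norm_molecule_le: "\<mu> \<in> molecules \<Longrightarrow> norm \<mu> \<le> 1"
  using dist_delta_le by (auto simp: molecules_def norm_scaleC norm_divide dist_norm)

lemma molecules_subset_FS: "molecules \<subseteq> FS 2"
proof
  fix \<mu> :: "'a lip_free" assume "\<mu> \<in> molecules"
  then obtain x y where "\<mu> = complex_of_real (1 / dist x y) *\<^sub>C (delta x - delta y)"
    by (auto simp: molecules_def)
  then have "\<mu> = (\<Sum>i<(2::nat). (if i = 0 then complex_of_real (1 / dist x y) else - complex_of_real (1 / dist x y)) *\<^sub>C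
      delta (if i = 0 then x else y))"
    by (simp add: numeral_2_eq_2 complex_vector.scale_right_diff_distrib)
  then show "\<mu> \<in> FS 2" unfolding FS_def mem_Collect_eq by (intro exI conjI TrueI)
qed

text \<open>Two finite nets, as in Schauder's theorem: first for the adjoint, which is uniformly small on
  the molecules, and then for finitely many functionals on the unit ball. This replaces the fact
  that the unit ball is the closed absolutely convex hull of the molecules.\<close>

lemma compact_operator_of_molecules:
  fixes T :: "'m::pointed_metric_space lip_free \<Rightarrow> 'n::pointed_metric_space lip_free"
  assumes bT: "bounded_clinear T" and cp: "compact (closure (T ` molecules))"
  shows "compact_operator T"
  unfolding compact_operator_def
proof (rule compact_closure_of_nets)
  fix \<epsilon> :: real assume "\<epsilon> > 0"
  \<comment> \<open>The estimate at the end adds \<open>3 * e\<close> on a vector of norm at most 2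
    and one further \<open>e\<close>.\<close>
  define e where "e = \<epsilon> / 7"
  have "e > 0" using \<open>\<epsilon> > 0\<close> by (simp add: e_def)
  obtain K where K: "K > 0" "\<And>x. norm (T x) \<le> K * norm x" using bounded_clinear_bound[OF bT] by blast
  obtain F where F: "finite F" "closure (T ` molecules) \<subseteq> (\<Union>p\<in>F. ball p e)"
    using cp \<open>e > 0\<close> unfolding compact_eq_totally_bounded by blast
  have *: "norm (pair g p) \<le> Max (norm ` F)" if "g \<in> cball 0 1" "p \<in> F" for g p
  proof -
    have "norm (pair g p) \<le> 1 * norm p"
      using that(1) by (intro order_trans[OF norm_pair_le mult_right_mono]) auto
    also have "\<dots> \<le> Max (norm ` F)" using F(1) that(2) by simp
    finally show ?thesis .
  qed
  obtain H where H: "finite H" "H \<subseteq> cball 0 1"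
    "\<And>g. g \<in> cball 0 1 \<Longrightarrow> \<exists>h\<in>H. \<forall>p\<in>F. norm (pair g p - pair h p) < e"
    by (rule finite_net_of_bounded_functions[of F "cball 0 1" pair, OF F(1) * \<open>e > 0\<close>]) (assumption | rule that)+
  have *: "norm (pair h (T \<mu>)) \<le> K" if "\<mu> \<in> cball 0 1" "h \<in> H" for \<mu> h
  proof -
    have "norm (pair h (T \<mu>)) \<le> 1 * norm (T \<mu>)"
      using H(2) that(2) by (intro order_trans[OF norm_pair_le] mult_right_mono) auto
    also have "\<dots> \<le> K * norm \<mu>" using K(2) by simp
    also have "\<dots> \<le> K * 1" using K(1) that(1) by (intro mult_left_mono) auto
    finally show ?thesis by simp
  qed
  obtain G where G: "finite G" "G \<subseteq> cball 0 1"
    "\<And>\<mu>. \<mu> \<in> cball 0 1 \<Longrightarrow> \<exists>\<nu>\<in>G. \<forall>h\<in>H. norm (pair h (T \<mu>) - pair h (T \<nu>)) < e"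
    by (rule finite_net_of_bounded_functions[of H "cball 0 1" "\<lambda>\<mu> h. pair h (T \<mu>)", OF H(1) * \<open>e > 0\<close>])
      (assumption | rule that)+
  \<comment> \<open>It is enough to bound difference quotients, that is, values at molecules
    \<open>m\<close>. There \<open>T m\<close> is within \<open>e\<close> of some \<open>p\<close>
    in \<open>F\<close>, which costs \<open>2 * e\<close> because \<open>norm (g - h)\<close> is at
    most 2, and \<open>g - h\<close> is below \<open>e\<close> at \<open>p\<close>.\<close>
  have adj: "norm (pair (g - h) (T \<mu>)) \<le> 3 * e * norm \<mu>"
    if g: "g \<in> cball 0 1" and h: "h \<in> H" "\<forall>p\<in>F. norm (pair g p - pair h p) < e" for g h \<mu>
  proof (rule functional_bound_of_lipschitz)
    show b: "bounded_clinear (\<lambda>\<mu>. pair (g - h) (T \<mu>))"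
      by (rule bounded_clinear_compose[OF bounded_clinear_pair bT])
    fix x y :: 'm
    show "norm (pair (g - h) (T (delta x)) - pair (g - h) (T (delta y))) \<le> 3 * e * dist x y"
    proof (cases "x = y")
      case False
      let ?c = "complex_of_real (1 / dist x y)"
      define m where "m = ?c *\<^sub>C (delta x - delta y)"
      have "m \<in> molecules" using False by (auto simp: m_def molecules_def)
      then have "T m \<in> closure (T ` molecules)" by (intro subsetD[OF closure_subset]) auto
      then obtain p where p: "p \<in> F" "norm (T m - p) < e"
        using F(2) by (auto simp: dist_norm norm_minus_commute subset_iff)
      have "norm (g - h) \<le> 2"
        using norm_triangle_ineq4[of g h] g h(1) H(2) by force
      then have "norm (pair (g - h) (T m - p)) \<le> 2 * norm (T m - p)"
        by (intro order_trans[OF norm_pair_le] mult_right_mono) auto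
      moreover have "norm (pair (g - h) p) < e"
        using h p(1) by (simp add: bounded_clinear_diff[OF bounded_clinear_pair_left])
      moreover have "pair (g - h) (T m) = pair (g - h) (T m - p) + pair (g - h) p"
        by (simp add: bounded_clinear_diff[OF bounded_clinear_pair])
      ultimately have "norm (pair (g - h) (T m)) \<le> 3 * e"
        using norm_triangle_ineq[of "pair (g - h) (T m - p)" "pair (g - h) p"] p(2) by simp
      moreover have "pair (g - h) (T m) = ?c * (pair (g - h) (T (delta x)) - pair (g - h) (T (delta y)))"
        using bounded_clinear_scaleC[OF b] bounded_clinear_diff[OF b] by (simp add: m_def scaleC_complex_def)
      ultimately show ?thesis using False by (simp add: norm_mult norm_divide field_simps)
    qed simp
  qed (use \<open>e > 0\<close> in simp)
  have "\<exists>\<nu>\<in>G. norm (T \<nu> - T \<mu>) \<le> \<epsilon>" if \<mu>: "\<mu> \<in> cball 0 1" for \<mu>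
  proof -
    obtain \<nu> where \<nu>: "\<nu> \<in> G" "\<forall>h\<in>H. norm (pair h (T \<mu>) - pair h (T \<nu>)) < e" using G(3)[OF \<mu>] by blast
    have "norm (T \<nu> - T \<mu>) \<le> 7 * e"
    proof (rule norm_lip_free_le)
      fix g :: "'n lip0" assume "norm g \<le> 1"
      then obtain h where h: "h \<in> H" "\<forall>p\<in>F. norm (pair g p - pair h p) < e" using H(3)[of g] by auto
      have "norm (\<nu> - \<mu>) \<le> 2"
        using norm_triangle_ineq4[of \<nu> \<mu>] \<mu> \<nu>(1) G(2) by force
      then have "3 * e * norm (\<nu> - \<mu>) \<le> 3 * e * 2" using \<open>e > 0\<close> by (intro mult_left_mono) auto
      then have "norm (pair (g - h) (T (\<nu> - \<mu>))) \<le> 6 * e"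
        using adj[of g h "\<nu> - \<mu>"] h \<open>norm g \<le> 1\<close> by simp
      moreover have "norm (pair h (T \<nu> - T \<mu>)) \<le> e"
        using \<nu>(2) h(1) less_imp_le by (force simp: bounded_clinear_diff[OF bounded_clinear_pair] norm_minus_commute)
      moreover have "pair g (T \<nu> - T \<mu>) = pair (g - h) (T (\<nu> - \<mu>)) + pair h (T \<nu> - T \<mu>)"
        by (simp add: bounded_clinear_diff[OF bT] bounded_clinear_diff[OF bounded_clinear_pair_left])
      ultimately show "norm (pair g (T \<nu> - T \<mu>)) \<le> 7 * e"
        using norm_triangle_ineq[of "pair (g - h) (T (\<nu> - \<mu>))" "pair h (T \<nu> - T \<mu>)"] by simp
    qed (use \<open>e > 0\<close> in simp)
    with \<nu>(1) show ?thesis by (auto simp: e_def)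
  qed
  then show "\<exists>F. finite F \<and> (\<forall>x\<in>T ` cball 0 1. \<exists>p\<in>F. dist p x \<le> \<epsilon>)"
    using G(1) by (intro exI[of _ "T ` G"]) (auto simp: dist_norm)
qed

section \<open>Finitely supported sequences without convergent subsequences\<close>

text \<open>Each index is chosen beyond the threshold of its predecessor. Since the indices
  increase, it is then beyond the thresholds of all earlier ones.\<close>

lemma greedy_subsequence:
  fixes Q :: "nat \<Rightarrow> nat \<Rightarrow> bool"
  assumes "\<And>m. \<forall>\<^sub>F n in sequentially. Q m n"
  obtains r :: "nat \<Rightarrow> nat" where "strict_mono r" "\<And>m n. m < n \<Longrightarrow> Q (r m) (r n)"
proof -
  obtain f where f: "\<And>m n. n \<ge> f m \<Longrightarrow> Q m n"
    using assms unfolding eventually_sequentially by metis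
  define r where "r = rec_nat 0 (\<lambda>_ p. Suc (p + f p))"
  have r: "r (Suc n) = Suc (r n + f (r n))" for n by (simp add: r_def)
  have mono: "strict_mono r" by (simp add: strict_mono_Suc_iff r)
  have "Q (r m) (r n)" if "m < n" for m n
  proof (rule f)
    have "r (Suc m) \<le> r n" using mono that by (simp add: strict_mono_less_eq Suc_leI)
    then show "f (r m) \<le> r n" by (simp add: r)
  qed
  with mono that show thesis by blast
qed

text \<open>The point is that \<open>c\<close> does not depend on \<open>u\<close>. A sequence that converges, tends to infinity or is
  separated and bounded has this property for a suitable finite set \<open>P\<close>.\<close>

definition escapes :: "(nat \<Rightarrow> 'a::metric_space) \<Rightarrow> 'a set \<Rightarrow> real \<Rightarrow> bool"
  where "escapes x P c \<longleftrightarrow> (\<forall>u. \<forall>\<^sub>F n in sequentially. c * infdist (x n) P \<le> dist (x n) u)"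

lemma escapes_subseq:
  assumes "escapes x P c" "strict_mono r"
  shows "escapes (\<lambda>n. x (r n)) P c"
  unfolding escapes_def
  by (intro allI eventually_subseq[OF assms(2), where P = "\<lambda>n. c * infdist (x n) P \<le> dist (x n) u" for u])
    (use assms(1) in \<open>simp add: escapes_def\<close>)

lemma escapes_mono:
  assumes "escapes x P c" "P \<subseteq> Q" "P \<noteq> {}" "0 \<le> c'" "c' \<le> c"
  shows "escapes x Q c'"
  unfolding escapes_def
proof
  fix u :: 'a
  have "c' * infdist (x n) Q \<le> c * infdist (x n) P" for n
    using assms infdist_mono[of P Q "x n"] infdist_nonneg[of "x n" Q] by (intro mult_mono) auto
  then show "\<forall>\<^sub>F n in sequentially. c' * infdist (x n) Q \<le> dist (x n) u"
    using assms(1) unfolding escapes_def by (blast intro: eventually_mono order_trans)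
qed

text \<open>For \<open>u = p\<close> the distance from \<open>u\<close> is already at least that
  from \<open>P\<close>. For any other \<open>u\<close> the points \<open>x n\<close> are eventually
  closer to \<open>p\<close> than to \<open>u\<close>.\<close>

lemma escapes_of_convergent:
  assumes "x \<longlonglongrightarrow> p" "p \<in> P"
  shows "escapes x P (1/2)"
  unfolding escapes_def
proof
  fix u :: 'a
  have le: "infdist (x n) P \<le> dist (x n) p" for n using assms(2) by (rule infdist_le)
  show "\<forall>\<^sub>F n in sequentially. 1/2 * infdist (x n) P \<le> dist (x n) u"
  proof (cases "u = p")
    case True
    have "1/2 * infdist (x n) P \<le> dist (x n) u" for n
      using le[of n] infdist_nonneg[of "x n" P] True by simp
    then show ?thesis by simp
  next
    case False
    then have "\<forall>\<^sub>F n in sequentially. dist (x n) p < dist u p / 2"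
      using tendstoD[OF assms(1), of "dist u p / 2"] by simp
    then show ?thesis
    proof eventually_elim
      case (elim n)
      then show ?case
        using le[of n] dist_triangle[of u p "x n"] zero_le_dist[of "x n" u] unfolding dist_commute[of u "x n"] by linarith
    qed
  qed
qed

lemma escapes_of_norm_at_top:
  fixes x :: "nat \<Rightarrow> 'a::real_normed_vector"
  assumes "\<And>n. real n < norm (x n)"
  shows "escapes x {0} (1/2)"
  unfolding escapes_def
proof
  fix u :: 'a
  obtain N where N: "2 * norm u \<le> real N" using real_arch_simple by blast
  have "1/2 * infdist (x n) {0} \<le> dist (x n) u" if "n \<ge> N" for n
  proof -
    have "2 * norm u \<le> norm (x n)" using N that assms[of n] by simp
    then show ?thesis using norm_triangle_ineq2[of "x n" u] by (simp add: dist_norm)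
  qed
  then show "\<forall>\<^sub>F n in sequentially. 1/2 * infdist (x n) {0} \<le> dist (x n) u"
    unfolding eventually_sequentially by blast
qed

text \<open>At most one term comes within \<open>e / 2\<close> of a given \<open>u\<close>, while
  the distance from \<open>{0}\<close> is at most \<open>B\<close>. The summand 1 keeps the
  denominator positive.\<close>

lemma escapes_of_separated:
  fixes x :: "nat \<Rightarrow> 'a::real_normed_vector"
  assumes "e > 0" and sep: "\<And>m n. m < n \<Longrightarrow> e < dist (x m) (x n)" and bd: "\<And>n. norm (x n) \<le> B"
  shows "escapes x {0} (e / 2 / (B + 1))"
  unfolding escapes_def
proof
  fix u :: 'a
  have "B \<ge> 0" using bd[of 0] norm_ge_zero[of "x 0"] by linarith
  have "\<exists>N. \<forall>n\<ge>N. e / 2 \<le> dist (x n) u"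
  proof (rule ccontr)
    assume neg: "\<not> ?thesis"
    then obtain m where m: "dist (x m) u < e / 2" by (metis not_le)
    from neg obtain n where n: "n \<ge> Suc m" "dist (x n) u < e / 2" by (metis not_le)
    from m n(2) have "dist (x m) (x n) < e" by (rule dist_triangle_half_l)
    then show False using sep[of m n] n by simp
  qed
  moreover have "e / 2 / (B + 1) * infdist (x n) {0} \<le> e / 2" for n
  proof -
    have "e / 2 * norm (x n) \<le> e / 2 * (B + 1)" using bd[of n] \<open>e > 0\<close> by (intro mult_left_mono) auto
    then have "e / 2 * norm (x n) / (B + 1) \<le> e / 2" using \<open>B \<ge> 0\<close> by (subst pos_divide_le_eq) auto
    then show ?thesis by simp
  qed
  ultimately show "\<forall>\<^sub>F n in sequentially. e / 2 / (B + 1) * infdist (x n) {0} \<le> dist (x n) u"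
    unfolding eventually_sequentially by (meson order_trans)
qed

lemma separated_subsequence:
  fixes x :: "nat \<Rightarrow> 'a::complete_space"
  assumes "\<And>r. strict_mono r \<Longrightarrow> \<not> convergent (\<lambda>n. x (r n))"
  obtains e and s :: "nat \<Rightarrow> nat" where "e > 0" "strict_mono s" "\<And>m n. m < n \<Longrightarrow> e < dist (x (s m)) (x (s n))"
proof -
  have "\<not> compact (closure (range x))"
  proof
    assume "compact (closure (range x))"
    moreover have "\<forall>n. x n \<in> closure (range x)" by (auto intro: subsetD[OF closure_subset])
    ultimately obtain l r where "strict_mono r" "(x \<circ> r) \<longlonglongrightarrow> l"
      unfolding compact_def by metis
    then show False using assms by (auto simp: convergent_def comp_def)
  qed
  then obtain e where e: "e > 0" "\<And>F. finite F \<Longrightarrow> \<exists>y\<in>range x. \<forall>p\<in>F. e < dist p y"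
    using compact_closure_of_nets[of "range x"] by (metis not_le)
  \<comment> \<open>The condition \<open>N < n\<close> is automatic: a term at positive distance
    from all \<open>x j\<close> with \<open>j \<le> N\<close> has a larger index.\<close>
  have step: "\<exists>n. N < n \<and> (\<forall>j\<le>N. e < dist (x j) (x n))" for N
  proof -
    obtain n where n: "\<forall>j\<le>N. e < dist (x j) (x n)" using e(2)[of "x ` {..N}"] by auto
    then have "N < n" using e(1) by (metis dist_self less_asym not_le)
    with n show ?thesis by blast
  qed
  obtain s where s: "\<And>k. s k < s (Suc k)" "\<And>k j. j \<le> s k \<Longrightarrow> e < dist (x j) (x (s (Suc k)))"
    using dependent_nat_choice[of "\<lambda>_ _. True" "\<lambda>_ N n. N < n \<and> (\<forall>j\<le>N. e < dist (x j) (x n))"] step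
    by metis
  have mono: "strict_mono s" using s(1) by (simp add: strict_mono_Suc_iff)
  have "e < dist (x (s m)) (x (s n))" if "m < n" for m n
  proof -
    obtain k where "n = Suc k" using \<open>m < n\<close> by (cases n) auto
    with \<open>m < n\<close> have k: "n = Suc k" "m \<le> k" by auto
    then have "s m \<le> s k" using mono by (simp add: strict_mono_less_eq)
    then show ?thesis using s(2) k by simp
  qed
  with e(1) mono that show thesis by blast
qed

text \<open>Three cases: a convergent subsequence with limit \<open>p\<close>, an unbounded
  sequence, or a sequence that is bounded from some index on and has a separated subsequence. In the
  last two, \<open>p = 0\<close> adds nothing to the set.\<close>

lemma escapes_subsequence:
  fixes x :: "nat \<Rightarrow> 'a::banach"
  obtains s :: "nat \<Rightarrow> nat" and p c where "strict_mono s" "c > 0" "p = 0 \<or> (\<lambda>n. x (s n)) \<longlonglongrightarrow> p"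
    "escapes (\<lambda>n. x (s n)) {0, p} c"
proof (cases "\<exists>s. strict_mono s \<and> convergent (\<lambda>n. x (s n))")
  case True
  then obtain s p where "strict_mono s" "(\<lambda>n. x (s n)) \<longlonglongrightarrow> p" by (auto simp: convergent_def)
  then show thesis using that[of s "1/2" p] escapes_of_convergent[of _ p "{0, p}"] by simp
next
  case nconv: False
  show thesis
  proof (cases "\<forall>B N. \<exists>n\<ge>N. B < norm (x n)")
    case True
    then have ex: "\<exists>n>N. B < norm (x n)" for N B by (meson Suc_le_lessD)
    obtain s where s: "\<And>n. real n < norm (x (s n))" "\<And>n. s n < s (Suc n)"
      using dependent_nat_choice[of "\<lambda>n m. real n < norm (x m)" "\<lambda>_ m m'. m < m'"] ex by metis
    then have "strict_mono s" by (simp add: strict_mono_Suc_iff)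
    then show thesis using that[of s "1/2" 0] escapes_of_norm_at_top[of "\<lambda>n. x (s n)"] s(1) by simp
  next
    case False
    then obtain B N where BN: "\<And>n. n \<ge> N \<Longrightarrow> norm (x n) \<le> B" by (meson not_le)
    have *: "\<not> convergent (\<lambda>n. x (r n + N))" if "strict_mono r" for r :: "nat \<Rightarrow> nat"
    proof -
      have "strict_mono (\<lambda>n. r n + N)" using that by (simp add: strict_mono_def)
      then show ?thesis using nconv by blast
    qed
    obtain e and s :: "nat \<Rightarrow> nat" where s: "e > 0" "strict_mono s" "\<And>m n. m < n \<Longrightarrow> e < dist (x (s m + N)) (x (s n + N))"
      using separated_subsequence[of "\<lambda>n. x (n + N)", OF *] by metis
    have "B \<ge> 0" using BN[of N] norm_ge_zero[of "x N"] by linarith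
    have "escapes (\<lambda>n. x (s n + N)) {0} (e / 2 / (B + 1))"
      by (rule escapes_of_separated[OF s(1,3)]) (auto intro: BN)
    moreover have "strict_mono (\<lambda>n. s n + N)" using s(2) by (simp add: strict_mono_def)
    moreover have "e / 2 / (B + 1) > 0" using s(1) \<open>B \<ge> 0\<close> by simp
    ultimately show thesis using that[of "\<lambda>n. s n + N" "e / 2 / (B + 1)" 0] by simp
  qed
qed

text \<open>One coordinate is treated at a time. Escape survives a further subsequence, a larger set
  and a smaller constant, so the earlier coordinates are not disturbed. The points added are 0 or
  limits of points of the closed set \<open>D\<close>.\<close>

lemma escapes_subsequence_finite:
  fixes x :: "nat \<Rightarrow> nat \<Rightarrow> 'a::banach"
  assumes "closed D" "0 \<in> D" "\<And>n i. x n i \<in> D"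
  shows "\<exists>(s :: nat \<Rightarrow> nat) P c. strict_mono s \<and> finite P \<and> 0 \<in> P \<and> P \<subseteq> D \<and> c > 0 \<and>
    (\<forall>i<k. escapes (\<lambda>n. x (s n) i) P c)"
proof (induction k)
  case 0
  show ?case using assms(2) by (intro exI[of _ id] exI[of _ "{0}"] exI[of _ 1]) (auto simp: strict_mono_def)
next
  case (Suc k)
  then obtain s P c where s: "strict_mono s" "finite P" "0 \<in> P" "P \<subseteq> D" "c > 0"
    "\<And>i. i < k \<Longrightarrow> escapes (\<lambda>n. x (s n) i) P c" by blast
  obtain t :: "nat \<Rightarrow> nat" and p d where t: "strict_mono t" "d > 0" "p = 0 \<or> (\<lambda>n. x (s (t n)) k) \<longlonglongrightarrow> p"
    "escapes (\<lambda>n. x (s (t n)) k) {0, p} d"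
    by (rule escapes_subsequence[of "\<lambda>n. x (s n) k"])
  have "p \<in> D" using t(3) assms(2) closed_sequentially[OF assms(1), of "\<lambda>n. x (s (t n)) k"] assms(3) by blast
  have "escapes (\<lambda>n. x (s (t n)) i) (insert p P) (min c d)" if "i < Suc k" for i
  proof (cases "i = k")
    case True
    then show ?thesis using escapes_mono[OF t(4)] s t by auto
  next
    case False
    then have "escapes (\<lambda>n. x (s (t n)) i) P c" using escapes_subseq[OF s(6) t(1)] that by simp
    then show ?thesis using s t by (auto intro: escapes_mono)
  qed
  moreover have "strict_mono (\<lambda>n. s (t n))" using s(1) t(1) by (simp add: strict_mono_def)
  ultimately show ?case using s t \<open>p \<in> D\<close>
    by (intro exI[of _ "\<lambda>n. s (t n)"] exI[of _ "insert p P"] exI[of _ "min c d"]) auto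
qed

text \<open>Because the constant in \<open>escapes\<close> is uniform in \<open>u\<close>, a greedy
  choice separates each term from all earlier terms. Separation from later terms follows by the
  triangle inequality with a smaller constant.\<close>

lemma scattered_subsequence:
  fixes x :: "nat \<Rightarrow> nat \<Rightarrow> 'a::banach"
  assumes "closed D" "0 \<in> D" "\<And>n i. x n i \<in> D"
  obtains s :: "nat \<Rightarrow> nat" and P c where "strict_mono s" "finite P" "0 \<in> P" "P \<subseteq> D" "0 < c" "c \<le> 1"
    "\<And>m n i j. m \<noteq> n \<Longrightarrow> i < k \<Longrightarrow> j < k \<Longrightarrow>
      c * infdist (x (s n) i) P \<le> dist (x (s n) i) (x (s m) j)"
proof -
  obtain s :: "nat \<Rightarrow> nat" and P c where s: "strict_mono s" "finite P" "0 \<in> P" "P \<subseteq> D" "c > 0"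
    and esc: "\<And>i. i < k \<Longrightarrow> escapes (\<lambda>n. x (s n) i) P c"
    using escapes_subsequence_finite[of D x k, OF assms] by blast
  define Q where "Q m n \<longleftrightarrow> (\<forall>i\<in>{..<k}. \<forall>j\<in>{..<k}.
    c * infdist (x (s n) i) P \<le> dist (x (s n) i) (x (s m) j))" for m n
  have *: "\<forall>\<^sub>F n in sequentially. Q m n" for m
    unfolding Q_def using esc by (intro eventually_ball_finite ballI) (auto simp: escapes_def)
  obtain r :: "nat \<Rightarrow> nat" where r: "strict_mono r" "\<And>m n. m < n \<Longrightarrow> Q (r m) (r n)"
    using greedy_subsequence[of Q, OF *] by metis
  \<comment> \<open>If \<open>v\<close> is a later point, then \<open>infdist u P \<le> infdist v P
    + dist u v \<le> (1 / c + 1) * dist u v\<close>; this is the inverse of that factor.\<close>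
  define c' where "c' = c / (1 + c)"
  have c': "0 < c'" "c' \<le> 1" "c' \<le> c" "c' * (1 / c + 1) = 1"
    using \<open>c > 0\<close> add_pos_pos[OF \<open>c > 0\<close> mult_pos_pos[OF \<open>c > 0\<close> \<open>c > 0\<close>]]
    by (auto simp: c'_def field_simps)
  show thesis
  proof (rule that[of "\<lambda>n. s (r n)" P c'])
    show "strict_mono (\<lambda>n. s (r n))" using s(1) r(1) by (simp add: strict_mono_def)
    fix m n i j :: nat assume ij: "m \<noteq> n" "i < k" "j < k"
    let ?u = "x (s (r n)) i" and ?v = "x (s (r m)) j"
    show "c' * infdist ?u P \<le> dist ?u ?v"
    proof (cases "m < n")
      case True
      then have "c * infdist ?u P \<le> dist ?u ?v" using r(2) ij by (simp add: Q_def)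
      then show ?thesis using mult_right_mono[OF c'(3) infdist_nonneg[of ?u P]] by simp
    next
      case False
      then have "c * infdist ?v P \<le> dist ?v ?u" using r(2)[of n m] ij by (simp add: Q_def)
      then have "infdist ?v P \<le> 1 / c * dist ?u ?v" using \<open>c > 0\<close> by (simp add: field_simps dist_commute)
      moreover have "infdist ?u P \<le> infdist ?v P + dist ?u ?v" by (rule infdist_triangle)
      ultimately have "infdist ?u P \<le> (1 / c + 1) * dist ?u ?v" by (simp add: ring_distribs)
      then have "c' * infdist ?u P \<le> c' * ((1 / c + 1) * dist ?u ?v)" using c'(1) by (intro mult_left_mono) auto
      also have "\<dots> = dist ?u ?v" by (simp add: c'(4) flip: mult.assoc)
      finally show ?thesis .
    qed
  qed (use s c' in auto)
qed

section \<open>Truncation with disjoint supports\<close>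

text \<open>If \<open>A\<close> and \<open>B\<close> are \<open>c\<close>-separated relative to the distance from \<open>P\<close>, the factor \<open>4 / c\<close> makes the
  bumps of \<open>A\<close> and \<open>B\<close> disjointly supported, however far the two sets are from \<open>P\<close>.\<close>

definition bump :: "'a::metric_space set \<Rightarrow> real \<Rightarrow> 'a set \<Rightarrow> 'a \<Rightarrow> real"
  where "bump P c A v = max 0 (infdist v P - 4 / c * infdist v A)"

lemma bump_lipschitz:
  assumes "c > 0"
  shows "\<bar>bump P c A u - bump P c A v\<bar> \<le> (1 + 4 / c) * dist u v"
proof -
  have "4 / c * \<bar>infdist u A - infdist v A\<bar> \<le> 4 / c * dist u v"
    using assms by (intro mult_left_mono infdist_triangle_abs) auto
  then have "\<bar>4 / c * infdist u A - 4 / c * infdist v A\<bar> \<le> 4 / c * dist u v"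
    using assms unfolding right_diff_distrib[symmetric] abs_mult by simp
  then show ?thesis
    using infdist_triangle_abs[of u P v] unfolding bump_def by (simp add: ring_distribs)
qed

lemma bump_eq_infdist: "u \<in> A \<Longrightarrow> bump P c A u = infdist u P"
  by (simp add: bump_def infdist_nonneg)

lemma infdist_lessD:
  assumes "infdist v A < r" "A \<noteq> {}"
  obtains a where "a \<in> A" "dist v a < r"
  using assms cInf_lessD[of "dist v ` A" r] by (auto simp: infdist_notempty)

text \<open>Put \<open>d = infdist v P\<close>. Where both bumps are positive, \<open>v\<close> is
  within \<open>c * d / 4\<close> of some \<open>u\<close> in \<open>A\<close> and some
  \<open>w\<close> in \<open>B\<close>. Then \<open>u\<close> is still at distance at least
  \<open>3 / 4 * d\<close> from \<open>P\<close>, so separation demands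
  \<open>dist u w \<ge> 3 / 4 * c * d\<close>, against \<open>dist u w < c * d / 2\<close>.\<close>

lemma bump_disjoint:
  assumes c: "0 < c" "c \<le> 1" and ne: "A \<noteq> {}" "B \<noteq> {}"
    and sep: "\<And>u w. u \<in> A \<Longrightarrow> w \<in> B \<Longrightarrow> c * infdist u P \<le> dist u w"
  shows "bump P c A v = 0 \<or> bump P c B v = 0"
proof (rule ccontr)
  assume "\<not> ?thesis"
  then have "4 / c * infdist v A < infdist v P" "4 / c * infdist v B < infdist v P"
    by (auto simp: bump_def max_def split: if_splits)
  then have lt: "infdist v A < c * infdist v P / 4" "infdist v B < c * infdist v P / 4"
    using c by (auto simp: field_simps)
  obtain u where u: "u \<in> A" "dist v u < c * infdist v P / 4" using infdist_lessD[OF lt(1) ne(1)] .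
  obtain w where w: "w \<in> B" "dist v w < c * infdist v P / 4" using infdist_lessD[OF lt(2) ne(2)] .
  have "c * infdist v P \<le> 1 * infdist v P" using c(2) infdist_nonneg by (rule mult_right_mono)
  moreover have "infdist v P \<le> infdist u P + dist v u" by (rule infdist_triangle)
  ultimately have "3 / 4 * infdist v P \<le> infdist u P" using u(2) by simp
  then have "c * (3 / 4 * infdist v P) \<le> c * infdist u P" using c(1) by (intro mult_left_mono) auto
  also have "\<dots> \<le> dist u w" using sep u w by blast
  also have "\<dots> \<le> dist v u + dist v w" by (rule dist_triangle3)
  finally have "3 / 4 * (c * infdist v P) \<le> dist v u + dist v w" by (simp add: mult.left_commute)
  moreover have "c * infdist v P \<ge> 0" using c(1) infdist_nonneg[of v P] by simp
  ultimately show False using u(2) w(2) by linarith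
qed

text \<open>Truncation to a square instead of a disc: the real and imaginary parts are cut off
  separately, so the Lipschitz estimate reduces to real numbers.\<close>

definition clamp_complex :: "real \<Rightarrow> complex \<Rightarrow> complex"
  where "clamp_complex w z = Complex (max (- w) (min w (Re z))) (max (- w) (min w (Im z)))"

lemma clamp_complex_lipschitz:
  "norm (clamp_complex w z - clamp_complex w' z') \<le> 2 * \<bar>w - w'\<bar> + 2 * norm (z - z')"
proof -
  have clamp: "\<bar>max (- w) (min w t) - max (- w') (min w' t')\<bar> \<le> \<bar>w - w'\<bar> + \<bar>t - t'\<bar>" for t t' :: real
    by linarith
  have "norm (clamp_complex w z - clamp_complex w' z')
      \<le> \<bar>Re (clamp_complex w z - clamp_complex w' z')\<bar> + \<bar>Im (clamp_complex w z - clamp_complex w' z')\<bar>"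
    by (rule cmod_le)
  also have "\<dots> \<le> (\<bar>w - w'\<bar> + \<bar>Re z - Re z'\<bar>) + (\<bar>w - w'\<bar> + \<bar>Im z - Im z'\<bar>)"
    using clamp[of "Re z" "Re z'"] clamp[of "Im z" "Im z'"] by (simp add: clamp_complex_def)
  finally show ?thesis using abs_Re_le_cmod[of "z - z'"] abs_Im_le_cmod[of "z - z'"] by simp
qed

lemma clamp_complex_eq:
  assumes "norm z \<le> w" shows "clamp_complex w z = z"
  using assms abs_Re_le_cmod[of z] abs_Im_le_cmod[of z]
  by (auto simp: clamp_complex_def complex_eq_iff)

lemma clamp_complex_0 [simp]: "clamp_complex 0 z = 0"
  by (simp add: clamp_complex_def complex_eq_iff)

lemma norm_pair_le_infdist:
  assumes "norm h \<le> 1" "P \<noteq> {}" and van: "\<And>p. p \<in> P \<Longrightarrow> pair h p = 0"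
  shows "norm (pair h v) \<le> infdist v P"
proof (rule ccontr)
  assume "\<not> ?thesis"
  then obtain p where p: "p \<in> P" "dist v p < norm (pair h v)"
    using infdist_lessD[of v P] assms(2) by (metis not_le)
  have "norm (pair h v) = norm (pair h (v - p))"
    using van[OF p(1)] by (simp add: bounded_clinear_diff[OF bounded_clinear_pair])
  also have "\<dots> \<le> norm h * norm (v - p)" by (rule norm_pair_le)
  also have "\<dots> \<le> 1 * norm (v - p)" using assms(1) by (intro mult_right_mono) auto
  finally show False using p(2) by (simp add: dist_norm)
qed

section \<open>Coordinate operators from disjointly supported functions\<close>

lemma sum_if_at_most_one_le:
  fixes c :: real
  assumes "finite J" "c \<ge> 0" and one: "\<And>m n. m \<in> J \<Longrightarrow> n \<in> J \<Longrightarrow> p m \<Longrightarrow> p n \<Longrightarrow> m = n"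
  shows "(\<Sum>n\<in>J. if p n then c else 0) \<le> c"
proof -
  have "(\<Sum>n\<in>J. if p n then c else 0) = real (card {n\<in>J. p n}) * c"
    using assms(1) by (simp add: sum.If_cases Int_def)
  also have "\<dots> \<le> 1 * c"
  proof (intro mult_right_mono assms(2))
    have "card {n\<in>J. p n} \<le> 1" using assms(1) one by (simp add: card_le_Suc0_iff_eq)
    then show "real (card {n\<in>J. p n}) \<le> 1" by simp
  qed
  finally show ?thesis by simp
qed

text \<open>Unimodular factors turn the sum of moduli into the pairing of \<open>\<nu>\<close> with
  one function \<open>G\<close>. Any two points meet the supports of at most two of the
  \<open>g n\<close>, so \<open>G\<close> is \<open>2 * L\<close>-Lipschitz however many terms it
  has.\<close>

lemma sum_norm_pair_disjoint_le:
  fixes g :: "nat \<Rightarrow> 'a::pointed_metric_space lip0"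
  assumes "finite J" and L: "\<And>n. norm (g n) \<le> L"
    and disj: "\<And>m n x. m \<noteq> n \<Longrightarrow> lip0_apply (g m) x = 0 \<or> lip0_apply (g n) x = 0"
  shows "(\<Sum>n\<in>J. norm (pair (g n) \<nu>)) \<le> 2 * L * norm \<nu>"
proof -
  have "L \<ge> 0" using L[of undefined] norm_ge_zero order_trans by blast
  define \<theta> where "\<theta> n = (if pair (g n) \<nu> = 0 then 0 else of_real (norm (pair (g n) \<nu>)) / pair (g n) \<nu>)" for n
  have \<theta>: "norm (\<theta> n) \<le> 1" "\<theta> n * pair (g n) \<nu> = of_real (norm (pair (g n) \<nu>))" for n
    by (auto simp: \<theta>_def norm_divide)
  define G where "G = (\<Sum>n\<in>J. \<theta> n *\<^sub>C g n)"
  have G: "pair G \<mu> = (\<Sum>n\<in>J. \<theta> n * pair (g n) \<mu>)" for \<mu>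
    unfolding G_def by (simp add: bounded_clinear_sum[OF bounded_clinear_pair_left]
        bounded_clinear_scaleC[OF bounded_clinear_pair_left] scaleC_complex_def)
  have G_apply: "lip0_apply G x = (\<Sum>n\<in>J. \<theta> n * lip0_apply (g n) x)" for x
    using G[of "delta x"] by simp
  have "norm (pair G \<nu>) \<le> 2 * L * norm \<nu>"
  proof (rule functional_bound_of_lipschitz[OF bounded_clinear_pair])
    fix x y :: 'a
    let ?d = "L * dist x y"
    have "norm (pair G (delta x) - pair G (delta y))
        = norm (\<Sum>n\<in>J. \<theta> n * (lip0_apply (g n) x - lip0_apply (g n) y))"
      by (simp add: G_apply sum_subtractf right_diff_distrib)
    \<comment> \<open>A term contributes only if \<open>g n\<close> is nonzero at \<open>x\<close>
      or at \<open>y\<close>, and each of these happens for at most one \<open>n\<close>.\<close>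
    also have "\<dots> \<le> (\<Sum>n\<in>J. (if lip0_apply (g n) x \<noteq> 0 then ?d else 0) + (if lip0_apply (g n) y \<noteq> 0 then ?d else 0))"
    proof (rule sum_norm_le)
      fix n
      let ?D = "lip0_apply (g n) x - lip0_apply (g n) y"
      have "norm (\<theta> n * ?D) \<le> 1 * norm ?D"
        unfolding norm_mult using \<theta>(1) by (intro mult_right_mono) auto
      moreover have "norm ?D \<le> ?d"
        using L[of n] by (intro order_trans[OF norm_lip0_apply_diff_le] mult_right_mono) auto
      moreover have "?d \<ge> 0" using \<open>L \<ge> 0\<close> by simp
      ultimately show "norm (\<theta> n * ?D)
          \<le> (if lip0_apply (g n) x \<noteq> 0 then ?d else 0) + (if lip0_apply (g n) y \<noteq> 0 then ?d else 0)"
        by auto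
    qed
    also have "\<dots> \<le> ?d + ?d"
    proof -
      have "(\<Sum>n\<in>J. if lip0_apply (g n) z \<noteq> 0 then ?d else 0) \<le> ?d" for z
        using assms(1) \<open>L \<ge> 0\<close> disj[of _ _ z] by (intro sum_if_at_most_one_le) (simp, simp, metis)
      then show ?thesis unfolding sum.distrib by (intro add_mono)
    qed
    finally show "norm (pair G (delta x) - pair G (delta y)) \<le> 2 * L * dist x y" by simp
  qed (use \<open>L \<ge> 0\<close> in simp)
  moreover have "pair G \<nu> = of_real (\<Sum>n\<in>J. norm (pair (g n) \<nu>))" by (simp add: G \<theta>(2))
  moreover have "(\<Sum>n\<in>J. norm (pair (g n) \<nu>)) \<ge> 0" by (intro sum_nonneg) auto
  ultimately show ?thesis by (simp only: norm_of_real abs_of_nonneg)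
qed

lemma ell1_analysis:
  fixes \<phi> :: "nat \<Rightarrow> 'a::complex_normed_vector \<Rightarrow> complex"
  assumes lin: "\<And>n. bounded_clinear (\<phi> n)"
    and bd: "\<And>J x. finite J \<Longrightarrow> (\<Sum>n\<in>J. norm (\<phi> n x)) \<le> K * norm x"
  obtains R where "bounded_clinear R" "\<And>x n. ell1_nth (R x) n = \<phi> n x"
proof -
  have sm: "summable (\<lambda>n. norm (\<phi> n x))" for x
    using bd by (intro bounded_imp_summable[where B = "K * norm x"]) auto
  define R where "R x = Abs_ell1 (\<lambda>n. \<phi> n x)" for x
  have R: "ell1_nth (R x) = (\<lambda>n. \<phi> n x)" for x
    unfolding R_def using sm by (intro Abs_ell1_inverse) auto
  have "bounded_clinear R"
  proof (rule bounded_clinearI[where K = K])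
    fix x y c
    show "R (x + y) = R x + R y"
      by (simp add: R plus_ell1.rep_eq bounded_clinear_add[OF lin] flip: ell1_nth_inject)
    show "R (c *\<^sub>C x) = c *\<^sub>C R x"
      by (simp add: R scaleC_ell1.rep_eq bounded_clinear_scaleC[OF lin] scaleC_complex_def flip: ell1_nth_inject)
    show "norm (R x) \<le> K * norm x"
      unfolding norm_ell1.rep_eq R by (rule suminf_le_const[OF sm bd]) simp
  qed
  with R that show thesis by simp
qed

section \<open>Sequences approaching a finite-dimensional subspace\<close>

lemma compact_bounded_combinations:
  fixes Q :: "'a::complex_normed_vector set"
  assumes "finite Q"
  shows "compact {\<Sum>p\<in>Q. c p *\<^sub>C p | c. \<forall>p\<in>Q. norm (c p) \<le> B}"
  using assms
proof (induction Q rule: finite_induct)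
  case empty
  then show ?case by simp
next
  case (insert q Q)
  let ?S = "{\<Sum>p\<in>Q. c p *\<^sub>C p | c. \<forall>p\<in>Q. norm (c p) \<le> B}"
  have eq: "{\<Sum>p\<in>insert q Q. c p *\<^sub>C p | c. \<forall>p\<in>insert q Q. norm (c p) \<le> B}
      = {x + y | x y. x \<in> (\<lambda>z. z *\<^sub>C q) ` cball 0 B \<and> y \<in> ?S}" (is "?L = ?R")
  proof
    show "?L \<subseteq> ?R"
    proof
      fix v assume "v \<in> ?L"
      then obtain c where c: "v = (\<Sum>p\<in>insert q Q. c p *\<^sub>C p)" "\<forall>p\<in>insert q Q. norm (c p) \<le> B" by blast
      then have "v = c q *\<^sub>C q + (\<Sum>p\<in>Q. c p *\<^sub>C p)" using insert.hyps by simp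
      moreover have "c q *\<^sub>C q \<in> (\<lambda>z. z *\<^sub>C q) ` cball 0 B" using c(2) by (intro imageI) simp
      moreover have "(\<Sum>p\<in>Q. c p *\<^sub>C p) \<in> ?S" using c(2) by blast
      ultimately show "v \<in> ?R" by blast
    qed
    show "?R \<subseteq> ?L"
    proof
      fix v assume "v \<in> ?R"
      then obtain z c where zc: "v = z *\<^sub>C q + (\<Sum>p\<in>Q. c p *\<^sub>C p)" "norm z \<le> B" "\<forall>p\<in>Q. norm (c p) \<le> B"
        by auto
      have "(\<Sum>p\<in>Q. (c(q := z)) p *\<^sub>C p) = (\<Sum>p\<in>Q. c p *\<^sub>C p)"
        using insert.hyps by (intro sum.cong) auto
      then have "v = (\<Sum>p\<in>insert q Q. (c(q := z)) p *\<^sub>C p)"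
        using zc insert.hyps by simp
      moreover have "\<forall>p\<in>insert q Q. norm ((c(q := z)) p) \<le> B" using zc by simp
      ultimately show "v \<in> ?L" by blast
    qed
  qed
  have "compact ((\<lambda>z. z *\<^sub>C q) ` cball 0 B)"
    by (intro compact_continuous_image linear_continuous_on bounded_linear_scaleC_left compact_cball)
  from compact_sums[OF this insert.IH] show ?case unfolding eq .
qed

text \<open>Tent functions centred at \<open>p\<close> whose radius does not exceed the distance to
  the other points of \<open>P\<close>. They vanish at the origin because
  \<open>p \<noteq> 0\<close>.\<close>

lemma dual_system_lip0:
  fixes P :: "'a::pointed_metric_space lip_free set"
  assumes P: "finite P" "0 \<in> P" "P \<subseteq> closure (range delta)"
  obtains \<Psi> where "\<And>p q. p \<in> P \<Longrightarrow> q \<in> P \<Longrightarrow> p \<noteq> 0 \<Longrightarrow> pair (\<Psi> p) q = (if q = p then 1 else 0)"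
proof -
  have "\<exists>\<psi>. \<forall>q\<in>P. pair \<psi> q = (if q = p then 1 else 0)" if "p \<in> P" "p \<noteq> 0" for p
  proof -
    obtain d where d: "d > 0" "\<And>q. q \<in> P \<Longrightarrow> q \<noteq> p \<Longrightarrow> d \<le> dist p q"
      using finite_set_avoid[OF P(1), of p] by metis
    define f where "f v = complex_of_real (max 0 (1 - dist v p / d))" for v
    have lip: "norm (f u - f v) \<le> 1 / d * dist u v" for u v
    proof -
      have "\<bar>dist u p / d - dist v p / d\<bar> = \<bar>dist u p - dist v p\<bar> / d"
        using d(1) by (simp flip: diff_divide_distrib)
      also have "\<dots> \<le> dist u v / d"
        using d(1) abs_dist_diff_le[of u p v] by (intro divide_right_mono) (auto simp: dist_commute)
      finally have "\<bar>max 0 (1 - dist u p / d) - max 0 (1 - dist v p / d)\<bar> \<le> dist u v / d" by linarith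
      then show ?thesis unfolding f_def by (simp flip: of_real_diff)
    qed
    have zero: "f q = (if q = p then 1 else 0)" if "q \<in> P" for q
      using d that by (force simp: f_def dist_commute max_def field_simps)
    have nn: "0 \<le> 1 / d" and f0: "f 0 = 0" using d(1) zero[OF P(2)] \<open>p \<noteq> 0\<close> by auto
    obtain \<psi> where "\<And>v. v \<in> closure (range delta) \<Longrightarrow> pair \<psi> v = f v"
      by (rule lip0_of_lipschitz_on_lip_free[OF nn lip f0]) (rule that)
    then show ?thesis using zero P(3) by (intro exI[of _ \<psi>]) auto
  qed
  then show thesis using that by metis
qed

text \<open>The map \<open>proj\<close> interpolates on \<open>P\<close>. Subtracting from
  \<open>g\<close> its interpolant gives a function \<open>h\<close> that vanishes on
  \<open>P\<close>, with norm at most \<open>C\<close>, and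
  \<open>pair g (\<nu> - proj \<nu>) = pair h \<nu>\<close>. So flatness forces
  \<open>\<gamma> n - proj (\<gamma> n)\<close> to 0, while the vectors
  \<open>proj (\<gamma> n)\<close> stay in a compact set.\<close>

lemma flat_sequence_convergent_subsequence:
  fixes \<gamma> :: "nat \<Rightarrow> 'a::pointed_metric_space lip_free"
  assumes P: "finite P" "0 \<in> P" "P \<subseteq> closure (range delta)" and bd: "\<And>n. norm (\<gamma> n) \<le> B"
    and flat: "\<And>\<eta>. \<eta> > 0 \<Longrightarrow> \<exists>N. \<forall>n\<ge>N. \<forall>h. norm h \<le> 1 \<longrightarrow> (\<forall>p\<in>P. pair h p = 0) \<longrightarrow> norm (pair h (\<gamma> n)) \<le> \<eta>"
  shows "\<exists>r. strict_mono r \<and> convergent (\<lambda>n. \<gamma> (r n))"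
proof -
  let ?Q = "P - {0}"
  obtain \<Psi> where \<Psi>: "\<And>p q. p \<in> P \<Longrightarrow> q \<in> P \<Longrightarrow> p \<noteq> 0 \<Longrightarrow> pair (\<Psi> p) q = (if q = p then 1 else 0)"
    by (rule dual_system_lip0[OF P]) blast
  define proj where "proj \<nu> = (\<Sum>p\<in>?Q. pair (\<Psi> p) \<nu> *\<^sub>C p)" for \<nu>
  \<comment> \<open>This bounds the norm of \<open>g\<close> minus its interpolant for every
    \<open>g\<close> in the unit ball.\<close>
  define C where "C = 1 + (\<Sum>p\<in>?Q. norm p * norm (\<Psi> p))"
  have "C > 0" unfolding C_def by (intro add_pos_nonneg sum_nonneg) auto
  have near: "norm (\<nu> - proj \<nu>) \<le> C * \<eta>"
    if "\<eta> > 0" "\<And>h. norm h \<le> 1 \<Longrightarrow> \<forall>p\<in>P. pair h p = 0 \<Longrightarrow> norm (pair h \<nu>) \<le> \<eta>" for \<nu> \<eta>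
  proof (rule norm_lip_free_le)
    fix g :: "'a lip0" assume "norm g \<le> 1"
    define h where "h = g - (\<Sum>p\<in>?Q. pair g p *\<^sub>C \<Psi> p)"
    have ph: "pair h \<mu> = pair g \<mu> - (\<Sum>p\<in>?Q. pair g p * pair (\<Psi> p) \<mu>)" for \<mu>
      unfolding h_def by (simp add: bounded_clinear_diff[OF bounded_clinear_pair_left]
          bounded_clinear_sum[OF bounded_clinear_pair_left]
          bounded_clinear_scaleC[OF bounded_clinear_pair_left] scaleC_complex_def)
    have "pair h q = 0" if "q \<in> P" for q
    proof -
      have "(\<Sum>p\<in>?Q. pair g p * pair (\<Psi> p) q) = (\<Sum>p\<in>?Q. if q = p then pair g p else 0)"
        using \<Psi> that by (intro sum.cong) auto
      also have "\<dots> = pair g q"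
        using P(1) that bounded_clinear_0[OF bounded_clinear_pair[of g]] by simp
      finally show ?thesis by (simp add: ph)
    qed
    moreover have "norm h \<le> C"
    proof -
      have "norm (\<Sum>p\<in>?Q. pair g p *\<^sub>C \<Psi> p) \<le> (\<Sum>p\<in>?Q. norm p * norm (\<Psi> p))"
      proof (rule sum_norm_le)
        fix p
        have "norm (pair g p) \<le> 1 * norm p"
          using \<open>norm g \<le> 1\<close> by (intro order_trans[OF norm_pair_le] mult_right_mono) auto
        then show "norm (pair g p *\<^sub>C \<Psi> p) \<le> norm p * norm (\<Psi> p)"
          by (simp add: norm_scaleC mult_right_mono)
      qed
      then show ?thesis using norm_triangle_ineq4[of g "\<Sum>p\<in>?Q. pair g p *\<^sub>C \<Psi> p"] \<open>norm g \<le> 1\<close>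
        by (simp add: h_def C_def)
    qed
    ultimately have "norm (pair (complex_of_real (1 / C) *\<^sub>C h) \<nu>) \<le> \<eta>"
      using \<open>C > 0\<close> by (intro that(2))
        (auto simp: norm_scaleC norm_divide bounded_clinear_scaleC[OF bounded_clinear_pair_left] scaleC_complex_def)
    then have "norm (pair h \<nu>) \<le> C * \<eta>"
      using \<open>C > 0\<close> by (simp add: bounded_clinear_scaleC[OF bounded_clinear_pair_left]
          scaleC_complex_def norm_mult norm_divide field_simps)
    moreover have "pair g (\<nu> - proj \<nu>) = pair h \<nu>"
      by (simp add: ph proj_def bounded_clinear_diff[OF bounded_clinear_pair] bounded_clinear_sum[OF bounded_clinear_pair]
          bounded_clinear_scaleC[OF bounded_clinear_pair] scaleC_complex_def mult.commute)
    ultimately show "norm (pair g (\<nu> - proj \<nu>)) \<le> C * \<eta>" by simp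
  qed (use \<open>C > 0\<close> that(1) in simp)
  have lim0: "(\<lambda>n. \<gamma> n - proj (\<gamma> n)) \<longlonglongrightarrow> 0"
  proof (rule LIMSEQ_I)
    fix e :: real assume "e > 0"
    then have pos: "e / (2 * C) > 0" using \<open>C > 0\<close> by simp
    from flat[OF this] obtain N where
      N: "\<And>n h. n \<ge> N \<Longrightarrow> norm h \<le> 1 \<Longrightarrow> \<forall>p\<in>P. pair h p = 0 \<Longrightarrow> norm (pair h (\<gamma> n)) \<le> e / (2 * C)" by blast
    have "norm (\<gamma> n - proj (\<gamma> n) - 0) < e" if "n \<ge> N" for n
      using near[OF pos N[OF that]] \<open>C > 0\<close> \<open>e > 0\<close> by simp
    then show "\<exists>N. \<forall>n\<ge>N. norm (\<gamma> n - proj (\<gamma> n) - 0) < e" by blast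
  qed
  define B' where "B' = (\<Sum>p\<in>?Q. norm (\<Psi> p) * B)"
  have "B \<ge> 0" using bd norm_ge_zero order_trans by blast
  have *: "norm (pair (\<Psi> p) (\<gamma> n)) \<le> B'" if "p \<in> ?Q" for p n
  proof -
    have "norm (pair (\<Psi> p) (\<gamma> n)) \<le> norm (\<Psi> p) * B"
      using bd by (intro order_trans[OF norm_pair_le] mult_left_mono) auto
    also have "\<dots> \<le> B'" unfolding B'_def using P(1) \<open>B \<ge> 0\<close> that by (intro member_le_sum) auto
    finally show ?thesis .
  qed
  define Z where "Z = {\<Sum>p\<in>?Q. c p *\<^sub>C p | c. \<forall>p\<in>?Q. norm (c p) \<le> B'}"
  have "proj (\<gamma> n) \<in> Z" for n
    unfolding proj_def Z_def mem_Collect_eq using *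
    by (intro exI[of _ "\<lambda>p. pair (\<Psi> p) (\<gamma> n)"]) simp
  moreover have "compact Z"
    unfolding Z_def using P(1) by (intro compact_bounded_combinations) simp
  ultimately have "\<exists>l\<in>Z. \<exists>r. strict_mono r \<and> ((\<lambda>n. proj (\<gamma> n)) \<circ> r) \<longlonglongrightarrow> l"
    unfolding compact_def by simp
  then obtain l r where r: "strict_mono r" "((\<lambda>n. proj (\<gamma> n)) \<circ> r) \<longlonglongrightarrow> l" by blast
  have "(\<lambda>n. (\<gamma> (r n) - proj (\<gamma> (r n))) + proj (\<gamma> (r n))) \<longlonglongrightarrow> 0 + l"
    using LIMSEQ_subseq_LIMSEQ[OF lim0 r(1)] r(2) by (intro tendsto_add) (auto simp: comp_def)
  then show ?thesis using r(1) by (auto simp: convergent_def)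
qed

section \<open>A biorthogonal system for a sequence without convergent subsequences\<close>

lemma biorthogonal_ell1_operator:
  fixes \<gamma> :: "nat \<Rightarrow> 'n::pointed_metric_space lip_free"
  assumes FS: "\<And>n. \<gamma> n \<in> FS k" and bd: "\<And>n. norm (\<gamma> n) \<le> B"
    and nconv: "\<And>r. strict_mono r \<Longrightarrow> \<not> convergent (\<lambda>n. \<gamma> (r n))"
  obtains r R where "strict_mono r" "bounded_clinear R" "\<And>n. R (\<gamma> (r n)) = ell1_unit n"
proof -
  have "\<exists>a y. \<gamma> n = (\<Sum>i<k. a i *\<^sub>C delta (y i))" for n using FS[of n] by (auto simp: FS_def)
  then obtain a y where ay: "\<And>n. \<gamma> n = (\<Sum>i<k. a n i *\<^sub>C delta (y n i))" by metis
  let ?D = "closure (range delta) :: 'n lip_free set"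
  define x where "x n i = delta (y n i)" for n i
  have xD: "x n i \<in> ?D" for n i unfolding x_def by (intro subsetD[OF closure_subset]) auto
  \<comment> \<open>For \<open>k = 0\<close> every term would be 0 and the sequence would converge.
    Positivity makes the sets \<open>A n\<close> nonempty.\<close>
  have "k > 0"
  proof (rule ccontr)
    assume "\<not> k > 0"
    then have "convergent (\<lambda>n. \<gamma> (id n))" by (simp add: ay convergent_const)
    then show False using nconv[of id] by (simp add: strict_mono_def)
  qed
  have "delta basepoint \<in> ?D" by (rule subsetD[OF closure_subset]) (rule rangeI)
  then have "0 \<in> ?D" by simp
  obtain s :: "nat \<Rightarrow> nat" and P c where s: "strict_mono s" and P: "finite P" "0 \<in> P" "P \<subseteq> ?D" and c: "0 < c" "c \<le> 1"
    and sep: "\<And>m n i j. m \<noteq> n \<Longrightarrow> i < k \<Longrightarrow> j < k \<Longrightarrow>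
      c * infdist (x (s n) i) P \<le> dist (x (s n) i) (x (s m) j)"
    using scattered_subsequence[of ?D x k, OF closed_closure \<open>0 \<in> ?D\<close> xD] by metis
  have "P \<noteq> {}" using P(2) by blast
  define S where "S \<eta> = {n. \<exists>h. norm h \<le> 1 \<and> (\<forall>p\<in>P. pair h p = 0) \<and> \<eta> < norm (pair h (\<gamma> (s n)))}" for \<eta>
  \<comment> \<open>Otherwise the sequence would be flat on \<open>P\<close> and have a convergent
    subsequence.\<close>
  have "\<exists>\<eta>>0. infinite (S \<eta>)"
  proof (rule ccontr)
    assume "\<not> ?thesis"
    then have fin: "finite (S \<eta>)" if "\<eta> > 0" for \<eta> using that by blast
    have "\<exists>N. \<forall>n\<ge>N. \<forall>h. norm h \<le> 1 \<longrightarrow> (\<forall>p\<in>P. pair h p = 0) \<longrightarrow> norm (pair h (\<gamma> (s n))) \<le> \<eta>"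
      if \<eta>: "\<eta> > 0" for \<eta>
    proof -
      obtain N where N: "\<forall>n\<in>S \<eta>. n < N" using fin[OF \<eta>] by (auto simp: finite_nat_set_iff_bounded)
      have "n \<notin> S \<eta>" if "n \<ge> N" for n using N that by (meson not_le)
      then show ?thesis unfolding S_def mem_Collect_eq by (meson not_le)
    qed
    from flat_sequence_convergent_subsequence[of P "\<lambda>n. \<gamma> (s n)", OF P bd this]
    obtain r :: "nat \<Rightarrow> nat" where r: "strict_mono r" "convergent (\<lambda>n. \<gamma> (s (r n)))" by blast
    then have "strict_mono (\<lambda>n. s (r n))" using s by (simp add: strict_mono_def)
    then show False using nconv r(2) by blast
  qed
  then obtain \<eta> where "\<eta> > 0" and inf: "infinite (S \<eta>)" by blast
  obtain t :: "nat \<Rightarrow> nat" where t: "strict_mono t" "\<And>n. t n \<in> S \<eta>"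
    using infinite_enumerate[OF inf] by metis
  define r where "r n = s (t n)" for n
  have "\<exists>h. norm h \<le> 1 \<and> (\<forall>p\<in>P. pair h p = 0) \<and> \<eta> < norm (pair h (\<gamma> (r n)))" for n
    using t(2)[of n] by (simp add: S_def r_def)
  then obtain h where h: "\<And>n. norm (h n) \<le> 1" "\<And>n p. p \<in> P \<Longrightarrow> pair (h n) p = 0"
    "\<And>n. \<eta> < norm (pair (h n) (\<gamma> (r n)))" by metis
  have r: "strict_mono r" using s t(1) by (simp add: r_def strict_mono_def)
  define A where "A n = x (r n) ` {..<k}" for n
  define W where "W n = bump P c (A n)" for n
  have A_ne: "A n \<noteq> {}" for n using \<open>k > 0\<close> by (auto simp: A_def)
  have Wdisj: "W m v = 0 \<or> W n v = 0" if "m \<noteq> n" for m n v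
    unfolding W_def
  proof (rule bump_disjoint[OF c A_ne A_ne])
    have "t m \<noteq> t n" using that t(1) by (simp add: strict_mono_eq)
    then show "c * infdist u P \<le> dist u w" if "u \<in> A m" "w \<in> A n" for u w
      using that sep by (auto simp: A_def r_def)
  qed
  define F where "F n v = clamp_complex (W n v) (pair (h n) v)" for n v
  \<comment> \<open>Clamping costs twice the Lipschitz constant of the bump plus twice that of the
    clamped function, which is at most 1.\<close>
  define L where "L = 2 * (1 + 4 / c) + 2"
  have "L \<ge> 0" using c by (simp add: L_def)
  have Flip: "norm (F n u - F n v) \<le> L * dist u v" for n u v
  proof -
    have "norm (pair (h n) u - pair (h n) v) \<le> 1 * norm (u - v)"
      using h(1)[of n] norm_pair_le[of "h n" "u - v"] mult_right_mono[of "norm (h n)" 1 "norm (u - v)"]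
      by (simp add: bounded_clinear_diff[OF bounded_clinear_pair])
    moreover have "\<bar>W n u - W n v\<bar> \<le> (1 + 4 / c) * dist u v"
      unfolding W_def using c(1) by (rule bump_lipschitz)
    ultimately have "2 * \<bar>W n u - W n v\<bar> + 2 * norm (pair (h n) u - pair (h n) v) \<le> L * dist u v"
      by (simp add: L_def dist_norm ring_distribs)
    then show ?thesis unfolding F_def by (rule order_trans[OF clamp_complex_lipschitz])
  qed
  have "F n 0 = 0" for n
    using clamp_complex_eq[of 0 "W n 0"]
    by (simp add: F_def W_def bump_def bounded_clinear_0[OF bounded_clinear_pair])
  have "\<exists>g. norm g \<le> L \<and> (\<forall>v\<in>?D. pair g v = F n v)" for n
    by (rule lip0_of_lipschitz_on_lip_free[OF \<open>L \<ge> 0\<close> Flip \<open>F n 0 = 0\<close>]) blast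
  then obtain g where g: "\<And>n. norm (g n) \<le> L" "\<And>n v. v \<in> ?D \<Longrightarrow> pair (g n) v = F n v" by metis
  have pg: "pair (g n) (\<gamma> (r m)) = (\<Sum>i<k. a (r m) i * F n (x (r m) i))" for m n
    using g(2)[OF xD] by (simp add: ay bounded_clinear_sum[OF bounded_clinear_pair] x_def
        bounded_clinear_scaleC[OF bounded_clinear_pair] scaleC_complex_def del: pair_delta)
  have diag: "pair (g n) (\<gamma> (r n)) = pair (h n) (\<gamma> (r n))" for n
  proof -
    \<comment> \<open>On \<open>A n\<close> the bump equals the distance from \<open>P\<close>,
      which dominates the modulus of \<open>h n\<close>, so clamping changes nothing there.\<close>
    have "F n u = pair (h n) u" if "u \<in> A n" for u
      using norm_pair_le_infdist[of "h n" P u] h \<open>P \<noteq> {}\<close> that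
      by (simp add: F_def W_def bump_eq_infdist clamp_complex_eq)
    then have "F n (x (r n) i) = pair (h n) (x (r n) i)" if "i < k" for i
      using that by (simp add: A_def)
    then have "pair (g n) (\<gamma> (r n)) = (\<Sum>i<k. a (r n) i * pair (h n) (x (r n) i))"
      unfolding pg by simp
    also have "\<dots> = pair (h n) (\<gamma> (r n))"
      by (simp add: ay bounded_clinear_sum[OF bounded_clinear_pair] x_def
          bounded_clinear_scaleC[OF bounded_clinear_pair] scaleC_complex_def del: pair_delta)
    finally show ?thesis .
  qed
  have off: "pair (g n) (\<gamma> (r m)) = 0" if "m \<noteq> n" for m n
  proof -
    have "F n u = 0" if u: "u \<in> A m" for u
    proof -
      \<comment> \<open>If bump \<open>n\<close> were nonzero at \<open>u\<close>, bump
        \<open>m\<close> would vanish there. On \<open>A m\<close> the latter is the distance from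
        \<open>P\<close>, and at distance 0 from \<open>P\<close> every bump vanishes.\<close>
      have "W n u = 0"
      proof (cases "W n u = 0")
        case False
        then have "W m u = 0" using Wdisj[OF \<open>m \<noteq> n\<close>, of u] by simp
        then have "infdist u P = 0" using u by (simp add: W_def bump_eq_infdist)
        moreover have "0 \<le> 4 / c * infdist u (A n)" using c(1) infdist_nonneg[of u "A n"] by simp
        ultimately show ?thesis unfolding W_def bump_def by linarith
      qed
      then show ?thesis by (simp add: F_def)
    qed
    then show ?thesis by (simp add: pg A_def)
  qed
  \<comment> \<open>Dividing by the diagonal entry, whose modulus exceeds \<eta>, gives coordinates
    that are exactly biorthogonal and keeps the sums of moduli bounded.\<close>
  define \<phi> where "\<phi> n \<nu> = pair (g n) \<nu> / pair (g n) (\<gamma> (r n))" for n \<nu>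
  have \<phi>: "bounded_clinear (\<phi> n)" for n
  proof -
    have "\<phi> n = (\<lambda>\<nu>. pair ((1 / pair (g n) (\<gamma> (r n))) *\<^sub>C g n) \<nu>)"
      by (simp add: \<phi>_def fun_eq_iff bounded_clinear_scaleC[OF bounded_clinear_pair_left] scaleC_complex_def)
    then show ?thesis using bounded_clinear_pair by simp
  qed
  have "(\<Sum>n\<in>J. norm (\<phi> n \<nu>)) \<le> (2 * L / \<eta>) * norm \<nu>" if "finite J" for J \<nu>
  proof -
    have "norm (\<phi> n \<nu>) \<le> norm (pair (g n) \<nu>) / \<eta>" for n
      unfolding \<phi>_def norm_divide diag
      using h(3)[of n] \<open>\<eta> > 0\<close> by (intro divide_left_mono mult_pos_pos) auto
    then have "(\<Sum>n\<in>J. norm (\<phi> n \<nu>)) \<le> (\<Sum>n\<in>J. norm (pair (g n) \<nu>)) / \<eta>"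
      by (simp add: sum_mono sum_divide_distrib)
    also have "\<dots> \<le> 2 * L * norm \<nu> / \<eta>"
    proof (intro divide_right_mono sum_norm_pair_disjoint_le that g(1))
      fix m n :: nat and z :: 'n assume "m \<noteq> n"
      have "delta z \<in> ?D" by (intro subsetD[OF closure_subset]) auto
      then have "lip0_apply (g i) z = F i (delta z)" for i using g(2)[of "delta z" i] by simp
      then show "lip0_apply (g m) z = 0 \<or> lip0_apply (g n) z = 0"
        using Wdisj[OF \<open>m \<noteq> n\<close>, of "delta z"] by (auto simp: F_def)
    qed (use \<open>\<eta> > 0\<close> in simp)
    finally show ?thesis by simp
  qed
  from ell1_analysis[OF \<phi> this] obtain R where R: "bounded_clinear R" "\<And>\<nu> n. ell1_nth (R \<nu>) n = \<phi> n \<nu>"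
    by blast
  have "pair (g n) (\<gamma> (r n)) \<noteq> 0" for n using h(3)[of n] \<open>\<eta> > 0\<close> by (auto simp: diag)
  then have "ell1_nth (R (\<gamma> (r m))) n = ell1_nth (ell1_unit m) n" for m n
    by (auto simp: R \<phi>_def off ell1_unit.rep_eq)
  then have "R (\<gamma> (r m)) = ell1_unit m" for m by (simp add: fun_eq_iff flip: ell1_nth_inject)
  with r R(1) that show thesis by blast
qed

section \<open>Equivalence of the properties\<close>

text \<open>Since \<open>R\<close> sends the images of the chosen molecules to unit vectors,
  \<open>R (T (S a)) = a\<close> is checked in each coordinate by applying a bounded functional to
  the series of \<open>S a\<close> term by term.\<close>

lemma not_compact_imp_fixes_complemented_copy_of_ell1:
  fixes T :: "'m::pointed_metric_space lip_free \<Rightarrow> 'n::pointed_metric_space lip_free"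
  assumes bT: "bounded_clinear T" and FS: "T ` FS 2 \<subseteq> FS k" and "\<not> compact_operator T"
  shows "fixes_complemented_copy_of_ell1 T"
proof -
  have "\<not> compact (closure (T ` molecules))"
    using assms(3) compact_operator_of_molecules[OF bT] by blast
  from sequence_without_convergent_subsequence[OF this]
  obtain \<gamma> :: "nat \<Rightarrow> 'n lip_free" where \<gamma>: "\<And>n. \<gamma> n \<in> T ` molecules"
    and nconv: "\<And>r :: nat \<Rightarrow> nat. strict_mono r \<Longrightarrow> \<not> convergent (\<lambda>n. \<gamma> (r n))"
    by metis
  then obtain m where m: "\<And>n. m n \<in> molecules" "\<And>n. \<gamma> n = T (m n)"
    unfolding image_iff by metis
  obtain K where K: "K > 0" "\<And>x. norm (T x) \<le> K * norm x" using bounded_clinear_bound[OF bT] by blast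
  have "\<gamma> n \<in> FS k" for n using FS m molecules_subset_FS by blast
  moreover have "norm (\<gamma> n) \<le> K" for n
  proof -
    have "K * norm (m n) \<le> K * 1" using K(1) norm_molecule_le[OF m(1)] by (intro mult_left_mono) auto
    then show ?thesis using K(2)[of "m n"] by (simp only: m(2))
  qed
  ultimately obtain r :: "nat \<Rightarrow> nat" and R where r: "strict_mono r" and R: "bounded_clinear R" "\<And>n. R (\<gamma> (r n)) = ell1_unit n"
    using biorthogonal_ell1_operator[of \<gamma> k K] nconv by metis
  obtain S where S: "bounded_clinear S" "\<And>a. (\<lambda>n. ell1_nth a n *\<^sub>C m (r n)) sums S a"
    using ell1_synthesis[of "\<lambda>n. m (r n)" 1] norm_molecule_le[OF m(1)] by auto
  have "R (T (S a)) = a" for a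
  proof -
    have "ell1_nth (R (T (S a))) j = ell1_nth a j" for j
    proof -
      let ?\<phi> = "\<lambda>x. ell1_nth (R (T x)) j"
      have \<phi>: "bounded_clinear ?\<phi>"
        by (rule bounded_clinear_compose[OF bounded_clinear_ell1_nth bounded_clinear_compose[OF R(1) bT]])
      have "(\<lambda>n. ?\<phi> (ell1_nth a n *\<^sub>C m (r n))) sums ?\<phi> (S a)"
        by (rule bounded_linear.sums[OF bounded_clinear_bounded_linear[OF \<phi>] S(2)])
      moreover have "?\<phi> (ell1_nth a n *\<^sub>C m (r n)) = (if n = j then ell1_nth a j else 0)" for n
        by (simp add: bounded_clinear_scaleC[OF \<phi>] flip: m(2)) (simp add: R(2) ell1_unit.rep_eq scaleC_complex_def)
      ultimately have "(\<lambda>n. if n = j then ell1_nth a j else 0) sums ?\<phi> (S a)" by simp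
      moreover have "(\<lambda>n. if n = j then ell1_nth a j else 0) sums ell1_nth a j" by (rule sums_single)
      ultimately show ?thesis by (rule sums_unique2)
    qed
    then show ?thesis by (simp add: fun_eq_iff flip: ell1_nth_inject)
  qed
  then show ?thesis
    unfolding fixes_complemented_copy_of_ell1_iff[OF bT] using R(1) S(1) by blast
qed

theorem theorem4p1:
  fixes T :: "'m::pointed_metric_space lip_free \<Rightarrow> 'n::pointed_metric_space lip_free"
  assumes "bounded_clinear T"
    and "\<exists>k. T ` FS 2 \<subseteq> FS k"
  shows "(compact_operator T \<longleftrightarrow> weakly_compact_operator T) \<and>
    (compact_operator T \<longleftrightarrow> super_strictly_singular T) \<and>
    (compact_operator T \<longleftrightarrow> super_strictly_cosingular T) \<and>
    (compact_operator T \<longleftrightarrow> strictly_singular T) \<and>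
    (compact_operator T \<longleftrightarrow> strictly_cosingular T) \<and>
    (compact_operator T \<longleftrightarrow> \<not> fixes_copy_of_ell1 T) \<and>
    (compact_operator T \<longleftrightarrow> \<not> fixes_complemented_copy_of_ell1 T)"
proof (cases "compact_operator T")
  case True
  have "\<exists>f. cdual_apply f y \<noteq> 0" if "y \<noteq> 0" for y :: "'n lip_free"
  proof -
    obtain f where "norm y \<le> 2 * norm (cdual_apply f y)"
      using lip_free_norming_functional[of y] by blast
    then show ?thesis using that by (intro exI[of _ f]) auto
  qed
  then have "weakly_compact_operator T" by (rule compact_imp_weakly_compact[OF True])
  moreover have "super_strictly_singular T"
    by (rule compact_imp_super_strictly_singular[OF assms(1) True lip_free_norming_functional])
  moreover from this have "strictly_singular T" by (rule super_strictly_singular_imp_strictly_singular)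
  moreover from this have "\<not> fixes_copy_of_ell1 T" by (rule strictly_singular_imp_not_fixes_copy_of_ell1)
  moreover from this have "\<not> fixes_complemented_copy_of_ell1 T"
    using fixes_complemented_imp_fixes by blast
  ultimately show ?thesis
    using True compact_imp_super_strictly_cosingular[OF True]
      compact_imp_strictly_cosingular[OF assms(1) True] by blast
next
  case False
  then have fc: "fixes_complemented_copy_of_ell1 T"
    using assms not_compact_imp_fixes_complemented_copy_of_ell1 by blast
  then obtain R S where RS: "bounded_clinear R" "bounded_clinear S" "\<And>a::ell1. R (T (S a)) = a"
    unfolding fixes_complemented_copy_of_ell1_iff[OF assms(1)] by blast
  have "fixes_copy_of_ell1 T" using fc by (rule fixes_complemented_imp_fixes)
  moreover from this have "\<not> strictly_singular T"
    using strictly_singular_imp_not_fixes_copy_of_ell1 by blast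
  moreover from this have "\<not> super_strictly_singular T"
    using super_strictly_singular_imp_strictly_singular by blast
  moreover note factor_ell1_not_weakly_compact[OF RS] factor_ell1_not_strictly_cosingular[OF RS]
    factor_ell1_not_super_strictly_cosingular[OF RS]
  ultimately show ?thesis using False fc by blast
qed

end
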